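(* Let $\mathcal{F}$ be a saturated formation containing the class $\mathcal{U}$ of all supersoluble groups, and let $N$ be a normal subgroup of a finite group $G$ such that $G/N \in \mathcal{F}$. Suppose that, for every prime $p$ dividing the order of $N$ and for every Sylow $p$-subgroup $P$ of $N$, every maximal subgroup of $P$ satisfies the partial $\Pi$-property in $N_{G}(P)$ and the derived subgroup $P'$ of $P$ satisfies the partial $\Pi$-property in $G$. Then $G \in \mathcal{F}$.
   Context: All groups are finite. A class $\mathcal{F}$ of (finite) groups is a formation if it is closed under taking homomorphic images and subdirect products. A formation $\mathcal{F}$ is saturated if $G/\Phi(G) \in \mathcal{F}$ implies $G \in \mathcal{F}$, where $\Phi(G)$ is the Frattini subgroup of $G$. For a set $\pi$ of primes, a positive integer is a $\pi$-number if all its prime divisors belong to $\pi$ (so $1$ is always a $\pi$-number, and is the only one when $\pi$ is empty). For a finite group $X$, $\pi(X)$ denotes the set of primes dividing $|X|$. Partial $\Pi$-property: a subgroup $H$ of a finite group $G$ satisfies the partial $\Pi$-property in $G$ if there exists a chief series $1 = G_{0} < G_{1} < \cdots < G_{n} = G$ of $G$ such that for every $i$ with $1 \leq i \leq n$, the index $|G/G_{i-1} : N_{G/G_{i-1}}(HG_{i-1}/G_{i-1} \cap G_{i}/G_{i-1})|$ is a $\pi(HG_{i-1}/G_{i-1} \cap G_{i}/G_{i-1})$-number. *)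

theory Defs
  imports
    "HOL-Algebra.Group_Action"
    "HOL-Algebra.Generated_Groups"
    "HOL-Algebra.Elementary_Groups"
    "HOL-Algebra.Product_Groups"
    "HOL-Computational_Algebra.Primes"
begin

text \<open>
  HOL has no type of all finite groups.  Every finite group is isomorphic to one whose carrier
  is a set of natural numbers, so a class of finite groups, which is always understood to be
  closed under isomorphism, is represented by its members of type \<^typ>\<open>nat monoid\<close>.
  A group over an arbitrary type belongs to the class if it is isomorphic to one of these.
\<close>

definition in_class :: "('a, 'b) monoid_scheme \<Rightarrow> nat monoid set \<Rightarrow> bool"
  where "in_class G \<F> \<longleftrightarrow> (\<exists>H\<in>\<F>. G \<cong> H)"

definition finite_group :: "('a, 'b) monoid_scheme \<Rightarrow> bool"
  where "finite_group G \<longleftrightarrow> group G \<and> finite (carrier G)"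

definition subdirect_product ::
    "'i set \<Rightarrow> ('i \<Rightarrow> ('a, 'b) monoid_scheme) \<Rightarrow> ('i \<Rightarrow> 'a) set \<Rightarrow> bool"
  where "subdirect_product I A S \<longleftrightarrow>
    subgroup S (product_group I A) \<and> (\<forall>i\<in>I. (\<lambda>x. x i) ` S = carrier (A i))"

text \<open>
  Closure under isomorphism is the special case of closure under homomorphic images in which
  the epimorphism is bijective.
\<close>

definition formation :: "nat monoid set \<Rightarrow> bool"
  where "formation \<F> \<longleftrightarrow>
    (\<forall>G\<in>\<F>. finite_group G) \<and>
    (\<forall>G\<in>\<F>. \<forall>H::nat monoid. group H \<and> epi G H \<noteq> {} \<longrightarrow> H \<in> \<F>) \<and>
    (\<forall>(I::nat set) A S. finite I \<and> I \<noteq> {} \<and> (\<forall>i\<in>I. A i \<in> \<F>) \<and> subdirect_product I A S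
       \<longrightarrow> in_class ((product_group I A)\<lparr>carrier := S\<rparr>) \<F>)"

definition maximal_subgroup :: "'a set \<Rightarrow> ('a, 'b) monoid_scheme \<Rightarrow> bool"
  where "maximal_subgroup M G \<longleftrightarrow>
    subgroup M G \<and> M \<noteq> carrier G \<and>
    (\<forall>K. subgroup K G \<and> M \<subseteq> K \<longrightarrow> K = M \<or> K = carrier G)"

text \<open>The trivial group has no maximal subgroup and is its own Frattini subgroup.\<close>

definition frattini :: "('a, 'b) monoid_scheme \<Rightarrow> 'a set"
  where "frattini G = carrier G \<inter> \<Inter> {M. maximal_subgroup M G}"

definition saturated :: "nat monoid set \<Rightarrow> bool"
  where "saturated \<F> \<longleftrightarrow>
    (\<forall>G::nat monoid. finite_group G \<and> in_class (G Mod frattini G) \<F> \<longrightarrow> G \<in> \<F>)"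

definition supersoluble :: "('a, 'b) monoid_scheme \<Rightarrow> bool"
  where "supersoluble G \<longleftrightarrow>
    (\<exists>(n::nat) S. S 0 = {\<one>\<^bsub>G\<^esub>} \<and> S n = carrier G \<and>
       (\<forall>i\<le>n. S i \<lhd> G) \<and>
       (\<forall>i<n. S i \<subseteq> S (Suc i) \<and> cyclic_group (G\<lparr>carrier := S (Suc i)\<rparr> Mod S i)))"

definition supersoluble_groups :: "nat monoid set"
  where "supersoluble_groups = {G. finite_group G \<and> supersoluble G}"

definition sylow_subgroup :: "nat \<Rightarrow> 'a set \<Rightarrow> ('a, 'b) monoid_scheme \<Rightarrow> bool"
  where "sylow_subgroup p P G \<longleftrightarrow>
    prime p \<and> subgroup P G \<and> card P = p ^ multiplicity p (order G)"

definition pi_number :: "nat set \<Rightarrow> nat \<Rightarrow> bool"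
  where "pi_number \<pi> n \<longleftrightarrow> n > 0 \<and> (\<forall>p. prime p \<and> p dvd n \<longrightarrow> p \<in> \<pi>)"

definition pi_of :: "'a set \<Rightarrow> nat set"
  where "pi_of X = {p. prime p \<and> p dvd card X}"

definition chief_series :: "('a, 'b) monoid_scheme \<Rightarrow> nat \<Rightarrow> (nat \<Rightarrow> 'a set) \<Rightarrow> bool"
  where "chief_series G n S \<longleftrightarrow>
    S 0 = {\<one>\<^bsub>G\<^esub>} \<and> S n = carrier G \<and>
    (\<forall>i\<le>n. S i \<lhd> G) \<and>
    (\<forall>i<n. S i \<subset> S (Suc i) \<and>
       (\<forall>L. L \<lhd> G \<and> S i \<subseteq> L \<and> L \<subseteq> S (Suc i) \<longrightarrow> L = S i \<or> L = S (Suc i)))"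

text \<open>
  For a normal subgroup \<open>K\<close> of \<open>G\<close> and a subgroup \<open>X\<close> of \<open>G\<close> containing \<open>K\<close>, this is
  \<open>X/K\<close> as a subset of the carrier of \<^term>\<open>G Mod K\<close>.
\<close>

definition quot_subgroup :: "('a, 'b) monoid_scheme \<Rightarrow> 'a set \<Rightarrow> 'a set \<Rightarrow> 'a set set"
  where "quot_subgroup G X K = (\<lambda>x. K #>\<^bsub>G\<^esub> x) ` X"

definition subgroup_index :: "('a, 'b) monoid_scheme \<Rightarrow> 'a set \<Rightarrow> nat"
  where "subgroup_index G H = card (rcosets\<^bsub>G\<^esub> H)"

definition partial_Pi_property :: "'a set \<Rightarrow> ('a, 'b) monoid_scheme \<Rightarrow> bool"
  where "partial_Pi_property H G \<longleftrightarrow>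
    subgroup H G \<and>
    (\<exists>n S. chief_series G n S \<and>
       (\<forall>i<n. let Q = G Mod S i;
                  X = quot_subgroup G (H <#>\<^bsub>G\<^esub> S i) (S i) \<inter> quot_subgroup G (S (Suc i)) (S i)
              in pi_number (pi_of X) (subgroup_index Q (normalizer Q X))))"

end

theory Submission
  imports Defs
    "HOL-Algebra.Sylow" "HOL-Algebra.Multiplicative_Group" "HOL-Algebra.SndIsomorphismGrp"
    "HOL-Number_Theory.Residue_Primitive_Roots"
begin

text \<open>
  Call \<open>N\<close> hypercyclically embedded in \<open>G\<close> if there is a chain of normal subgroups of \<open>G\<close> from \<open>1\<close>
  to \<open>N\<close> all of whose factors have prime order. Such an \<open>N\<close> with \<open>G/N \<in> \<F>\<close> gives \<open>G \<in> \<F>\<close>: for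
  \<open>V\<close> normal of prime order, either \<open>V \<le> \<Phi>(G)\<close> and saturation applies, or \<open>V\<close> has a complement \<open>M\<close>,
  the group \<open>G/C\<^sub>M(V)\<close> is supersoluble, and \<open>G\<close> is a subdirect product of \<open>G/V\<close> and \<open>G/C\<^sub>M(V)\<close>.

  That \<open>N\<close> is hypercyclically embedded is proved by induction on its order. Let \<open>p\<close> be the smallest
  prime divisor of \<open>|N|\<close> and \<open>P\<close> a Sylow \<open>p\<close>-subgroup of \<open>N\<close>. The hypothesis on maximal subgroups makes
  \<open>P\<close> hypercyclically embedded in \<open>N\<^sub>G(P)\<close>, so by minimality of \<open>p\<close> the \<open>p'\<close>-elements of \<open>N\<^sub>N(P)\<close>
  centralize \<open>P\<close>. The hypothesis on \<open>P'\<close> says that \<open>P'\<close> covers or avoids every factor of some chief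
  series of \<open>G\<close>. Going down this series one gets a normal \<open>p\<close>-complement \<open>L\<close> of \<open>N\<close>: by transfer it
  is enough that fusion is trivial in the relevant section, which follows from Sylow's theorem in
  the avoided case, and from \<open>P = P\<^sub>0 P' \<Longrightarrow> P = P\<^sub>0\<close> in the covered case. The induction hypothesis
  applies to \<open>L\<close>, whose Sylow subgroups are Sylow in \<open>N\<close>, and \<open>G = N\<^sub>G(P) L\<close> transports the chain
  of \<open>P\<close> to \<open>N/L\<close>.
\<close>

section \<open>Group actions of p-groups and conjugation\<close>

text \<open>For a \<open>p\<close>-subgroup \<open>H\<close> the index in the partial \<Pi>-property
  is a power of \<open>p\<close>, so at every chief factor some subgroup of \<open>p\<close>-power
  index normalizes \<open>(H <#> S i) \<inter> S (Suc i)\<close>. This becomes decisive once a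
  subgroup of index prime to \<open>p\<close> normalizes the same set: the normalizer is then the
  whole group. For maximal subgroups of \<open>P\<close> that second subgroup is a Sylow
  \<open>p\<close>-subgroup of \<open>N_G(P)\<close>, so they must be chosen with an invariant
  trace; for \<open>P'\<close> it is \<open>N_G(P)\<close> itself. The obstacle is that the property
  only grants some chief series, which depends on the subgroup and need not pass through
  \<open>P\<close> or \<open>N\<close>. Hence the series is intersected with \<open>P\<close> or
  \<open>N\<close>. Since the hypotheses are not visibly inherited by quotients, the descent stays
  in one group, and statements about a section \<open>A/K\<close> are written for elements of
  \<open>A\<close> modulo \<open>K\<close>. The prime \<open>p\<close> is the smallest one because a
  group of order \<open>p\<close> has no nontrivial automorphism whose order is a power of a larger
  prime.\<close>

lemma (in group) card_fixed_points_mod: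
  assumes R: "subgroup R G" and p: "prime p" and cR: "card R = p ^ k" and fE: "finite E"
    and cl: "\<And>g e. g \<in> R \<Longrightarrow> e \<in> E \<Longrightarrow> f g e \<in> E"
    and one: "\<And>e. e \<in> E \<Longrightarrow> f \<one> e = e"
    and mult: "\<And>g h e. g \<in> R \<Longrightarrow> h \<in> R \<Longrightarrow> e \<in> E \<Longrightarrow> f (g \<otimes> h) e = f g (f h e)"
  shows "card {e \<in> E. \<forall>g\<in>R. f g e = e} mod p = card E mod p"
proof -
  let ?R = "G\<lparr>carrier := R\<rparr>" and ?\<phi> = "\<lambda>g. restrict (f g) E"
  interpret R: group ?R by (rule subgroup.subgroup_is_group[OF R group_axioms])
  have iR: "inv g \<in> R" if "g \<in> R" for g using that R by (simp add: subgroup.m_inv_closed)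
  note gR = subgroup.mem_carrier[OF R]
  have bij: "?\<phi> g \<in> Bij E" if g: "g \<in> R" for g
  proof -
    have a: "f (inv g) (f g e) = e" if "e \<in> E" for e
      using mult[OF iR[OF g] g that] one[OF that] gR[OF g] by simp
    have b: "f g (f (inv g) e) = e" if "e \<in> E" for e
      using mult[OF g iR[OF g] that] one[OF that] gR[OF g] by simp
    have "bij_betw (?\<phi> g) E E"
      by (rule bij_betw_byWitness[where f' = "f (inv g)"]) (use a b cl g iR in auto)
    thus ?thesis by (simp add: Bij_def)
  qed
  \<comment> \<open>\<open>f\<close> is an action only for arguments in \<open>R\<close> and
    \<open>E\<close>; restricting each \<open>f g\<close> to \<open>E\<close> makes it an element of
    \<open>Bij E\<close>, whose members are extensional.\<close>
  interpret A: group_action ?R E ?\<phi>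
  proof (intro group_action.intro group_hom.intro group_hom_axioms.intro)
    show "group (BijGroup E)" by (rule group_BijGroup)
    show "group ?R" by (rule R.group_axioms)
    show "?\<phi> \<in> hom ?R (BijGroup E)"
    proof (rule homI)
      fix x assume "x \<in> carrier ?R" thus "?\<phi> x \<in> carrier (BijGroup E)"
        using bij by (simp add: BijGroup_def)
    next
      fix x y assume "x \<in> carrier ?R" "y \<in> carrier ?R"
      hence xy: "x \<in> R" "y \<in> R" by auto
      have "?\<phi> (x \<otimes> y) = compose E (?\<phi> x) (?\<phi> y)"
        using mult cl xy by (auto simp: compose_def restrict_def fun_eq_iff)
      thus "?\<phi> (x \<otimes>\<^bsub>?R\<^esub> y) = ?\<phi> x \<otimes>\<^bsub>BijGroup E\<^esub> ?\<phi> y"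
        using bij xy by (simp add: BijGroup_def)
    qed
  qed
  let ?O = "orbits ?R E ?\<phi>" and ?F = "{e \<in> E. \<forall>g\<in>R. f g e = e}"
  have orb_dvd: "card o1 dvd p ^ k" if "o1 \<in> ?O" for o1
  proof -
    from that obtain x where x: "x \<in> E" "o1 = orbit ?R ?\<phi> x" by (auto simp: orbits_def)
    have "card o1 * card (stabilizer ?R ?\<phi> x) = p ^ k"
      using A.orbit_stabilizer_theorem[OF x(1)] x(2) cR by (simp add: order_def)
    thus ?thesis by (metis dvd_triv_left)
  qed
  have finO: "finite ?O"
    using fE A.orbits_coverture by (metis finite_UnionD)
  have sum: "card E = (\<Sum>o1\<in>?O. card o1)"
    using A.disjoint_sum[OF fE, of "\<lambda>_. 1::nat"] by simp
  let ?O1 = "{o1\<in>?O. card o1 = 1}"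
  \<comment> \<open>Orbit sizes divide \<open>p ^ k\<close>, so orbits other than singletons
    contribute multiples of \<open>p\<close>; the singletons in \<open>?O1\<close> correspond to the
    fixed points.\<close>
  have big: "p dvd card o1" if o: "o1 \<in> ?O - ?O1" for o1
  proof -
    from o orb_dvd obtain j where j: "card o1 = p ^ j" by (auto simp: divides_primepow_nat[OF p])
    moreover have "j \<noteq> 0"
    proof
      assume "j = 0"
      with j have "card o1 = 1" by simp
      with o show False by simp
    qed
    ultimately show ?thesis by (simp add: dvd_power)
  qed
  have split: "card E = (\<Sum>o1\<in>?O1. card o1) + (\<Sum>o1\<in>?O - ?O1. card o1)"
    unfolding sum by (subst sum.subset_diff[OF _ finO, of ?O1]) auto
  have s1: "(\<Sum>o1\<in>?O1. card o1) = card ?O1" by simp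
  have O1: "?O1 = (\<lambda>e. {e}) ` ?F"
  proof (intro equalityI subsetI)
    fix o1 assume "o1 \<in> ?O1"
    then obtain x where x: "x \<in> E" "o1 = orbit ?R ?\<phi> x" "card o1 = 1" by (auto simp: orbits_def)
    have "x \<in> o1" using A.orbit_refl[OF x(1)] x(2) by simp
    with x(3) have o: "o1 = {x}" by (metis card_1_singletonE singletonD)
    have "f g x = x" if "g \<in> R" for g
    proof -
      have "f g x \<in> o1" unfolding x(2) orbit_def using that x(1) by auto
      thus ?thesis using o by simp
    qed
    thus "o1 \<in> (\<lambda>e. {e}) ` ?F" using o x(1) by auto
  next
    fix o1 assume "o1 \<in> (\<lambda>e. {e}) ` ?F"
    then obtain e where e: "e \<in> E" "\<forall>g\<in>R. f g e = e" "o1 = {e}" by auto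
    have "orbit ?R ?\<phi> e = {e}" using e subgroup.one_closed[OF R] by (auto simp: orbit_def intro!: exI[of _ \<one>])
    thus "o1 \<in> ?O1" using e unfolding orbits_def by auto
  qed
  have "card ?O1 = card ?F" unfolding O1 by (rule card_image) simp
  hence "card E = card ?F + (\<Sum>o1\<in>?O - ?O1. card o1)" using split s1 by linarith
  moreover have "p dvd (\<Sum>o1\<in>?O - ?O1. card o1)" by (rule dvd_sum) (use big in blast)
  ultimately show ?thesis by (auto elim!: dvdE)
qed

definition (in group) conjg :: "'a \<Rightarrow> 'a \<Rightarrow> 'a"
  where "conjg g x = g \<otimes> x \<otimes> inv g"

context group begin

lemma conjg_closed [simp]: "\<lbrakk>g \<in> carrier G; x \<in> carrier G\<rbrakk> \<Longrightarrow> conjg g x \<in> carrier G"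
  by (simp add: conjg_def)

lemma conjg_mult: "\<lbrakk>g \<in> carrier G; x \<in> carrier G; y \<in> carrier G\<rbrakk> \<Longrightarrow> conjg g (x \<otimes> y) = conjg g x \<otimes> conjg g y"
  by (simp add: conjg_def m_assoc inv_solve_left)

lemma conjg_conjg: "\<lbrakk>g \<in> carrier G; h \<in> carrier G; x \<in> carrier G\<rbrakk> \<Longrightarrow> conjg (g \<otimes> h) x = conjg g (conjg h x)"
  by (simp add: conjg_def m_assoc inv_mult_group)

lemma conjg_one [simp]: "x \<in> carrier G \<Longrightarrow> conjg \<one> x = x"
  by (simp add: conjg_def)

lemma conjg_one_right [simp]: "g \<in> carrier G \<Longrightarrow> conjg g \<one> = \<one>"
  by (simp add: conjg_def)

lemma conjg_inv_conjg [simp]: "\<lbrakk>g \<in> carrier G; x \<in> carrier G\<rbrakk> \<Longrightarrow> conjg (inv g) (conjg g x) = x"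
  by (simp flip: conjg_conjg)

lemma conjg_conjg_inv [simp]: "\<lbrakk>g \<in> carrier G; x \<in> carrier G\<rbrakk> \<Longrightarrow> conjg g (conjg (inv g) x) = x"
  by (simp flip: conjg_conjg)

lemma conjg_pow: "\<lbrakk>g \<in> carrier G; x \<in> carrier G\<rbrakk> \<Longrightarrow> conjg g (x [^] (n::nat)) = conjg g x [^] n"
  by (induction n) (simp_all add: conjg_mult)

lemma inj_on_conjg: "\<lbrakk>g \<in> carrier G; X \<subseteq> carrier G\<rbrakk> \<Longrightarrow> inj_on (conjg g) X"
  by (rule inj_on_inverseI[where g = "conjg (inv g)"]) auto

lemma card_conjg: "\<lbrakk>g \<in> carrier G; X \<subseteq> carrier G\<rbrakk> \<Longrightarrow> card (conjg g ` X) = card X"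
  by (simp add: card_image inj_on_conjg)

lemma conjg_hom: "g \<in> carrier G \<Longrightarrow> conjg g \<in> hom G G"
  by (simp add: hom_def conjg_mult)

lemma subgroup_conjg:
  assumes "g \<in> carrier G" "subgroup H G" shows "subgroup (conjg g ` H) G"
proof -
  interpret group_hom G G "conjg g"
    by (simp add: group_hom_def group_hom_axioms_def conjg_hom assms group_axioms)
  show ?thesis using subgroup_img_is_subgroup assms(2) by blast
qed

lemma conjg_image_conjg:
  "\<lbrakk>g \<in> carrier G; h \<in> carrier G; X \<subseteq> carrier G\<rbrakk> \<Longrightarrow> conjg (g \<otimes> h) ` X = conjg g ` conjg h ` X"
  by (auto simp: image_image conjg_conjg subset_iff intro!: image_cong)

lemma normal_conjg: "\<lbrakk>A \<lhd> G; g \<in> carrier G; a \<in> A\<rbrakk> \<Longrightarrow> conjg g a \<in> A"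
  by (simp add: conjg_def normal.inv_op_closed2)

lemma normal_conjgI: "\<lbrakk>subgroup A G; \<And>g a. \<lbrakk>g \<in> carrier G; a \<in> A\<rbrakk> \<Longrightarrow> conjg g a \<in> A\<rbrakk> \<Longrightarrow> A \<lhd> G"
  by (simp add: conjg_def normal_inv_iff)

lemma mem_rcos_iff:
  "\<lbrakk>subgroup B G; x \<in> carrier G; y \<in> carrier G\<rbrakk> \<Longrightarrow> x \<in> B #> y \<longleftrightarrow> x \<otimes> inv y \<in> B"
  by (simp add: subgroup.rcos_module[OF _ group_axioms])

lemma rcos_eq_iff:
  assumes "subgroup B G" "x \<in> carrier G" "y \<in> carrier G"
  shows "B #> x = B #> y \<longleftrightarrow> x \<otimes> inv y \<in> B"
  by (metis assms mem_rcos_iff repr_independence rcos_self)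

lemma conjg_rcos:
  assumes B: "subgroup B G" and g: "g \<in> carrier G" and a: "a \<in> carrier G" and gB: "conjg g ` B = B"
  shows "conjg g ` (B #> a) = B #> conjg g a"
proof -
  have "conjg g ` (B #> a) = (\<lambda>b. conjg g b \<otimes> conjg g a) ` B"
    using subgroup.mem_carrier[OF B] g a
    by (auto simp: r_coset_def conjg_mult image_iff)
  also have "\<dots> = (\<lambda>b. b \<otimes> conjg g a) ` (conjg g ` B)" by (simp add: image_image)
  finally show ?thesis by (auto simp: gB r_coset_def)
qed

lemma conjg_image_eqI:
  assumes "finite X" "X \<subseteq> carrier G" "g \<in> carrier G" "\<And>x. x \<in> X \<Longrightarrow> conjg g x \<in> X"
  shows "conjg g ` X = X"
  using assms by (intro card_subset_eq) (auto simp: card_conjg)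

text \<open>Lagrange's theorem for a section. The cosets are taken in the ambient group and written
  as an image over \<open>A\<close>, so indices multiply without changing the group; the later
  counting in sections uses this form.\<close>

lemma card_subgroup_cosets:
  assumes A: "subgroup A G" and B: "subgroup B G" and BA: "B \<subseteq> A"
  shows "card A = card ((\<lambda>a. B #> a) ` A) * card B"
proof -
  interpret A: group "G\<lparr>carrier := A\<rparr>" by (rule subgroup.subgroup_is_group[OF A group_axioms])
  have B': "subgroup B (G\<lparr>carrier := A\<rparr>)" by (rule subgroup_incl[OF B A BA])
  have "card (rcosets\<^bsub>G\<lparr>carrier := A\<rparr>\<^esub> B) * card B = order (G\<lparr>carrier := A\<rparr>)"
    by (rule A.lagrange[OF B'])
  moreover have "rcosets\<^bsub>G\<lparr>carrier := A\<rparr>\<^esub> B = (\<lambda>a. B #> a) ` A"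
    by (auto simp: RCOSETS_def)
  ultimately show ?thesis by (simp add: order_def)
qed

lemma card_subgroup_pos: "\<lbrakk>subgroup A G; finite A\<rbrakk> \<Longrightarrow> 0 < card A"
  using subgroup.one_closed card_gt_0_iff by blast

lemma card_subgroup_dvd:
  assumes "subgroup A G" "subgroup B G" "B \<subseteq> A"
  shows "card B dvd card A"
  using card_subgroup_cosets[OF assms] by simp

lemma card_fixed_cosets_mod:
  assumes W: "subgroup W G" and p: "prime p" and cW: "card W = p ^ k"
    and A: "subgroup A G" and B: "subgroup B G" and BA: "B \<subseteq> A" and fA: "finite A"
    and WA: "\<And>w a. w \<in> W \<Longrightarrow> a \<in> A \<Longrightarrow> conjg w a \<in> A"
    and WB: "\<And>w b. w \<in> W \<Longrightarrow> b \<in> B \<Longrightarrow> conjg w b \<in> B"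
  shows "card {C \<in> (\<lambda>a. B #> a) ` A. \<forall>w\<in>W. conjg w ` C = C} mod p = (card A div card B) mod p"
proof -
  let ?E = "(\<lambda>a. B #> a) ` A"
  have fB: "finite B" using fA BA by (rule finite_subset[rotated])
  have cE: "card ?E = card A div card B"
    using card_subgroup_cosets[OF A B BA] card_subgroup_pos[OF B fB] by simp
  have sub: "B \<subseteq> carrier G" "A \<subseteq> carrier G" "W \<subseteq> carrier G"
    using A B W by (auto dest: subgroup.subset)
  have wB: "conjg w ` B = B" if "w \<in> W" for w
    by (rule conjg_image_eqI) (use that WB fB sub in auto)
  have E: "conjg w ` (B #> a) = B #> conjg w a" if "w \<in> W" "a \<in> A" for w a
    by (rule conjg_rcos[OF B _ _ wB]) (use that sub in auto)
  have Ec: "C \<subseteq> carrier G" if "C \<in> ?E" for C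
    using that sub by (auto simp: r_coset_def)
  have "card {C \<in> ?E. \<forall>w\<in>W. conjg w ` C = C} mod p = card ?E mod p"
  proof (rule card_fixed_points_mod[OF W p cW])
    show "finite ?E" using fA by simp
    show "conjg g ` C \<in> ?E" if "g \<in> W" "C \<in> ?E" for g C
      using that E WA by auto
    show "conjg \<one> ` C = C" if "C \<in> ?E" for C
      using Ec[OF that] by (force simp: subset_iff image_iff)
    show "conjg (g \<otimes> h) ` C = conjg g ` conjg h ` C" if "g \<in> W" "h \<in> W" "C \<in> ?E" for g h C
      using that sub Ec by (intro conjg_image_conjg) auto
  qed
  thus ?thesis using cE by simp
qed

text \<open>The number of cosets of \<open>B\<close> in \<open>A\<close> fixed by \<open>W\<close>
  is divisible by \<open>p\<close>, and \<open>B\<close> itself is one of them, so there is another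
  fixed coset. This is the section form of the fact that a \<open>p\<close>-group acting on a
  nontrivial \<open>p\<close>-group fixes a nontrivial element.\<close>

lemma p_group_centralizes_mod:
  assumes W: "subgroup W G" and p: "prime p" and cW: "card W = p ^ k"
    and A: "subgroup A G" and B: "subgroup B G" and BA: "B \<subseteq> A" and fA: "finite A"
    and WA: "\<And>w a. w \<in> W \<Longrightarrow> a \<in> A \<Longrightarrow> conjg w a \<in> A"
    and WB: "\<And>w b. w \<in> W \<Longrightarrow> b \<in> B \<Longrightarrow> conjg w b \<in> B"
    and dv: "p dvd card A div card B"
  shows "\<exists>z\<in>A - B. \<forall>w\<in>W. conjg w z \<in> B #> z"
proof -
  let ?F = "{C \<in> (\<lambda>a. B #> a) ` A. \<forall>w\<in>W. conjg w ` C = C}"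
  have sub: "B \<subseteq> carrier G" "A \<subseteq> carrier G" "W \<subseteq> carrier G"
    using A B W by (auto dest: subgroup.subset)
  have fB: "finite B" using fA BA by (rule finite_subset[rotated])
  have "p dvd card ?F"
    using card_fixed_cosets_mod[OF W p cW A B BA fA WA WB] dv by (auto simp: dvd_eq_mod_eq_0)
  moreover have "B \<in> ?F"
  proof -
    have "B = B #> \<one>" using sub by (simp add: coset_mult_one)
    moreover have "conjg w ` B = B" if "w \<in> W" for w
      by (rule conjg_image_eqI) (use that WB fB sub in auto)
    ultimately show ?thesis using subgroup.one_closed[OF A] by auto
  qed
  moreover have "finite ?F" using fA by simp
  ultimately have "card ?F \<noteq> 1"
    using p by auto
  hence "?F \<noteq> {B}" by (metis One_nat_def card_1_singleton_iff)
  with \<open>B \<in> ?F\<close> obtain C where C: "C \<in> ?F" "C \<noteq> B" by blast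
  then obtain z where z: "z \<in> A" "C = B #> z" by auto
  have zG: "z \<in> carrier G" using z sub by auto
  have "z \<notin> B" using C z by (metis B coset_join2 zG)
  moreover have "conjg w z \<in> B #> z" if "w \<in> W" for w
    using C(1) z that rcos_self[OF zG B] by blast
  ultimately show ?thesis using z by blast
qed

end

section \<open>Sylow subgroups\<close>

text \<open>The Sylow condition is phrased by an index prime to \<open>p\<close> instead of an exact
  exponent, so that passing between intermediate groups is plain divisibility. In the applications
  \<open>N\<close> is a subgroup, which makes the truncating \<open>div\<close> exact. If
  \<open>p\<close> does not divide \<open>card N\<close>, then \<open>P\<close> is trivial.\<close>

definition (in group) sylow_in :: "nat \<Rightarrow> 'a set \<Rightarrow> 'a set \<Rightarrow> bool"
  where "sylow_in p P N \<longleftrightarrow> prime p \<and> subgroup P G \<and> P \<subseteq> N \<and> (\<exists>k. card P = p ^ k) \<and> \<not> p dvd card N div card P"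

context group begin

lemma sylow_inD:
  assumes "sylow_in p P N"
  shows "prime p" "subgroup P G" "P \<subseteq> N" "\<exists>k. card P = p ^ k" "\<not> p dvd card N div card P"
  using assms by (auto simp: sylow_in_def)

lemma sylow_in_exists:
  assumes N: "subgroup N G" and fN: "finite N" and p: "prime p"
  shows "\<exists>P. sylow_in p P N"
proof -
  interpret N: group "G\<lparr>carrier := N\<rparr>" by (rule subgroup.subgroup_is_group[OF N group_axioms])
  have "card N \<noteq> 0" using card_subgroup_pos[OF N fN] by simp
  then obtain m where m: "card N = p ^ multiplicity p (card N) * m" "\<not> p dvd m"
    using multiplicity_decompose'[of "card N" p] p by (metis not_prime_unit)
  have "\<exists>H. subgroup H (G\<lparr>carrier := N\<rparr>) \<and> card H = p ^ multiplicity p (card N)"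
    by (rule sylow_thm[OF p N.group_axioms]) (use m fN in \<open>simp_all add: order_def\<close>)
  then obtain H where H: "subgroup H (G\<lparr>carrier := N\<rparr>)" "card H = p ^ multiplicity p (card N)" by blast
  have "card N div card H = m"
    using m(1) H(2) p by (metis nonzero_mult_div_cancel_left not_prime_0 power_not_zero)
  moreover have "subgroup H G" by (rule incl_subgroup[OF N H(1)])
  moreover have "H \<subseteq> N" using subgroup.subset[OF H(1)] by simp
  ultimately show ?thesis using H p m by (auto simp: sylow_in_def)
qed

lemma sylow_in_iff_sylow_subgroup:
  assumes N: "subgroup N G" and fN: "finite N"
  shows "sylow_subgroup p P (G\<lparr>carrier := N\<rparr>) \<longleftrightarrow> sylow_in p P N"
proof -
  have pos: "card N \<noteq> 0" using card_subgroup_pos[OF N fN] by simp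
  show ?thesis
  proof
    assume "sylow_subgroup p P (G\<lparr>carrier := N\<rparr>)"
    hence p: "prime p" and P: "subgroup P (G\<lparr>carrier := N\<rparr>)" "card P = p ^ multiplicity p (card N)"
      by (auto simp: sylow_subgroup_def order_def)
    obtain m where m: "card N = p ^ multiplicity p (card N) * m" "\<not> p dvd m"
      using multiplicity_decompose'[of "card N" p] p pos by (metis not_prime_unit)
    have "card N div card P = m"
      using m(1) P(2) p by (metis nonzero_mult_div_cancel_left not_prime_0 power_not_zero)
    moreover have "subgroup P G" by (rule incl_subgroup[OF N P(1)])
    moreover have "P \<subseteq> N" using subgroup.subset[OF P(1)] by simp
    ultimately show "sylow_in p P N" using P p m by (auto simp: sylow_in_def)
  next
    assume R: "sylow_in p P N"
    then obtain k where k: "card P = p ^ k" by (auto simp: sylow_in_def)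
    note R' = sylow_inD[OF R]
    have "card N = card P * (card N div card P)"
      using card_subgroup_dvd[OF N R'(2,3)] by simp
    hence "multiplicity p (card N) = k"
      using R'(5) R'(1) k card_subgroup_dvd[OF N R'(2,3)]
      by (metis multiplicity_eqI mult_dvd_mono nonzero_mult_div_cancel_left dvd_mult_div_cancel dvd_refl mult.commute power_Suc
          not_prime_0 power_not_zero dvd_times_left_cancel_iff)
    thus "sylow_subgroup p P (G\<lparr>carrier := N\<rparr>)"
      using R' k subgroup_incl[OF R'(2) N R'(3)] by (simp add: sylow_subgroup_def order_def)
  qed
qed

text \<open>\<open>Q\<close> acts by right multiplication on the cosets of \<open>P\<close> in
  \<open>N\<close>, whose number is prime to \<open>p\<close>, so a coset \<open>P #> a\<close> is
  fixed; then \<open>a\<close> conjugates \<open>Q\<close> into \<open>P\<close>. The factor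
  \<open>inv q\<close> turns right multiplication into a left action.\<close>

lemma p_subgroup_conj_into_sylow:
  assumes N: "subgroup N G" and fN: "finite N" and P: "sylow_in p P N"
    and Q: "subgroup Q G" "Q \<subseteq> N" "card Q = p ^ k"
  shows "\<exists>g\<in>N. conjg g ` Q \<subseteq> P"
proof -
  note P' = sylow_inD[OF P]
  let ?E = "(\<lambda>a. P #> a) ` N"
  have NG: "N \<subseteq> carrier G" and PG: "P \<subseteq> carrier G" and QG: "Q \<subseteq> carrier G"
    using N P'(2) Q(1) by (auto dest: subgroup.subset)
  have cN: "card N = card ?E * card P" by (rule card_subgroup_cosets[OF N P'(2,3)])
  have "0 < card P" using card_subgroup_pos P' fN finite_subset by metis
  hence cE: "card ?E = card N div card P" using cN by simp
  have Pc: "P #> a #> b = P #> (a \<otimes> b)" if "a \<in> N" "b \<in> N" for a b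
    using that PG NG by (intro coset_mult_assoc) auto
  have iN: "inv a \<in> N" if "a \<in> N" for a using that N by (simp add: subgroup.m_inv_closed)
  have mN: "a \<otimes> b \<in> N" if "a \<in> N" "b \<in> N" for a b using that N by (simp add: subgroup.m_closed)
  have "card {C \<in> ?E. \<forall>q\<in>Q. C #> inv q = C} mod p = card ?E mod p"
  proof (rule card_fixed_points_mod[OF Q(1) P'(1) Q(3)])
    show "finite ?E" using fN by simp
    show "C #> inv q \<in> ?E" if "q \<in> Q" "C \<in> ?E" for q C
      using that Pc iN mN Q(2) by auto
    show "C #> inv \<one> = C" if "C \<in> ?E" for C
      using that PG NG by (auto simp: coset_mult_assoc subset_iff)
    show "C #> inv (g \<otimes> h) = C #> inv h #> inv g" if "g \<in> Q" "h \<in> Q" "C \<in> ?E" for g h C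
    proof -
      from that obtain a where a: "a \<in> N" "C = P #> a" by auto
      have "g \<in> N" "h \<in> N" "g \<in> carrier G" "h \<in> carrier G" "a \<in> carrier G" using that Q(2) a NG by auto
      thus ?thesis using a by (simp add: Pc iN mN inv_mult_group m_assoc)
    qed
  qed
  moreover have "card ?E mod p \<noteq> 0" using P'(5) cE by (simp add: dvd_eq_mod_eq_0)
  ultimately have "{C \<in> ?E. \<forall>q\<in>Q. C #> inv q = C} \<noteq> {}" by (metis card.empty mod_0)
  then obtain a where a: "a \<in> N" "\<And>q. q \<in> Q \<Longrightarrow> P #> a #> inv q = P #> a" by blast
  have "conjg a q \<in> P" if q: "q \<in> Q" for q
  proof -
    have c: "a \<in> carrier G" "q \<in> carrier G" "q \<in> N" using a q NG QG Q(2) by auto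
    have "P #> (a \<otimes> inv q) = P #> a" using a(2)[OF q] Pc[OF a(1) iN[OF c(3)]] by simp
    hence "P #> a = P #> (a \<otimes> inv q)" by simp
    hence "a \<otimes> inv (a \<otimes> inv q) \<in> P"
      using rcos_eq_iff[OF P'(2)] c by simp
    thus ?thesis using c by (simp add: conjg_def inv_mult_group m_assoc)
  qed
  thus ?thesis using a(1) by blast
qed

lemma conjg_sylow_in:
  assumes "sylow_in p P N" "finite P" "g \<in> carrier G" "conjg g ` P \<subseteq> N"
  shows "sylow_in p (conjg g ` P) N"
  using assms subgroup.subset[of P G] card_conjg[of g P] by (auto simp: sylow_in_def subgroup_conjg)

lemma card_sylow_in_eq:
  assumes N: "subgroup N G" and fN: "finite N" and P: "sylow_in p P N" and Q: "sylow_in p Q N"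
  shows "card P = card Q"
  using sylow_in_iff_sylow_subgroup[OF N fN] P Q by (metis sylow_subgroup_def)

lemma sylow_in_conj:
  assumes N: "subgroup N G" and fN: "finite N" and P: "sylow_in p P N" and Q: "sylow_in p Q N"
  shows "\<exists>g\<in>N. conjg g ` Q = P"
proof -
  obtain k where "card Q = p ^ k" using sylow_inD[OF Q] by blast
  then obtain g where g: "g \<in> N" "conjg g ` Q \<subseteq> P"
    using p_subgroup_conj_into_sylow[OF N fN P sylow_inD(2,3)[OF Q]] by blast
  have "card (conjg g ` Q) = card P"
    using card_sylow_in_eq[OF N fN P Q] sylow_inD(2)[OF Q] g(1) N
    by (simp add: card_conjg subgroup.subset subgroup.mem_carrier)
  hence "conjg g ` Q = P"
    using g(2) fN sylow_inD(3)[OF P] by (meson card_subset_eq finite_subset)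
  thus ?thesis using g(1) by blast
qed

text \<open>The conjugate of \<open>P\<close> by \<open>g\<close> is again Sylow in
  \<open>N\<close>, so some \<open>n\<close> in \<open>N\<close> brings it back. Thus
  \<open>g\<close> lies in the product of \<open>N\<close> and the normalizer of
  \<open>P\<close>.\<close>

lemma frattini_argument:
  assumes N: "subgroup N G" and fN: "finite N" and P: "sylow_in p P N"
    and g: "g \<in> carrier G" and gN: "\<And>x. x \<in> N \<Longrightarrow> conjg g x \<in> N"
  shows "\<exists>n\<in>N. conjg (n \<otimes> g) ` P = P"
proof -
  have PG: "P \<subseteq> carrier G" using sylow_inD(2)[OF P] by (rule subgroup.subset)
  have "sylow_in p (conjg g ` P) N"
    by (rule conjg_sylow_in[OF P _ g]) (use gN fN sylow_inD(3)[OF P] in \<open>auto intro: finite_subset\<close>)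
  then obtain n where "n \<in> N" "conjg n ` conjg g ` P = P"
    using sylow_in_conj[OF N fN P] by blast
  moreover have "conjg (n \<otimes> g) ` P = conjg n ` conjg g ` P"
    by (rule conjg_image_conjg) (use \<open>n \<in> N\<close> N g PG in \<open>auto intro: subgroup.mem_carrier\<close>)
  ultimately show ?thesis by auto
qed

lemma sylow_in_larger:
  assumes P: "subgroup P G" "P \<subseteq> C" "card P = p ^ k" and C: "subgroup C G" "C \<subseteq> N"
    and N: "subgroup N G" "finite N" and S: "\<not> p dvd card N div card P" "prime p"
  shows "sylow_in p P C"
proof -
  have "card P dvd card C" "card C dvd card N"
    using assms card_subgroup_dvd by blast+
  hence "card C div card P dvd card N div card P"
    by (metis div_dvd_div dvd_trans)
  thus ?thesis using assms by (auto simp: sylow_in_def dest: dvd_trans)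
qed

lemma p_power_sylowI:
  assumes P: "subgroup P G" "P \<subseteq> A" "card P = p ^ j" "prime p" and Q: "sylow_in p Q A" 
    and A: "subgroup A G" "finite A" and le: "card Q \<le> card P"
  shows "sylow_in p P A"
proof -
  obtain k where k: "card Q = p ^ k" using sylow_inD[OF Q] by blast
  have kj: "k \<le> j" using le k P(3,4) by (metis power_increasing_iff prime_gt_1_nat)
  have d: "card P dvd card A" "card Q dvd card A"
    using card_subgroup_dvd[OF A(1) P(1,2)] card_subgroup_dvd[OF A(1) sylow_inD(2,3)[OF Q]] .
  define y where "y = card A div card P"
  have "card Q * (card A div card Q) = card P * y" using d by (simp add: y_def)
  moreover have "card P = card Q * p ^ (j - k)" using P(3) k kj by (simp flip: power_add)
  moreover have "card Q \<noteq> 0" using k P(4) by simp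
  ultimately have "card A div card Q = p ^ (j - k) * y"
    by (simp only: mult.assoc mult_cancel1 simp_thms)
  hence "card A div card P dvd card A div card Q" by (simp add: y_def)
  thus ?thesis using P sylow_inD(5)[OF Q] by (auto simp: sylow_in_def dest: dvd_trans)
qed

text \<open>A Sylow subgroup of \<open>A\<close> can be conjugated into \<open>P\<close> by an
  element of \<open>N\<close>; as \<open>A\<close> is invariant, it lands in
  \<open>P \<inter> A\<close>, which is therefore large enough to be Sylow.\<close>

lemma sylow_in_normal_Int:
  assumes N: "subgroup N G" and fN: "finite N" and P: "sylow_in p P N"
    and A: "subgroup A G" "A \<subseteq> N" and nA: "\<And>n a. n \<in> N \<Longrightarrow> a \<in> A \<Longrightarrow> conjg n a \<in> A"
  shows "sylow_in p (P \<inter> A) A"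
proof -
  note P' = sylow_inD[OF P]
  have fA: "finite A" using A fN finite_subset by blast
  obtain Q where Q: "sylow_in p Q A" using sylow_in_exists[OF A(1) fA P'(1)] by blast
  note Q' = sylow_inD[OF Q]
  then obtain k where k: "card Q = p ^ k" by blast
  obtain g where g: "g \<in> N" "conjg g ` Q \<subseteq> P"
    using p_subgroup_conj_into_sylow[OF N fN P Q'(2) _ k] Q'(3) A(2) by auto
  have sub: "conjg g ` Q \<subseteq> P \<inter> A" using g nA Q'(3) by auto
  have PA: "subgroup (P \<inter> A) G" using P'(2) A(1) subgroups_Inter_pair by blast
  have gG: "g \<in> carrier G" using g(1) N by (simp add: subgroup.mem_carrier)
  have le: "card Q \<le> card (P \<inter> A)"
    using card_mono[OF _ sub] fA card_conjg[OF gG subgroup.subset[OF Q'(2)]] by simp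
  have "finite P" using P'(3) fN finite_subset by blast
  hence "card (P \<inter> A) dvd card P" using card_subgroup_dvd[OF P'(2) PA] by simp
  then obtain j where "card (P \<inter> A) = p ^ j" using P'(1,4) by (metis divides_primepow_nat)
  thus ?thesis using p_power_sylowI[OF PA _ _ P'(1) Q A(1) fA le] by simp
qed

text \<open>A prime divisor \<open>q\<close> of the index of \<open>C\<close> would divide the index
  of a Sylow \<open>q\<close>-subgroup contained in \<open>C\<close>. This reduces the claim that a
  group acts trivially on a section to one Sylow subgroup for each prime.\<close>

lemma subgroup_eq_if_contains_sylows:
  assumes Y: "subgroup Y G" "finite Y" and C: "subgroup C G" "C \<subseteq> Y"
    and S: "\<And>q. prime q \<Longrightarrow> q dvd card Y \<Longrightarrow> \<exists>R. sylow_in q R Y \<and> R \<subseteq> C"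
  shows "C = Y"
proof -
  have fC: "finite C" using C Y finite_subset by blast
  have "card C dvd card Y" by (rule card_subgroup_dvd[OF Y(1) C])
  then obtain d where d: "card Y = card C * d" by blast
  have "d = 1"
  proof (rule ccontr)
    assume "d \<noteq> 1"
    then obtain q where q: "prime q" "q dvd d" using prime_factor_nat by blast
    then obtain R where R: "sylow_in q R Y" "R \<subseteq> C" using S[OF q(1)] d by auto
    note R' = sylow_inD[OF R(1)]
    have "card R dvd card C" by (rule card_subgroup_dvd[OF C(1) R'(2) R(2)])
    then obtain c where c: "card C = card R * c" by blast
    have "card R > 0" using card_subgroup_pos R'(2) fC R(2) finite_subset by blast
    hence "card Y div card R = c * d" using c d by simp
    thus False using R'(5) q(2) by simp
  qed
  thus ?thesis using d C(2) Y(2) by (simp add: card_subset_eq)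
qed

end

section \<open>Subgroups of p-groups\<close>

lemma (in group_hom) card_image_mult_card_kernel:
  assumes "finite (carrier G)"
  shows "card (h ` carrier G) * card (kernel G H h) = card (carrier G)"
proof -
  have sub: "subgroup (kernel G H h) G" by (rule subgroup_kernel)
  have "group (H\<lparr>carrier := h ` carrier G\<rparr>)"
    by (rule subgroup.subgroup_is_group[OF img_is_subgroup H.group_axioms])
  then interpret I: group_hom G "H\<lparr>carrier := h ` carrier G\<rparr>" h
    by (auto simp: group_hom_def group_hom_axioms_def hom_def)
  have ker: "kernel G (H\<lparr>carrier := h ` carrier G\<rparr>) h = kernel G H h"
    by (simp add: kernel_def)
  have "bij_betw (\<lambda>X. the_elem (h ` X)) (carrier (G Mod kernel G H h)) (h ` carrier G)"
    using I.FactGroup_iso_set ker by (simp add: iso_def)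
  hence "card (rcosets (kernel G H h)) = card (h ` carrier G)"
    by (simp add: bij_betw_same_card FactGroup_def)
  thus ?thesis using G.lagrange[OF sub] by (simp add: order_def)
qed

context group begin

text \<open>The map is multiplicative on \<open>B\<close> only. Among others it will be commutation
  with a fixed element, the \<open>p\<close>-th power map and the transfer, which are not
  homomorphisms on the whole group.\<close>

lemma card_hom_image_subgroup:
  assumes H: "group H" and B: "subgroup B G" "finite B"
    and cl: "\<And>b. b \<in> B \<Longrightarrow> f b \<in> carrier H"
    and f: "\<And>a b. a \<in> B \<Longrightarrow> b \<in> B \<Longrightarrow> f (a \<otimes> b) = f a \<otimes>\<^bsub>H\<^esub> f b"
  shows "subgroup (f ` B) H" and "card (f ` B) * card {b \<in> B. f b = \<one>\<^bsub>H\<^esub>} = card B"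
proof -
  interpret B: group "G\<lparr>carrier := B\<rparr>" by (rule subgroup.subgroup_is_group[OF B(1) group_axioms])
  interpret h: group_hom "G\<lparr>carrier := B\<rparr>" H f
    using cl f by (auto simp: group_hom_def group_hom_axioms_def hom_def H B.group_axioms)
  show "subgroup (f ` B) H" using h.img_is_subgroup by simp
  show "card (f ` B) * card {b \<in> B. f b = \<one>\<^bsub>H\<^esub>} = card B"
    using h.card_image_mult_card_kernel B(2) by (simp add: kernel_def)
qed

lemma inv_mult_cancel_left [simp]:
  "\<lbrakk>x \<in> carrier G; y \<in> carrier G\<rbrakk> \<Longrightarrow> inv x \<otimes> (x \<otimes> y) = y"
  "\<lbrakk>x \<in> carrier G; y \<in> carrier G\<rbrakk> \<Longrightarrow> x \<otimes> (inv x \<otimes> y) = y"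
  by (simp_all flip: m_assoc)

section \<open>Normalizers and the adjunction of one element\<close>

definition normalizes :: "'a set \<Rightarrow> 'a set"
  where "normalizes X = {g \<in> carrier G. conjg g ` X = X}"

lemma subgroup_normalizes:
  assumes X: "X \<subseteq> carrier G" shows "subgroup (normalizes X) G"
proof (rule subgroupI)
  show "normalizes X \<subseteq> carrier G" by (auto simp: normalizes_def)
  have "conjg \<one> ` X = X" using X by (force simp: subset_iff image_iff)
  thus "normalizes X \<noteq> {}" by (auto simp: normalizes_def)
next
  fix g assume "g \<in> normalizes X"
  hence g: "g \<in> carrier G" "conjg g ` X = X" by (auto simp: normalizes_def)
  have "conjg (inv g) ` X = conjg (inv g) ` conjg g ` X" by (simp add: g)
  also have "\<dots> = conjg (inv g \<otimes> g) ` X" using g X by (intro conjg_image_conjg[symmetric]) auto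
  also have "\<dots> = X" using g X by (force simp: subset_iff image_iff)
  finally show "inv g \<in> normalizes X" using g by (simp add: normalizes_def)
next
  fix g h assume "g \<in> normalizes X" "h \<in> normalizes X"
  thus "g \<otimes> h \<in> normalizes X" using X by (simp add: normalizes_def conjg_image_conjg)
qed

lemma normalizes_iff:
  assumes "finite X" "X \<subseteq> carrier G"
  shows "g \<in> normalizes X \<longleftrightarrow> g \<in> carrier G \<and> (\<forall>x\<in>X. conjg g x \<in> X)"
  using assms conjg_image_eqI[of X g] by (auto simp: normalizes_def)

lemma subgroup_subset_normalizes:
  assumes A: "subgroup A G" "finite A" shows "A \<subseteq> normalizes A"
  using A normalizes_iff[OF A(2) subgroup.subset[OF A(1)]]
  by (auto simp: conjg_def subgroup.m_closed subgroup.m_inv_closed subgroup.mem_carrier)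

lemma normalizer_eq_normalizes:
  assumes "X \<subseteq> carrier G" shows "normalizer G X = normalizes X"
proof -
  have "g <# X #> inv g = conjg g ` X" for g
    by (auto simp: l_coset_def r_coset_def conjg_def)
  thus ?thesis using assms by (auto simp: normalizer_def stabilizer_def normalizes_def)
qed

lemma pow_index_mem:
  assumes A: "subgroup A G" "finite A" and B: "subgroup B G" "B \<subseteq> A" "A \<subseteq> normalizes B" and a: "a \<in> A"
  shows "a [^] (card A div card B) \<in> B"
proof -
  let ?A = "G\<lparr>carrier := A\<rparr>"
  interpret A: group ?A by (rule subgroup.subgroup_is_group[OF A(1) group_axioms])
  have BA: "subgroup B ?A" by (rule subgroup_incl[OF B(1) A(1) B(2)])
  interpret N: normal B ?A
  proof (rule A.normal_invI[OF BA])
    fix x h assume "x \<in> carrier ?A" "h \<in> B"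
    thus "x \<otimes>\<^bsub>?A\<^esub> h \<otimes>\<^bsub>?A\<^esub> inv\<^bsub>?A\<^esub> x \<in> B"
      using B(3) m_inv_consistent[OF A(1)] by (auto simp: normalizes_def conjg_def)
  qed
  interpret Q: group "?A Mod B" by (rule N.factorgroup_is_group)
  have "card B > 0" using card_subgroup_pos B A(2) finite_subset by blast
  moreover have "order (?A Mod B) * card B = card A"
    using A.lagrange[OF BA] by (simp add: order_def FactGroup_def)
  ultimately have o: "order (?A Mod B) = card A div card B"
    by (metis nonzero_mult_div_cancel_right not_gr_zero)
  have "(B #>\<^bsub>?A\<^esub> a) [^]\<^bsub>?A Mod B\<^esub> (card A div card B) = B"
    using Q.pow_order_eq_1[of "B #>\<^bsub>?A\<^esub> a"] a by (simp add: o carrier_FactGroup)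
  hence "B #> a [^]\<^bsub>?A\<^esub> (card A div card B) = B"
    using N.FactGroup_pow[of a] a by simp
  moreover have "a [^]\<^bsub>?A\<^esub> (card A div card B) = a [^] (card A div card B)"
    by (rule nat_pow_consistent[symmetric])
  moreover have "a \<in> carrier G" using a A by (simp add: subgroup.mem_carrier)
  ultimately show ?thesis
    by (metis B(1) nat_pow_closed rcos_self)
qed

text \<open>For \<open>z\<close> normalizing \<open>B\<close> this is the subgroup generated by
  \<open>B\<close> and \<open>z\<close>. With the explicit form, invariance under an action can be
  checked on \<open>B\<close> and on \<open>z\<close>.\<close>

definition adjoin :: "'a set \<Rightarrow> 'a \<Rightarrow> 'a set"
  where "adjoin B z = {b \<otimes> z [^] (i::int) |b i. b \<in> B}"

lemma subgroup_adjoin: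
  assumes B: "subgroup B G" and z: "z \<in> normalizes B"
  shows "subgroup (adjoin B z) G" "B \<subseteq> adjoin B z" "z \<in> adjoin B z"
proof -
  have BG: "B \<subseteq> carrier G" by (rule subgroup.subset[OF B])
  have zG: "z \<in> carrier G" using z by (simp add: normalizes_def)
  have zi: "z [^] i \<in> normalizes B" for i :: int
    by (rule subgroup_int_pow_closed[OF subgroup_normalizes[OF BG] z])
  have cz: "conjg (z [^] i) b \<in> B" if "b \<in> B" for b and i :: int
    using zi[of i] that by (auto simp: normalizes_def)
  show "subgroup (adjoin B z) G"
  proof (rule subgroupI)
    show "adjoin B z \<subseteq> carrier G" using BG zG by (auto simp: adjoin_def)
    show "adjoin B z \<noteq> {}" using subgroup.one_closed[OF B] by (auto simp: adjoin_def)
  next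
    fix a assume "a \<in> adjoin B z"
    then obtain b and i :: int where a: "a = b \<otimes> z [^] i" "b \<in> B" by (auto simp: adjoin_def)
    have bG: "b \<in> carrier G" using a BG by auto
    have "inv a = conjg (z [^] (- i)) (inv b) \<otimes> z [^] (- i)"
      using a bG zG by (simp add: conjg_def inv_mult_group int_pow_neg m_assoc)
    moreover have "conjg (z [^] (- i)) (inv b) \<in> B"
      by (rule cz) (use a B in \<open>simp add: subgroup.m_inv_closed\<close>)
    ultimately show "inv a \<in> adjoin B z" unfolding adjoin_def by blast
  next
    fix a a' assume "a \<in> adjoin B z" "a' \<in> adjoin B z"
    then obtain b b' and i i' :: int
      where a: "a = b \<otimes> z [^] i" "b \<in> B" "a' = b' \<otimes> z [^] i'" "b' \<in> B" by (auto simp: adjoin_def)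
    have bG: "b \<in> carrier G" "b' \<in> carrier G" using a BG by auto
    have "a \<otimes> a' = (b \<otimes> conjg (z [^] i) b') \<otimes> z [^] (i + i')"
      using a bG zG by (simp add: conjg_def int_pow_mult m_assoc inv_solve_left)
    moreover have "b \<otimes> conjg (z [^] i) b' \<in> B"
      using cz a B by (simp add: subgroup.m_closed)
    ultimately show "a \<otimes> a' \<in> adjoin B z" unfolding adjoin_def by blast
  qed
  show "B \<subseteq> adjoin B z"
  proof
    fix b assume "b \<in> B"
    moreover have "b = b \<otimes> z [^] (0::int)" using \<open>b \<in> B\<close> BG by auto
    ultimately show "b \<in> adjoin B z" unfolding adjoin_def by blast
  qed
  have "z = \<one> \<otimes> z [^] (1::int)" using zG by simp
  thus "z \<in> adjoin B z" unfolding adjoin_def using subgroup.one_closed[OF B] by blast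
qed

lemma adjoin_subset:
  assumes "subgroup A G" "B \<subseteq> A" "z \<in> A" shows "adjoin B z \<subseteq> A"
  using assms subgroup_int_pow_closed[OF assms(1,3)] by (auto simp: adjoin_def subgroup.m_closed subset_iff)

lemma adjoin_eq_if_prime_index:
  assumes A: "subgroup A G" "finite A" and B: "subgroup B G" "B \<subseteq> A"
    and q: "prime q" "card A = q * card B" and z: "z \<in> A" "z \<notin> B" "z \<in> normalizes B"
  shows "adjoin B z = A"
proof -
  note S = subgroup_adjoin[OF B(1) z(3)]
  have sub: "adjoin B z \<subseteq> A" by (rule adjoin_subset[OF A(1) B(2) z(1)])
  have fJ: "finite (adjoin B z)" using sub A(2) finite_subset by blast
  have "card B > 0" using card_subgroup_pos B A(2) finite_subset by blast
  obtain c where c: "card (adjoin B z) = card B * c"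
    using card_subgroup_dvd[OF S(1) B(1) S(2)] by blast
  have "card B < card (adjoin B z)"
    using S(2,3) z(2) fJ by (metis psubset_card_mono psubsetI)
  hence "c \<noteq> 1" using c by auto
  moreover have "card (adjoin B z) dvd card A" by (rule card_subgroup_dvd[OF A(1) S(1) sub])
  hence "c dvd q" using c q(2) \<open>card B > 0\<close> by (simp add: mult.commute)
  ultimately have "c = q" using q(1) by (metis prime_nat_iff)
  hence "card (adjoin B z) = card A" using c q(2) by simp
  thus ?thesis using sub A(2) by (simp add: card_subset_eq)
qed

text \<open>Since \<open>z [^] p\<close> lies in \<open>B\<close>, the cosets
  \<open>B #> z [^] i\<close> with \<open>i < p\<close> are all, which bounds the index by
  \<open>p\<close>; and the index is a power of \<open>p\<close> different from 1.\<close>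

lemma card_adjoin_p:
  assumes P: "subgroup P G" "card P = p ^ k" and p: "prime p" and B: "subgroup B G" "B \<subseteq> P"
    and z: "z \<in> P" "z \<notin> B" "z \<in> normalizes B" "z [^] p \<in> B"
  shows "card (adjoin B z) = p * card B"
proof -
  have fP: "finite P" using P p by (metis card.infinite not_prime_0 power_not_zero)
  note S = subgroup_adjoin[OF B(1) z(3)]
  have sub: "adjoin B z \<subseteq> P" by (rule adjoin_subset[OF P(1) B(2) z(1)])
  have fJ: "finite (adjoin B z)" using sub fP finite_subset by blast
  have BG: "B \<subseteq> carrier G" by (rule subgroup.subset[OF B(1)])
  have zG: "z \<in> carrier G" using z by (simp add: normalizes_def)
  let ?E = "(\<lambda>a. B #> a) ` adjoin B z"
  have cJ: "card (adjoin B z) = card ?E * card B"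
    by (rule card_subgroup_cosets[OF S(1) B(1) S(2)])
  have "?E \<subseteq> (\<lambda>i. B #> z [^] i) ` {0..<p}"
  proof
    fix C assume "C \<in> ?E"
    then obtain b and i :: int where C: "C = B #> (b \<otimes> z [^] i)" "b \<in> B" by (auto simp: adjoin_def)
    have bG: "b \<in> carrier G" using C BG by auto
    let ?r = "nat (i mod int p)"
    have r: "?r \<in> {0..<p}" "int ?r = i mod int p"
      using p by (simp_all add: prime_gt_0_nat nat_less_iff)
    have "i = int p * (i div int p) + int ?r" using r by simp
    hence "z [^] i = (z [^] p) [^] (i div int p) \<otimes> z [^] ?r"
      using zG by (metis int_pow_int int_pow_mult int_pow_pow)
    moreover have "(z [^] p) [^] (i div int p) \<in> B"
      by (rule subgroup_int_pow_closed[OF B(1) z(4)])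
    ultimately have "b \<otimes> z [^] i \<otimes> inv (z [^] ?r) \<in> B"
      using C(2) B(1) bG zG by (simp add: m_assoc subgroup.m_closed subgroup.mem_carrier[OF B(1)])
    hence "C = B #> z [^] ?r" using C(1) bG zG rcos_eq_iff[OF B(1)] by simp
    thus "C \<in> (\<lambda>i. B #> z [^] i) ` {0..<p}" using r(1) by blast
  qed
  hence le: "card ?E \<le> p"
    using surj_card_le[of "{0..<p}" ?E "\<lambda>i. B #> z [^] i"] by simp
  have "card B < card (adjoin B z)"
    using S(2,3) z(2) fJ by (metis psubset_card_mono psubsetI)
  hence "card ?E \<noteq> 1" using cJ by auto
  moreover have "card ?E dvd p ^ k"
    using card_subgroup_dvd[OF P(1) S(1) sub] cJ P(2) by (metis dvd_mult_left)
  then obtain j where j: "card ?E = p ^ j" using p by (metis divides_primepow_nat)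
  ultimately have "j \<noteq> 0" by (metis power_0)
  moreover have "j \<le> 1" using le j p by (metis power_one_right power_increasing_iff prime_gt_1_nat)
  ultimately have "card ?E = p" using j by (cases j) auto
  thus ?thesis using cJ by simp
qed

lemma p_power_index_dvd:
  assumes P: "subgroup P G" "card P = p ^ k" and p: "prime p" and A: "subgroup A G" "A \<subseteq> P"
    and B: "subgroup B G" "B \<subset> A"
  shows "p dvd card A div card B" "\<exists>j. card A = p ^ j"
proof -
  have fP: "finite P" using P p by (metis card.infinite not_prime_0 power_not_zero)
  have fA: "finite A" using A(2) fP finite_subset by blast
  show j: "\<exists>j. card A = p ^ j" using card_subgroup_dvd[OF P(1) A] P(2) p by (metis divides_primepow_nat)
  have "card B dvd card A" by (rule card_subgroup_dvd[OF A(1) B(1)]) (use B in auto)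
  then obtain c where c: "card A = card B * c" by blast
  have "card B < card A" using B(2) fA by (rule psubset_card_mono[rotated])
  hence "c \<noteq> 1" "card B > 0" using c card_subgroup_pos[OF B(1)] B(2) fA finite_subset by auto
  have "c dvd card A" using c by simp
  then obtain i where i: "c = p ^ i" using j p by (metis divides_primepow_nat)
  with \<open>c \<noteq> 1\<close> have "i \<noteq> 0" by (metis power_0)
  thus "p dvd card A div card B" using c i \<open>card B > 0\<close> by (simp add: dvd_power)
qed

lemma finite_p_power: "\<lbrakk>card P = p ^ k; prime p\<rbrakk> \<Longrightarrow> finite P"
  by (metis card.infinite not_prime_0 power_not_zero)

text \<open>A maximal proper subgroup \<open>Y\<close> over \<open>U\<close> acts by conjugation on
  its own cosets in \<open>P\<close>; a second fixed coset \<open>Y #> z\<close> means that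
  \<open>z\<close> normalizes \<open>Y\<close>, so \<open>P\<close> is \<open>adjoin Y z\<close> and
  \<open>P/Y\<close> is cyclic. Consequently commutators never help to generate \<open>P\<close>:
  \<open>P = U P'\<close> forces \<open>U = P\<close>.\<close>

lemma proper_subgroup_of_p_group:
  assumes P: "subgroup P G" "card P = p ^ k" and p: "prime p" and U: "subgroup U G" "U \<subset> P"
  shows "\<exists>Y. subgroup Y G \<and> U \<subseteq> Y \<and> Y \<subset> P \<and> (\<forall>x\<in>P. \<forall>y\<in>P. x \<otimes> y \<otimes> inv x \<otimes> inv y \<in> Y)"
proof -
  have fP: "finite P" by (rule finite_p_power[OF P(2) p])
  have PG: "P \<subseteq> carrier G" by (rule subgroup.subset[OF P(1)])
  let ?S = "{Y. subgroup Y G \<and> U \<subseteq> Y \<and> Y \<subset> P}"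
  have "finite ?S" by (rule finite_subset[of _ "Pow P"]) (use fP in auto)
  moreover have "U \<in> ?S" using U by auto
  ultimately obtain Y where Y: "Y \<in> ?S" and mx: "\<And>Z. Z \<in> ?S \<Longrightarrow> Y \<subseteq> Z \<Longrightarrow> Z = Y"
    using finite_has_maximal2[of ?S U] by (metis (no_types, lifting))
  have Y': "subgroup Y G" "U \<subseteq> Y" "Y \<subset> P" using Y by auto
  have fY: "finite Y" using Y'(3) fP finite_subset by blast
  have YG: "Y \<subseteq> carrier G" by (rule subgroup.subset[OF Y'(1)])
  obtain j where j: "card Y = p ^ j"
    using card_subgroup_dvd[OF P(1) Y'(1) _] Y'(3) P(2) p by (metis divides_primepow_nat psubsetE)
  have cl: "conjg w a \<in> A" if "subgroup A G" "w \<in> A" "a \<in> A" for w a A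
    using that by (simp add: conjg_def subgroup.m_closed subgroup.m_inv_closed)
  have "\<exists>z\<in>P - Y. \<forall>w\<in>Y. conjg w z \<in> Y #> z"
    by (rule p_group_centralizes_mod[OF Y'(1) p j P(1) Y'(1) _ fP _ _ p_power_index_dvd(1)[OF P p P(1) order_refl Y'(1,3)]])
      (use cl[OF P(1)] cl[OF Y'(1)] Y' in auto)
  then obtain z where z: "z \<in> P" "z \<notin> Y" "\<And>w. w \<in> Y \<Longrightarrow> conjg w z \<in> Y #> z" by blast
  have zG: "z \<in> carrier G" using z PG by auto
  have zn: "z \<in> normalizes Y"
  proof (subst normalizes_iff[OF fY YG], intro conjI ballI)
    fix y assume y: "y \<in> Y"
    have yG: "y \<in> carrier G" using y YG by auto
    have "inv y \<in> Y" using y Y'(1) by (simp add: subgroup.m_inv_closed)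
    from z(3)[OF this] have "inv y \<otimes> z \<otimes> y \<otimes> inv z \<in> Y"
      using mem_rcos_iff[OF Y'(1)] yG zG by (simp add: conjg_def)
    hence "y \<otimes> (inv y \<otimes> z \<otimes> y \<otimes> inv z) \<in> Y" using y Y'(1) by (simp add: subgroup.m_closed)
    thus "conjg z y \<in> Y" using yG zG by (simp add: m_assoc conjg_def)
  qed (use zG in simp)
  note S = subgroup_adjoin[OF Y'(1) zn]
  have "adjoin Y z \<subseteq> P" by (rule adjoin_subset[OF P(1) _ z(1)]) (use Y' in auto)
  moreover have "adjoin Y z \<notin> ?S" using mx[of "adjoin Y z"] S(2,3) z(2) by auto
  ultimately have PJ: "adjoin Y z = P" using S Y'(2) by auto
  \<comment> \<open>Modulo \<open>Y\<close> a product depends only on the sum of the two exponents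
    of \<open>z\<close>, hence is symmetric in its factors.\<close>
  have key: "Y #> (x \<otimes> y) = Y #> z [^] (i + i')"
    if x: "x = b \<otimes> z [^] i" "b \<in> Y" and y: "y = b' \<otimes> z [^] i'" "b' \<in> Y" for x y b b' and i i' :: int
  proof -
    have bG: "b \<in> carrier G" "b' \<in> carrier G" using x y YG by auto
    have "z [^] i \<in> normalizes Y" by (rule subgroup_int_pow_closed[OF subgroup_normalizes[OF YG] zn])
    hence "conjg (z [^] i) b' \<in> Y" using y(2) by (auto simp: normalizes_def)
    hence "b \<otimes> conjg (z [^] i) b' \<in> Y" using x(2) Y'(1) by (simp add: subgroup.m_closed)
    moreover have "x \<otimes> y \<otimes> inv (z [^] (i + i')) = b \<otimes> conjg (z [^] i) b'"
      using x y bG zG by (simp add: conjg_def int_pow_mult m_assoc inv_mult_group)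
    ultimately show ?thesis using rcos_eq_iff[OF Y'(1)] x y bG zG by simp
  qed
  have "x \<otimes> y \<otimes> inv x \<otimes> inv y \<in> Y" if "x \<in> P" "y \<in> P" for x y
  proof -
    have xy: "x \<in> carrier G" "y \<in> carrier G" using that PG by auto
    have "x \<in> adjoin Y z" "y \<in> adjoin Y z" using that PJ by simp_all
    then obtain b b' i i' where "x = b \<otimes> z [^] (i::int)" "b \<in> Y" "y = b' \<otimes> z [^] (i'::int)" "b' \<in> Y"
      unfolding adjoin_def by blast
    hence "Y #> (x \<otimes> y) = Y #> (y \<otimes> x)" using key[of x b i y b' i'] key[of y b' i' x b i] by (simp add: add.commute)
    hence "x \<otimes> y \<otimes> inv (y \<otimes> x) \<in> Y" using rcos_eq_iff[OF Y'(1)] xy by simp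
    thus ?thesis using xy by (simp add: inv_mult_group m_assoc)
  qed
  thus ?thesis using Y' by blast
qed


text \<open>This is the centralizer in \<open>Y\<close> of \<open>A\<close> modulo \<open>K\<close>.
  For a single element \<open>A = {v}\<close> it is the centralizer of one coset, the group in which
  Sylow's theorem is applied when fusion is studied.\<close>

lemma subgroup_commuting_mod:
  assumes K: "K \<lhd> G" and A: "A \<subseteq> carrier G" and Y: "subgroup Y G"
  shows "subgroup {g \<in> Y. \<forall>a\<in>A. conjg g a \<otimes> inv a \<in> K} G"
proof -
  have Ks: "subgroup K G" by (rule normal_imp_subgroup[OF K])
  note YG = subgroup.mem_carrier[OF Y]
  have AG: "a \<in> carrier G" if "a \<in> A" for a using that A by auto
  show ?thesis
  proof (rule subgroupI)
    show "{g \<in> Y. \<forall>a\<in>A. conjg g a \<otimes> inv a \<in> K} \<subseteq> carrier G" using YG by auto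
    have "\<one> \<in> {g \<in> Y. \<forall>a\<in>A. conjg g a \<otimes> inv a \<in> K}"
      using AG subgroup.one_closed[OF Y] subgroup.one_closed[OF Ks] by simp
    thus "{g \<in> Y. \<forall>a\<in>A. conjg g a \<otimes> inv a \<in> K} \<noteq> {}" by blast
  next
    fix g assume g: "g \<in> {g \<in> Y. \<forall>a\<in>A. conjg g a \<otimes> inv a \<in> K}"
    have gG: "g \<in> carrier G" using g YG by auto
    have "conjg (inv g) a \<otimes> inv a \<in> K" if a: "a \<in> A" for a
    proof -
      have "inv (conjg g a \<otimes> inv a) \<in> K" using g a subgroup.m_inv_closed[OF Ks] by auto
      hence "conjg (inv g) (inv (conjg g a \<otimes> inv a)) \<in> K" using normal_conjg[OF K] gG by simp
      thus ?thesis using gG AG[OF a] by (simp add: conjg_def m_assoc inv_mult_group)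
    qed
    thus "inv g \<in> {g \<in> Y. \<forall>a\<in>A. conjg g a \<otimes> inv a \<in> K}" using g Y by (simp add: subgroup.m_inv_closed)
  next
    fix g h assume g: "g \<in> {g \<in> Y. \<forall>a\<in>A. conjg g a \<otimes> inv a \<in> K}"
      and h: "h \<in> {g \<in> Y. \<forall>a\<in>A. conjg g a \<otimes> inv a \<in> K}"
    have G: "g \<in> carrier G" "h \<in> carrier G" using g h YG by auto
    have "conjg (g \<otimes> h) a \<otimes> inv a \<in> K" if a: "a \<in> A" for a
    proof -
      have "conjg g (conjg h a \<otimes> inv a) \<otimes> (conjg g a \<otimes> inv a) \<in> K"
        by (rule subgroup.m_closed[OF Ks]) (use normal_conjg[OF K] g h a G in auto)
      thus ?thesis using G AG[OF a] by (simp add: conjg_def m_assoc inv_mult_group)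
    qed
    thus "g \<otimes> h \<in> {g \<in> Y. \<forall>a\<in>A. conjg g a \<otimes> inv a \<in> K}" using g h Y by (simp add: subgroup.m_closed)
  qed
qed

lemma normal_commuting_mod:
  assumes K: "K \<lhd> G" and A: "A \<lhd> G" and Y: "Y \<lhd> G"
  shows "{g \<in> Y. \<forall>a\<in>A. conjg g a \<otimes> inv a \<in> K} \<lhd> G"
proof (rule normal_conjgI)
  have AG: "a \<in> carrier G" if "a \<in> A" for a using subgroup.mem_carrier[OF normal_imp_subgroup[OF A] that] .
  show "subgroup {g \<in> Y. \<forall>a\<in>A. conjg g a \<otimes> inv a \<in> K} G"
    by (rule subgroup_commuting_mod[OF K _ normal_imp_subgroup[OF Y]]) (use AG in auto)
  fix g z assume g: "g \<in> carrier G" and z: "z \<in> {g \<in> Y. \<forall>a\<in>A. conjg g a \<otimes> inv a \<in> K}"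
  have zG: "z \<in> carrier G" using z subgroup.mem_carrier[OF normal_imp_subgroup[OF Y]] by auto
  have "conjg (conjg g z) a \<otimes> inv a \<in> K" if a: "a \<in> A" for a
  proof -
    have a': "conjg (inv g) a \<in> A" using normal_conjg[OF A] g a by simp
    have "conjg g (conjg z (conjg (inv g) a) \<otimes> inv (conjg (inv g) a)) \<in> K"
      by (rule normal_conjg[OF K g]) (use z a' in auto)
    thus ?thesis using g zG AG[OF a] by (simp add: conjg_def m_assoc inv_mult_group)
  qed
  thus "conjg g z \<in> {g \<in> Y. \<forall>a\<in>A. conjg g a \<otimes> inv a \<in> K}" using normal_conjg[OF Y g] z by auto
qed

lemma conjg_eq_iff:
  assumes "g \<in> carrier G" "x \<in> carrier G"
  shows "conjg g x \<otimes> inv x = \<one> \<longleftrightarrow> conjg g x = x" "conjg g x = x \<longleftrightarrow> conjg x g = g"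
proof -
  show "conjg g x \<otimes> inv x = \<one> \<longleftrightarrow> conjg g x = x"
    using assms by (metis conjg_closed inv_closed inv_equality inv_inv r_inv)
  have "conjg a b = b \<longleftrightarrow> a \<otimes> b = b \<otimes> a" if "a \<in> carrier G" "b \<in> carrier G" for a b
    using that by (simp add: conjg_def inv_solve_right')
  thus "conjg g x = x \<longleftrightarrow> conjg x g = g" using assms by auto
qed

text \<open>Otherwise a set of commutators \<open>[a\<^sub>0, B]\<close>, or the \<open>p\<close>-th powers of the elements of some \<open>A\<close>,
  would form a normal subgroup of order \<open>p\<close>.\<close>

lemma elementary_abelian_p_subgroup:
  assumes P: "P \<lhd> G" "card P = p ^ k" and p: "prime p"
    and no: "\<And>A. A \<lhd> G \<Longrightarrow> A \<subseteq> P \<Longrightarrow> card A \<noteq> p"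
    and step: "\<And>W. W \<lhd> G \<Longrightarrow> W \<subseteq> P \<Longrightarrow> W \<noteq> {\<one>} \<Longrightarrow> W \<noteq> P
                 \<Longrightarrow> \<exists>A. A \<lhd> G \<and> W \<subseteq> A \<and> A \<subseteq> P \<and> card A = p * card W"
    and x: "x \<in> P" and y: "y \<in> P"
  shows "x \<otimes> y = y \<otimes> x" and "x [^] p = \<one>"
proof -
  have Ps: "subgroup P G" by (rule normal_imp_subgroup[OF P(1)])
  have fP: "finite P" by (rule finite_p_power[OF P(2) p])
  have PG: "P \<subseteq> carrier G" by (rule subgroup.subset[OF Ps])
  have PGi: "u \<in> carrier G" if "u \<in> P" for u using that PG by auto
  have cPP: "conjg u v \<in> P" if "u \<in> P" "v \<in> P" for u v using normal_conjg[OF P(1)] that PGi by blast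
  have comm: "\<forall>x\<in>P. \<forall>y\<in>P. x \<otimes> y = y \<otimes> x"
  proof (rule ccontr)
    assume nc: "\<not> ?thesis"
    define Z where "Z = {z \<in> P. \<forall>w\<in>P. conjg w z = z}"
    have Zcomm: "z \<otimes> w = w \<otimes> z" if "z \<in> Z" "w \<in> P" for z w
    proof -
      have "z \<in> carrier G" "w \<in> carrier G" "conjg w z = z" using that PGi by (auto simp: Z_def)
      thus ?thesis by (metis conjg_def inv_solve_right' m_closed)
    qed
    have "Z = {z \<in> P. \<forall>w\<in>P. conjg z w \<otimes> inv w \<in> {\<one>}}"
      using conjg_eq_iff PGi by (auto simp: Z_def)
    hence Zn: "Z \<lhd> G" using normal_commuting_mod[OF one_is_normal P(1) P(1)] by simp
    have Zs: "subgroup Z G" by (rule normal_imp_subgroup[OF Zn])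
    have ZP: "Z \<subseteq> P" by (auto simp: Z_def)
    have ZnP: "Z \<noteq> P"
    proof
      assume "Z = P"
      hence "\<forall>x\<in>P. \<forall>y\<in>P. x \<otimes> y = y \<otimes> x" using Zcomm by auto
      with nc show False by blast
    qed
    have one: "{\<one>} \<subset> P"
      using ZnP ZP subgroup.one_closed[OF Zs] subgroup.one_closed[OF Ps] by auto
    \<comment> \<open>The centre of a nontrivial \<open>p\<close>-group is nontrivial;
      \<open>step\<close> excludes the trivial subgroup, so this must be known before it is applied
      to \<open>Z\<close>.\<close>
    have "\<exists>z\<in>P - {\<one>}. \<forall>w\<in>P. conjg w z \<in> {\<one>} #> z"
      by (rule p_group_centralizes_mod[OF Ps p P(2) Ps triv_subgroup _ fP cPP _
            p_power_index_dvd(1)[OF Ps P(2) p Ps order_refl triv_subgroup one]])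
        (use one PGi in auto)
    then obtain z where z: "z \<in> P" "z \<noteq> \<one>" "\<And>w. w \<in> P \<Longrightarrow> conjg w z \<in> {\<one>} #> z" by blast
    have "z \<in> Z" using z PGi[OF z(1)] by (auto simp: Z_def r_coset_def)
    hence "Z \<noteq> {\<one>}" using z(2) by auto
    then obtain A where A: "A \<lhd> G" "Z \<subseteq> A" "A \<subseteq> P" "card A = p * card Z"
      using step[OF Zn ZP _ ZnP] by blast
    have As: "subgroup A G" by (rule normal_imp_subgroup[OF A(1)])
    have fA: "finite A" using A(3) fP finite_subset by blast
    have AG: "u \<in> carrier G" if "u \<in> A" for u using that A(3) PGi by auto
    have cZ: "card Z > 0" using card_subgroup_pos[OF Zs] fA A(2) finite_subset by blast
    have dA: "p dvd card A div card Z" using A(4) cZ by simp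
    \<comment> \<open>\<open>a0\<close> generates \<open>A\<close> modulo \<open>Z\<close> and is
      centralized by \<open>P\<close> modulo \<open>Z\<close>, so its commutators with elements of
      \<open>P\<close> are central in \<open>P\<close>.\<close>
    obtain a0 where a0: "a0 \<in> A" "a0 \<notin> Z" "\<And>w. w \<in> P \<Longrightarrow> conjg w a0 \<in> Z #> a0"
      using p_group_centralizes_mod[OF Ps p P(2) As Zs A(2) fA _ _ dA]
        normal_conjg[OF A(1)] normal_conjg[OF Zn] PGi by (metis Diff_iff)
    have a0P: "a0 \<in> P" and a0G: "a0 \<in> carrier G" using a0 A(3) AG by auto
    have "a0 \<in> normalizes Z"
      using normalizes_iff[of Z a0] normal_conjg[OF Zn] a0G fA A(2) subgroup.subset[OF Zs] finite_subset by blast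
    hence AJ: "adjoin Z a0 = A"
      by (rule adjoin_eq_if_prime_index[OF As fA Zs A(2) p A(4) a0(1,2)])
    \<comment> \<open>The centralizer of \<open>A\<close> in \<open>P\<close> contains
      \<open>Z\<close> and is proper because \<open>a0\<close> is not central, so
      \<open>step\<close> applies again and gives \<open>B\<close> of index \<open>p\<close> over
      \<open>C\<close>.\<close>
    define C where "C = {b \<in> P. \<forall>a\<in>A. conjg b a = a}"
    have "C = {b \<in> P. \<forall>a\<in>A. conjg b a \<otimes> inv a \<in> {\<one>}}"
      using conjg_eq_iff(1) PGi AG by (auto simp: C_def)
    hence Cn: "C \<lhd> G" using normal_commuting_mod[OF one_is_normal A(1) P(1)] by simp
    have Cs: "subgroup C G" by (rule normal_imp_subgroup[OF Cn])
    have CP: "C \<subseteq> P" by (auto simp: C_def)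
    have ZC: "Z \<subseteq> C"
    proof
      fix z assume z: "z \<in> Z"
      have "conjg z a = a" if "a \<in> A" for a
      proof -
        have "z \<otimes> a = a \<otimes> z" using Zcomm[OF z, of a] A(3) that by auto
        moreover have "z \<in> carrier G" using z ZP PGi by auto
        ultimately show ?thesis using AG[OF that] by (simp add: conjg_def m_assoc)
      qed
      thus "z \<in> C" using z by (simp add: C_def Z_def)
    qed
    have "C \<noteq> P"
    proof
      assume "C = P"
      hence "a0 \<in> Z" using a0(1) a0P by (auto simp: C_def Z_def)
      with a0(2) show False by simp
    qed
    moreover have "C \<noteq> {\<one>}" using \<open>z \<in> Z\<close> z(2) ZC by auto
    ultimately obtain B where B: "B \<lhd> G" "C \<subseteq> B" "B \<subseteq> P" "card B = p * card C"
      using step[OF Cn CP] by blast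
    have Bs: "subgroup B G" by (rule normal_imp_subgroup[OF B(1)])
    have fB: "finite B" using B(3) fP finite_subset by blast
    have BP: "b \<in> P" if "b \<in> B" for b using that B(3) by auto
    \<comment> \<open>Commutation with \<open>a0\<close> takes central values on \<open>P\<close>,
      hence is multiplicative. Its kernel on \<open>B\<close> is \<open>C\<close>, since
      \<open>A\<close> is generated by \<open>Z\<close> and \<open>a0\<close>; so the image of
      \<open>B\<close> has order \<open>p\<close>.\<close>
    define \<gamma> where "\<gamma> b = conjg b a0 \<otimes> inv a0" for b
    have \<gamma>Z: "\<gamma> b \<in> Z" if "b \<in> P" for b
      using a0(3)[OF that] mem_rcos_iff[OF Zs] a0G PGi[OF that] by (simp add: \<gamma>_def)
    have \<gamma>G: "\<gamma> b \<in> carrier G" if "b \<in> P" for b using \<gamma>Z[OF that] ZP PGi by auto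
    have \<gamma>c: "conjg b a0 = \<gamma> b \<otimes> a0" if "b \<in> P" for b
      using a0G PGi[OF that] by (simp add: \<gamma>_def m_assoc)
    have \<gamma>m: "\<gamma> (b \<otimes> b') = \<gamma> b \<otimes> \<gamma> b'" if b: "b \<in> P" "b' \<in> P" for b b'
    proof -
      have "conjg (b \<otimes> b') a0 = conjg b (\<gamma> b') \<otimes> conjg b a0"
        using PGi b a0G \<gamma>G by (simp add: conjg_conjg \<gamma>c[OF b(2)] conjg_mult)
      also have "conjg b (\<gamma> b') = \<gamma> b'" using \<gamma>Z[OF b(2)] b(1) by (simp add: Z_def)
      finally have "\<gamma> (b \<otimes> b') = \<gamma> b' \<otimes> \<gamma> b"
        using PGi b a0G \<gamma>G by (simp add: \<gamma>_def m_assoc)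
      thus ?thesis using Zcomm[OF \<gamma>Z[OF b(1)], of "\<gamma> b'"] \<gamma>Z[OF b(2)] ZP by auto
    qed
    note im = card_hom_image_subgroup[OF group_axioms Bs fB, of \<gamma>]
    have Ds: "subgroup (\<gamma> ` B) G" by (rule im(1)) (use BP \<gamma>G \<gamma>m in auto)
    have "card (\<gamma> ` B) * card {b \<in> B. \<gamma> b = \<one>} = card B" by (rule im(2)) (use BP \<gamma>G \<gamma>m in auto)
    moreover have "{b \<in> B. \<gamma> b = \<one>} = C"
    proof (intro equalityI subsetI)
      fix b assume b: "b \<in> {b \<in> B. \<gamma> b = \<one>}"
      hence bP: "b \<in> P" using BP by auto
      have b0: "conjg b a0 = a0" using \<gamma>c[OF bP] b a0G by simp
      have "conjg b a = a" if "a \<in> A" for a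
      proof -
        have "a \<in> adjoin Z a0" using that AJ by simp
        then obtain z i where a: "a = z \<otimes> a0 [^] (i::int)" "z \<in> Z" by (auto simp: adjoin_def)
        have zG: "z \<in> carrier G" using a(2) ZP PGi by auto
        interpret c: group_hom G G "conjg b"
          by (simp add: group_hom_def group_hom_axioms_def conjg_hom PGi[OF bP] group_axioms)
        have "conjg b a = conjg b z \<otimes> (conjg b a0) [^] i"
          using a zG a0G PGi[OF bP] by (simp add: c.hom_int_pow)
        thus ?thesis using a b0 bP by (simp add: Z_def)
      qed
      thus "b \<in> C" using bP by (simp add: C_def)
    next
      fix b assume b: "b \<in> C"
      hence "\<gamma> b = \<one>" using a0(1) a0G by (simp add: C_def \<gamma>_def)
      thus "b \<in> {b \<in> B. \<gamma> b = \<one>}" using b B(2) by auto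
    qed
    moreover have "card C > 0" using card_subgroup_pos[OF Cs] fB B(2) finite_subset by blast
    ultimately have "card (\<gamma> ` B) = p" using B(4) by simp
    moreover have "\<gamma> ` B \<lhd> G"
    proof (rule normal_conjgI[OF Ds])
      fix g d assume g: "g \<in> carrier G" and "d \<in> \<gamma> ` B"
      then obtain b where b: "b \<in> B" "d = \<gamma> b" by auto
      have bG: "b \<in> carrier G" using b BP PGi by auto
      let ?b = "conjg g b"
      have b': "?b \<in> B" by (rule normal_conjg[OF B(1) g b(1)])
      have bP': "?b \<in> P" using BP[OF b'] .
      interpret c: group_hom G G "conjg ?b"
        by (simp add: group_hom_def group_hom_axioms_def conjg_hom PGi[OF bP'] group_axioms)
      \<comment> \<open>Conjugation by \<open>g\<close> moves \<open>a0\<close> to some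
        \<open>z \<otimes> a0 [^] i\<close> with central \<open>z\<close>, and the commutator of
        \<open>?b\<close> with that element is \<open>\<gamma> ?b [^] i\<close>; this keeps the
        image invariant.\<close>
      have "conjg g a0 \<in> adjoin Z a0" using normal_conjg[OF A(1) g a0(1)] AJ by simp
      then obtain z i where a: "conjg g a0 = z \<otimes> a0 [^] (i::int)" "z \<in> Z" by (auto simp: adjoin_def)
      have zG: "z \<in> carrier G" using a(2) ZP PGi by auto
      have "conjg g d = conjg ?b (conjg g a0) \<otimes> inv (conjg g a0)"
        using b(2) g a0G bG by (simp add: \<gamma>_def conjg_def m_assoc inv_mult_group)
      also have "conjg ?b (conjg g a0) = conjg ?b z \<otimes> (conjg ?b a0) [^] i"
        using a(1) zG a0G by (simp add: c.hom_int_pow)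
      also have "conjg ?b z = z" using a(2) bP' by (simp add: Z_def)
      also have "conjg ?b a0 [^] i = \<gamma> ?b [^] i \<otimes> a0 [^] i"
        unfolding \<gamma>c[OF bP'] using Zcomm[OF \<gamma>Z[OF bP'] a0P] \<gamma>G[OF bP'] a0G by (intro int_pow_mult_distrib) auto
      also have "z \<otimes> (\<gamma> ?b [^] i \<otimes> a0 [^] i) \<otimes> inv (conjg g a0) = z \<otimes> \<gamma> ?b [^] i \<otimes> inv z"
        using a(1) zG a0G \<gamma>G[OF bP'] by (simp add: m_assoc inv_mult_group)
      also have "\<dots> = \<gamma> ?b [^] i"
      proof -
        have "\<gamma> ?b [^] i \<in> Z" by (rule subgroup_int_pow_closed[OF Zs \<gamma>Z[OF bP']])
        hence "\<gamma> ?b [^] i \<in> P" using ZP by auto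
        from Zcomm[OF a(2) this] show ?thesis using zG \<gamma>G[OF bP'] by (simp add: m_assoc)
      qed
      finally show "conjg g d \<in> \<gamma> ` B"
        using subgroup_int_pow_closed[OF Ds, of "\<gamma> ?b" i] b' by simp
    qed
    moreover have "\<gamma> ` B \<subseteq> P" using \<gamma>Z BP ZP by auto
    ultimately show False using no by blast
  qed
  show "x \<otimes> y = y \<otimes> x" using comm x y by blast
  have powP: "u [^] (n::nat) \<in> P" if "u \<in> P" for u n
    using that Ps by (induction n) (auto simp: subgroup.one_closed subgroup.m_closed)
  have powm: "(u \<otimes> v) [^] p = u [^] p \<otimes> v [^] p" if "u \<in> P" "v \<in> P" for u v
    using that comm PGi by (intro pow_mult_distrib) auto
  define \<Omega> where "\<Omega> = {u \<in> P. u [^] p = \<one>}"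
  have \<Omega>P: "\<Omega> \<subseteq> P" by (auto simp: \<Omega>_def)
  have "\<one> \<in> \<Omega>" using subgroup.one_closed[OF Ps] by (simp add: \<Omega>_def)
  hence \<Omega>s: "subgroup \<Omega> G"
    by (intro subgroupI)
      (use Ps PGi powm in \<open>auto simp: \<Omega>_def subgroup.m_closed subgroup.m_inv_closed nat_pow_inv\<close>)
  have \<Omega>n: "\<Omega> \<lhd> G"
  proof (rule normal_conjgI[OF \<Omega>s])
    fix g a assume "g \<in> carrier G" "a \<in> \<Omega>"
    thus "conjg g a \<in> \<Omega>" using normal_conjg[OF P(1)] PGi by (auto simp: \<Omega>_def simp flip: conjg_pow)
  qed
  have "\<Omega> = P"
  proof (rule ccontr)
    assume nP: "\<Omega> \<noteq> P"
    then obtain u where u: "u \<in> P" "u \<notin> \<Omega>" using \<Omega>P by auto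
    have uG: "u \<in> carrier G" using u PGi by auto
    have uk: "u [^] (p ^ k) = \<one>"
    proof -
      interpret P: group "G\<lparr>carrier := P\<rparr>" by (rule subgroup.subgroup_is_group[OF Ps group_axioms])
      have "u [^]\<^bsub>G\<lparr>carrier := P\<rparr>\<^esub> order (G\<lparr>carrier := P\<rparr>) = \<one>"
        using P.pow_order_eq_1[of u] u by simp
      thus ?thesis using P(2) by (simp add: order_def flip: nat_pow_consistent)
    qed
    \<comment> \<open>With \<open>j\<close> least, \<open>u [^] (p ^ (j - 1))\<close> is a
      nontrivial element of \<open>\<Omega>\<close>, so \<open>step\<close> applies to
      \<open>\<Omega>\<close>. In a subgroup \<open>A\<close> containing \<open>\<Omega>\<close>
      with index \<open>p\<close>, the \<open>p\<close>-th powers then form a subgroup of order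
      \<open>p\<close>.\<close>
    define j where "j = (LEAST j. u [^] (p ^ j) = \<one>)"
    have j: "u [^] (p ^ j) = \<one>" unfolding j_def by (rule LeastI[of "\<lambda>j. u [^] (p ^ j) = \<one>", OF uk])
    have "u \<noteq> \<one>" using u(2) subgroup.one_closed[OF \<Omega>s] by auto
    hence "j \<noteq> 0" using j uG by (metis nat_pow_eone power_0)
    then obtain i where i: "j = Suc i" by (cases j) auto
    have "u [^] (p ^ i) \<noteq> \<one>" using not_less_Least[of i "\<lambda>j. u [^] (p ^ j) = \<one>"] i j_def by auto
    moreover have "u [^] (p ^ i) \<in> \<Omega>"
      using j i powP[OF u(1)] uG by (simp add: \<Omega>_def nat_pow_pow mult.commute)
    ultimately have "\<Omega> \<noteq> {\<one>}" by auto
    then obtain A where A: "A \<lhd> G" "\<Omega> \<subseteq> A" "A \<subseteq> P" "card A = p * card \<Omega>"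
      using step[OF \<Omega>n \<Omega>P _ nP] by blast
    have As: "subgroup A G" by (rule normal_imp_subgroup[OF A(1)])
    have fA: "finite A" using A(3) fP finite_subset by blast
    let ?\<pi> = "\<lambda>u. u [^] p"
    note im = card_hom_image_subgroup[OF group_axioms As fA, of ?\<pi>]
    have AP: "u \<in> P" if "u \<in> A" for u using that A(3) by auto
    have Ds: "subgroup (?\<pi> ` A) G" by (rule im(1)) (use AP powm PGi in auto)
    have "card (?\<pi> ` A) * card {b \<in> A. ?\<pi> b = \<one>} = card A" by (rule im(2)) (use AP powm PGi in auto)
    moreover have "{b \<in> A. ?\<pi> b = \<one>} = \<Omega>" using A(2,3) by (auto simp: \<Omega>_def)
    moreover have "card \<Omega> > 0" using card_subgroup_pos[OF \<Omega>s] fA A(2) finite_subset by blast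
    ultimately have "card (?\<pi> ` A) = p" using A(4) by simp
    moreover have "?\<pi> ` A \<lhd> G"
    proof (rule normal_conjgI[OF Ds])
      fix g d assume g: "g \<in> carrier G" and "d \<in> ?\<pi> ` A"
      then obtain a where a: "a \<in> A" "d = a [^] p" by auto
      hence "conjg g d = (conjg g a) [^] p" using A(3) PGi g by (auto intro!: conjg_pow)
      thus "conjg g d \<in> ?\<pi> ` A" using normal_conjg[OF A(1) g a(1)] by blast
    qed
    moreover have "?\<pi> ` A \<subseteq> P" using A(3) powP by auto
    ultimately show False using no by blast
  qed
  thus "x [^] p = \<one>" using x by (auto simp: \<Omega>_def)
qed

end

section \<open>Quotients and the partial \<open>\<Pi>\<close>-property\<close>

text \<open>One link of a hypercyclic chain. The order of the factor is stated through
  cardinalities, so no factor group is formed. Normality refers to the ambient group, so a chain for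
  \<open>N_G(P)\<close> is not yet one for \<open>G\<close>. The closure
  \<open>prime_step\<^sup>*\<^sup>*\<close> also allows a chain without links.\<close>

definition (in group) prime_step :: "'a set \<Rightarrow> 'a set \<Rightarrow> bool"
  where "prime_step B C \<longleftrightarrow> B \<lhd> G \<and> C \<lhd> G \<and> B \<subseteq> C \<and> (\<exists>q. prime q \<and> card C = q * card B)"

lemma power_of_only_prime_divisor:
  assumes "0 < (n::nat)" "prime p" "\<And>q. prime q \<Longrightarrow> q dvd n \<Longrightarrow> q = p"
  shows "\<exists>r. n = p ^ r"
proof -
  obtain m where m: "n = p ^ multiplicity p n * m" "\<not> p dvd m"
    using multiplicity_decompose'[of n p] assms(1,2) by (metis not_prime_unit not_gr_zero)
  have "m = 1"
  proof (rule ccontr)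
    assume "m \<noteq> 1"
    then obtain q where "prime q" "q dvd m" using prime_factor_nat by blast
    thus False using m assms(3)[of q] by (metis dvd_mult)
  qed
  thus ?thesis using m by auto
qed

context group begin

lemma prime_step_chain_mono:
  assumes "prime_step\<^sup>*\<^sup>* B C" shows "B \<subseteq> C"
  using assms by induction (auto simp: prime_step_def)

text \<open>The index of \<open>Y\<close> divides both the \<open>p\<close>-power index of
  \<open>E\<close> and the index of \<open>S\<close>, which is prime to \<open>p\<close>. In the
  applications \<open>Y\<close> is a normalizer and \<open>E\<close> is supplied by the partial
  \<Pi>-property.\<close>

lemma subgroup_eq_if_coprime_indices:
  assumes fG: "finite (carrier G)" and Y: "subgroup Y G"
    and E: "subgroup E G" "E \<subseteq> Y" "card (carrier G) = p ^ r * card E"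
    and S: "subgroup S G" "S \<subseteq> Y" "\<not> p dvd card (carrier G) div card S" and p: "prime p"
  shows "Y = carrier G"
proof -
  have fY: "finite Y" using fG subgroup.subset[OF Y] finite_subset by blast
  obtain d where d: "card (carrier G) = card Y * d"
    using card_subgroup_dvd[OF subgroup_self Y subgroup.subset[OF Y]] by blast
  obtain e where e: "card Y = card E * e" using card_subgroup_dvd[OF Y E(1,2)] by blast
  obtain s where s: "card Y = card S * s" using card_subgroup_dvd[OF Y S(1,2)] by blast
  have "card E > 0" "card S > 0" using card_subgroup_pos E S fY finite_subset by blast+
  hence "p ^ r = e * d" using d e E(3) by (simp add: mult.assoc)
  hence "d dvd p ^ r" by simp
  then obtain j where j: "d = p ^ j" using p by (metis divides_primepow_nat)
  have "card (carrier G) div card S = s * d" using d s \<open>card S > 0\<close> by (simp add: mult.assoc)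
  hence "j = 0" using S(3) j by (cases j) auto
  thus ?thesis using d j fG subgroup.subset[OF Y] by (simp add: card_subset_eq)
qed

lemma conjg_mem_if_commutator_mem:
  assumes "subgroup X G" "x \<in> X" "y \<in> carrier G" "y \<otimes> x \<otimes> inv y \<otimes> inv x \<in> X"
  shows "conjg y x \<in> X"
proof -
  have "x \<in> carrier G" using assms(1,2) by (simp add: subgroup.mem_carrier)
  thus ?thesis
    using subgroup.m_closed[OF assms(1,4,2)] assms(3) by (simp add: conjg_def m_assoc)
qed

section \<open>Products with a normal subgroup and the correspondence theorem\<close>

lemma set_mult_mem_iff:
  "x \<in> A <#> B \<longleftrightarrow> (\<exists>a\<in>A. \<exists>b\<in>B. x = a \<otimes> b)"
  by (auto simp: set_mult_def)

lemma subgroup_set_mult_normal: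
  assumes "subgroup M G" "U \<lhd> G"
  shows "subgroup (M <#> U) G" "U \<subseteq> M <#> U" "M \<subseteq> M <#> U" "M <#> U = U <#> M"
proof -
  interpret second_isomorphism_grp U G M
    using assms by (simp add: second_isomorphism_grp_def second_isomorphism_grp_axioms_def)
  show e: "M <#> U = U <#> M" by (rule commut_normal[OF assms])
  show "subgroup (M <#> U) G" "U \<subseteq> M <#> U" "M \<subseteq> M <#> U"
    using normal_set_mult_subgroup H_contained_in_set_mult S_contained_in_set_mult by (simp_all add: e)
qed

lemma normal_set_mult:
  assumes M: "M \<lhd> G" and U: "U \<lhd> G" shows "M <#> U \<lhd> G"
proof (rule normal_conjgI)
  show "subgroup (M <#> U) G" by (rule subgroup_set_mult_normal[OF normal_imp_subgroup[OF M] U])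
next
  fix g a assume g: "g \<in> carrier G" and "a \<in> M <#> U"
  then obtain m u where a: "m \<in> M" "u \<in> U" "a = m \<otimes> u" by (auto simp: set_mult_mem_iff)
  have "m \<in> carrier G" "u \<in> carrier G"
    using a M U by (auto dest: normal_imp_subgroup subgroup.mem_carrier)
  hence "conjg g a = conjg g m \<otimes> conjg g u" using a g by (simp add: conjg_mult)
  thus "conjg g a \<in> M <#> U"
    using normal_conjg[OF M g a(1)] normal_conjg[OF U g a(2)] by (auto simp: set_mult_mem_iff)
qed

lemma group_hom_Mod: "U \<lhd> G \<Longrightarrow> group_hom G (G Mod U) (\<lambda>x. U #> x)"
  by (simp add: group_hom_def group_hom_axioms_def group_axioms normal.factorgroup_is_group normal.r_coset_hom_Mod)

lemma Mod_preimage_subgroup: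
  assumes fG: "finite (carrier G)" and U: "U \<lhd> G" and W: "subgroup W (G Mod U)"
  defines "V \<equiv> {x \<in> carrier G. U #> x \<in> W}"
  shows "subgroup V G" "U \<subseteq> V" "(\<lambda>x. U #> x) ` V = W" "card V = card W * card U"
    "W \<lhd> G Mod U \<Longrightarrow> V \<lhd> G"
proof -
  interpret U: normal U G by (rule U)
  have V: "V = \<Union>W" unfolding V_def using U.factgroup_subgroup_union_char[OF W] by simp
  show s: "subgroup V G" unfolding V by (rule U.factgroup_subgroup_union_subgroup[OF W])
  show "U \<subseteq> V"
    unfolding V_def using subgroup.one_closed[OF W] U.is_subgroup coset_join2 by auto
  show im: "(\<lambda>x. U #> x) ` V = W"
    using subgroup.subset[OF W] by (auto simp: V_def carrier_FactGroup)
  show "card V = card W * card U"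
    using card_subgroup_cosets[OF s U.is_subgroup \<open>U \<subseteq> V\<close>] fG im by (simp add: V_def)
  show "V \<lhd> G" if "W \<lhd> G Mod U" unfolding V by (rule U.factgroup_subgroup_union_normal[OF that])
qed

lemma Mod_image_normal:
  assumes "U \<lhd> G" "A \<lhd> G" shows "(\<lambda>x. U #> x) ` A \<lhd> G Mod U"
  by (rule normal.surj_hom_normal_subgroup[OF assms(2) group_hom_Mod[OF assms(1)]]) (simp add: carrier_FactGroup)

text \<open>The criterion \<open>elementary_abelian_p_subgroup\<close> is applied in
  \<open>G Mod U\<close> and pulled back by the correspondence of subgroups. Its hypotheses and
  conclusions here concern subgroups and elements of \<open>G\<close>, so the later argument stays
  in \<open>G\<close>.\<close>

lemma elementary_abelian_mod:
  assumes fG: "finite (carrier G)" and U: "U \<lhd> G" and P: "P \<lhd> G" "card P = p ^ k" and p: "prime p"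
    and UP: "U \<subseteq> P"
    and no: "\<And>A. A \<lhd> G \<Longrightarrow> U \<subseteq> A \<Longrightarrow> A \<subseteq> P \<Longrightarrow> card A \<noteq> p * card U"
    and step: "\<And>W. W \<lhd> G \<Longrightarrow> U \<subset> W \<Longrightarrow> W \<subset> P
                 \<Longrightarrow> \<exists>A. A \<lhd> G \<and> W \<subseteq> A \<and> A \<subseteq> P \<and> card A = p * card W"
    and x: "x \<in> P" and y: "y \<in> P"
  shows "x \<otimes> y \<otimes> inv x \<otimes> inv y \<in> U" and "x [^] p \<in> U"
proof -
  let ?Q = "G Mod U" and ?\<pi> = "\<lambda>x. U #> x"
  interpret U: normal U G by (rule U)
  interpret \<pi>: group_hom G ?Q ?\<pi> by (rule group_hom_Mod[OF U])
  have Ps: "subgroup P G" by (rule normal_imp_subgroup[OF P(1)])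
  note PG = subgroup.mem_carrier[OF Ps]
  have fP: "finite P" by (rule finite_p_power[OF P(2) p])
  have fU: "finite U" using UP fP finite_subset by blast
  have cU: "card U > 0" by (rule card_subgroup_pos[OF U.is_subgroup fU])
  have cA: "card A = card (?\<pi> ` A) * card U" if "A \<lhd> G" "U \<subseteq> A" for A
    by (rule card_subgroup_cosets[OF normal_imp_subgroup[OF that(1)] U.is_subgroup that(2)])
  have pre: "{x \<in> carrier G. ?\<pi> x \<in> W} \<subseteq> P" if "W \<subseteq> ?\<pi> ` P" for W
  proof
    fix v assume v: "v \<in> {x \<in> carrier G. ?\<pi> x \<in> W}"
    hence "?\<pi> v \<in> ?\<pi> ` P" using that by auto
    then obtain w where w: "v \<in> carrier G" "w \<in> P" "?\<pi> v = ?\<pi> w" using v by auto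
    hence "v \<otimes> inv w \<in> P" using rcos_eq_iff[OF U.is_subgroup, of v w] PG UP by auto
    hence "v \<otimes> inv w \<otimes> w \<in> P" using w(2) Ps by (simp only: subgroup.m_closed)
    thus "v \<in> P" using w PG by (simp add: m_assoc)
  qed
  have PQ: "?\<pi> ` P \<lhd> ?Q" by (rule Mod_image_normal[OF U P(1)])
  have "card (?\<pi> ` P) dvd p ^ k" using cA[OF P(1) UP] P(2) by (metis dvd_triv_left)
  then obtain j where cPQ: "card (?\<pi> ` P) = p ^ j" using p by (metis divides_primepow_nat)
  have no': "card A \<noteq> p" if "A \<lhd> ?Q" "A \<subseteq> ?\<pi> ` P" for A
  proof
    assume c: "card A = p"
    note M = Mod_preimage_subgroup[OF fG U normal_imp_subgroup[OF that(1)]]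
    show False
      using no[OF M(5)[OF that(1)] M(2) pre[OF that(2)]] M(4) c by simp
  qed
  have step': "\<exists>A. A \<lhd> ?Q \<and> W \<subseteq> A \<and> A \<subseteq> ?\<pi> ` P \<and> card A = p * card W"
    if W: "W \<lhd> ?Q" "W \<subseteq> ?\<pi> ` P" "W \<noteq> {\<one>\<^bsub>?Q\<^esub>}" "W \<noteq> ?\<pi> ` P" for W
  proof -
    let ?V = "{x \<in> carrier G. ?\<pi> x \<in> W}"
    note M = Mod_preimage_subgroup[OF fG U normal_imp_subgroup[OF W(1)]]
    have "?V \<noteq> U"
    proof
      assume "?V = U"
      hence "card W = 1" using M(4) cU by simp
      moreover have "\<one>\<^bsub>?Q\<^esub> \<in> W" using normal_imp_subgroup[OF W(1)] by (rule subgroup.one_closed)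
      ultimately show False using W(3) by (metis card_1_singletonE singletonD)
    qed
    moreover have "?V \<noteq> P" using M(3) W(4) by auto
    ultimately obtain A where A: "A \<lhd> G" "?V \<subseteq> A" "A \<subseteq> P" "card A = p * card ?V"
      using step[OF M(5)[OF W(1)]] M(2) pre[OF W(2)] by blast
    have "U \<subseteq> A" using A(2) M(2) by (rule subset_trans[rotated])
    hence "card (?\<pi> ` A) * card U = p * card W * card U"
      using cA[OF A(1)] A(4) M(4) by (metis mult.assoc)
    hence "card (?\<pi> ` A) = p * card W" using cU by simp
    moreover have "W \<subseteq> ?\<pi> ` A" using M(3) A(2) by blast
    ultimately show ?thesis using Mod_image_normal[OF U A(1)] A(3) by blast
  qed
  note R = group.elementary_abelian_p_subgroup[OF U.factorgroup_is_group PQ cPQ p no' step' imageI[OF x] imageI[OF y]]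
  have xy: "x \<in> carrier G" "y \<in> carrier G" using x y PG by auto
  have "?\<pi> (x \<otimes> y) = ?\<pi> (y \<otimes> x)" using R(1) U.rcos_sum[OF xy] U.rcos_sum[OF xy(2,1)] by simp
  hence "x \<otimes> y \<otimes> inv (y \<otimes> x) \<in> U"
    by (rule iffD1[OF rcos_eq_iff[OF U.is_subgroup m_closed[OF xy] m_closed[OF xy(2,1)]]])
  thus "x \<otimes> y \<otimes> inv x \<otimes> inv y \<in> U" using xy by (simp add: inv_mult_group m_assoc)
  have "?\<pi> (x [^] p) = U" using R(2) U.FactGroup_pow[OF xy(1), of p] by simp
  thus "x [^] p \<in> U" using rcos_self[OF _ U.is_subgroup, of "x [^] p"] xy by simp
qed

text \<open>Modulo \<open>S i\<close> the intersection in the definition is contained in an image of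
  \<open>M\<close>, hence a \<open>p\<close>-group; so the index of its normalizer is a power of
  \<open>p\<close>. \<open>E\<close> is the preimage of that normalizer and has the same index. This
  turns the property into a statement about conjugation inside \<open>G\<close>.\<close>

lemma partial_Pi_p_subgroup:
  assumes fG: "finite (carrier G)" and Pi: "partial_Pi_property M G" and M: "card M = p ^ k" and p: "prime p"
  shows "\<exists>n S. chief_series G n S \<and> (\<forall>i<n. \<exists>E r. subgroup E G \<and> card (carrier G) = p ^ r * card E
            \<and> (\<forall>g\<in>E. \<forall>x\<in>(M <#> S i) \<inter> S (Suc i). conjg g x \<in> (M <#> S i) \<inter> S (Suc i)))"
proof -
  from Pi have Ms: "subgroup M G" by (simp add: partial_Pi_property_def)
  from Pi obtain n S where ch: "chief_series G n S"
    and ix: "\<And>i. i < n \<Longrightarrow> (let Q = G Mod S i;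
                  X = quot_subgroup G (M <#> S i) (S i) \<inter> quot_subgroup G (S (Suc i)) (S i)
              in pi_number (pi_of X) (subgroup_index Q (normalizer Q X)))"
    unfolding partial_Pi_property_def by blast
  note MG = subgroup.mem_carrier[OF Ms]
  have "\<exists>E r. subgroup E G \<and> card (carrier G) = p ^ r * card E
            \<and> (\<forall>g\<in>E. \<forall>x\<in>(M <#> S i) \<inter> S (Suc i). conjg g x \<in> (M <#> S i) \<inter> S (Suc i))" if i: "i < n" for i
  proof -
    have Ui: "S i \<lhd> G" and Un: "S (Suc i) \<lhd> G" and UU: "S i \<subseteq> S (Suc i)"
      using ch i by (auto simp: chief_series_def)
    define U V K where "U = S i" and "V = S (Suc i)" and "K = (M <#> U) \<inter> V"
    have U: "U \<lhd> G" and V: "V \<lhd> G" and UV: "U \<subseteq> V" using Ui Un UU by (auto simp: U_def V_def)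
    let ?Q = "G Mod U" and ?\<pi> = "\<lambda>x. U #> x"
    interpret U: normal U G by (rule U)
    interpret \<pi>: group_hom G ?Q ?\<pi> by (rule group_hom_Mod[OF U])
    note MU = subgroup_set_mult_normal[OF Ms U]
    define X where "X = ?\<pi> ` (M <#> U) \<inter> ?\<pi> ` V"
    \<comment> \<open>A subgroup containing \<open>U\<close> is a union of cosets of
      \<open>U\<close>, so membership can be tested in the quotient.\<close>
    have sat: "x \<in> A" if A: "subgroup A G" "U \<subseteq> A" and x: "x \<in> carrier G" "?\<pi> x \<in> ?\<pi> ` A" for x A
    proof -
      from x(2) obtain w where w: "w \<in> A" "?\<pi> x = ?\<pi> w" by auto
      have wG: "w \<in> carrier G" using w A(1) by (simp add: subgroup.mem_carrier)
      have "x \<otimes> inv w \<in> A" using rcos_eq_iff[OF U.is_subgroup x(1) wG] w(2) A(2) by auto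
      hence "x \<otimes> inv w \<otimes> w \<in> A" using w(1) A(1) by (simp only: subgroup.m_closed)
      thus ?thesis using x(1) wG by (simp add: m_assoc)
    qed
    have Vs: "subgroup V G" by (rule normal_imp_subgroup[OF V])
    have Ks: "subgroup K G" unfolding K_def by (rule subgroups_Inter_pair[OF MU(1) Vs])
    have KX: "?\<pi> x \<in> X \<longleftrightarrow> x \<in> K" if "x \<in> carrier G" for x
      using sat[OF MU(1,2) that] sat[OF Vs UV that] by (auto simp: X_def K_def)
    have XK: "X = ?\<pi> ` K"
    proof (intro equalityI subsetI)
      fix c assume c: "c \<in> X"
      then obtain v where v: "v \<in> V" "c = ?\<pi> v" by (auto simp: X_def)
      have "v \<in> carrier G" using v Vs by (simp add: subgroup.mem_carrier)
      thus "c \<in> ?\<pi> ` K" using KX[of v] v c by auto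
    qed (auto simp: X_def K_def)
    have Xs: "subgroup X ?Q" unfolding XK by (rule \<pi>.subgroup_img_is_subgroup[OF Ks])
    have fM: "finite M" by (rule finite_p_power[OF M p])
    have "?\<pi> ` (M <#> U) \<subseteq> ?\<pi> ` M"
    proof
      fix c assume "c \<in> ?\<pi> ` (M <#> U)"
      then obtain u m where um: "u \<in> U" "m \<in> M" "c = ?\<pi> (u \<otimes> m)" by (auto simp: MU(4) set_mult_mem_iff)
      have "?\<pi> (u \<otimes> m) = ?\<pi> m"
        using rcos_eq_iff[OF U.is_subgroup, of "u \<otimes> m" m] um MG by (simp add: m_assoc)
      thus "c \<in> ?\<pi> ` M" using um by auto
    qed
    hence XM: "X \<subseteq> ?\<pi> ` M" by (auto simp: X_def)
    note im = card_hom_image_subgroup[OF \<pi>.H.group_axioms Ms fM, of ?\<pi>]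
    have "subgroup (?\<pi> ` M) ?Q" by (rule im(1)) (use MG in auto)
    from \<pi>.H.card_subgroup_dvd[OF this Xs XM] have "card X dvd card (?\<pi> ` M)" using fM by simp
    also have "card (?\<pi> ` M) * card {b \<in> M. ?\<pi> b = \<one>\<^bsub>?Q\<^esub>} = card M" by (rule im(2)) (use MG in auto)
    hence "card (?\<pi> ` M) dvd p ^ k" using M by (metis dvd_triv_left)
    finally obtain j where cX: "card X = p ^ j" using p by (metis divides_primepow_nat)
    \<comment> \<open>Only an inclusion: for trivial \<open>X\<close> the set is empty, and the
      index is then \<open>p ^ 0\<close>.\<close>
    have piX: "pi_of X \<subseteq> {p}" unfolding pi_of_def cX using p by (auto dest: prime_dvd_power primes_dvd_imp_eq)
    have XQ: "X \<subseteq> carrier ?Q" by (rule subgroup.subset[OF Xs])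
    define Nz where "Nz = \<pi>.H.normalizes X"
    have Nzs: "subgroup Nz ?Q" unfolding Nz_def by (rule \<pi>.H.subgroup_normalizes[OF XQ])
    have "pi_number (pi_of X) (subgroup_index ?Q Nz)"
      using ix[OF i] \<pi>.H.normalizer_eq_normalizes[OF XQ]
      by (simp add: Let_def quot_subgroup_def X_def U_def V_def Nz_def)
    then obtain r where r: "subgroup_index ?Q Nz = p ^ r"
      using power_of_only_prime_divisor[of "subgroup_index ?Q Nz" p] p piX by (auto simp: pi_number_def)
    have "card (rcosets\<^bsub>?Q\<^esub> Nz) * card Nz = order ?Q" by (rule \<pi>.H.lagrange[OF Nzs])
    hence oQ: "order ?Q = p ^ r * card Nz" using r by (simp add: subgroup_index_def)
    have oG: "card (carrier G) = order ?Q * card U"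
      using lagrange[OF U.is_subgroup] by (simp add: order_def FactGroup_def)
    define E where "E = {x \<in> carrier G. ?\<pi> x \<in> Nz}"
    note E = Mod_preimage_subgroup[OF fG U Nzs, folded E_def]
    have "card (carrier G) = p ^ r * card E" using oG oQ E(4) by simp
    moreover have "conjg g x \<in> K" if g: "g \<in> E" and x: "x \<in> K" for g x
    proof -
      have gx: "g \<in> carrier G" "x \<in> carrier G" using g x Ks by (auto simp: E_def subgroup.mem_carrier)
      have "?\<pi> (conjg g x) = \<pi>.H.conjg (?\<pi> g) (?\<pi> x)"
        using gx by (simp add: conjg_def \<pi>.H.conjg_def)
      also have "\<dots> \<in> X" using g x KX[OF gx(2)] by (auto simp: E_def Nz_def \<pi>.H.normalizes_def)
      finally show ?thesis using KX gx by simp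
    qed
    ultimately show ?thesis using E(1) unfolding K_def U_def V_def by blast
  qed
  thus ?thesis using ch by blast
qed

end

section \<open>Normal p-subgroups whose maximal subgroups have the partial \<open>\<Pi>\<close>-property\<close>

context group begin

text \<open>At the top of the chain the intersection with \<open>U'\<close> is \<open>U'\<close>
  itself. Suppose it drops to \<open>U\<close> in a link from \<open>C\<close> to \<open>C'\<close>.
  Minimality puts all of \<open>U'\<close> into \<open>C'\<close>, while \<open>U'\<close> meets
  \<open>C\<close> in \<open>U\<close>; so \<open>U'/U\<close> embeds into \<open>C'/C\<close>,
  which has order \<open>p\<close>, against \<open>no\<close>.\<close>

lemma unique_minimal_over_hypercyclic:
  assumes P: "P \<lhd> G" "card P = p ^ k" and p: "prime p"
    and U: "U \<lhd> G" and U': "U' \<lhd> G" "U \<subset> U'" "U' \<subseteq> P"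
    and mn: "\<And>W. W \<lhd> G \<Longrightarrow> U \<subset> W \<Longrightarrow> W \<subseteq> U' \<Longrightarrow> W = U'"
    and no: "card U' \<noteq> p * card U"
    and W: "U \<subset> W" "prime_step\<^sup>*\<^sup>* W P"
  shows "W \<inter> U' \<noteq> U"
  using W(2,1)
proof (induction rule: converse_rtranclp_induct)
  case base
  then show ?case using U'(2,3) by auto
next
  case (step C C')
  have CC: "C \<lhd> G" "C' \<lhd> G" "C \<subseteq> C'" using step(1) by (auto simp: prime_step_def)
  have ns: "C' \<inter> U' \<noteq> U" using step CC(3) by auto
  have Cs: "subgroup C G" "subgroup C' G" "subgroup U G" "subgroup U' G" "subgroup P G"
    using CC U U' P normal_imp_subgroup by auto
  have C'P: "C' \<subseteq> P" using step(2) prime_step_chain_mono by blast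
  have fP: "finite P" by (rule finite_p_power[OF P(2) p])
  have fin: "finite C'" "finite C" "finite U" "finite U'"
    using finite_subset[OF _ fP] C'P CC(3) U'(2,3) by auto
  show ?case
  proof
    assume eq: "C \<inter> U' = U"
    have "C' \<inter> U' \<lhd> G" by (rule normal_subgroup_intersect[OF CC(2) U'(1)])
    hence "C' \<inter> U' = U'" using mn[of "C' \<inter> U'"] ns eq CC(3) by auto
    hence U'C': "U' \<subseteq> C'" by auto
    obtain q where q: "prime q" "card C' = q * card C" using step(1) by (auto simp: prime_step_def)
    have "card C' dvd p ^ k" using card_subgroup_dvd[OF Cs(5,2) C'P] P(2) by simp
    hence "q dvd p ^ k" using q(2) by (metis dvd_mult_left)
    hence "q = p" using q(1) p by (metis prime_dvd_power primes_dvd_imp_eq)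
    have "card C' = card ((\<lambda>a. C #> a) ` C') * card C" by (rule card_subgroup_cosets[OF Cs(2,1) CC(3)])
    hence cC: "card ((\<lambda>a. C #> a) ` C') = p"
      using q(2) \<open>q = p\<close> card_subgroup_pos[OF Cs(1) fin(2)] by simp
    let ?E = "(\<lambda>a. U #> a) ` U'" 
    have inj: "U #> a = U #> b" if "a \<in> U'" "b \<in> U'" "C #> a = C #> b" for a b
    proof -
      have ab: "a \<in> carrier G" "b \<in> carrier G" using that Cs(4) by (auto simp: subgroup.mem_carrier)
      have "a \<otimes> inv b \<in> C" using that ab rcos_eq_iff[OF Cs(1)] by simp
      moreover have "a \<otimes> inv b \<in> U'" using that Cs(4) by (simp add: subgroup.m_closed subgroup.m_inv_closed)
      ultimately show ?thesis using rcos_eq_iff[OF Cs(3) ab] eq by auto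
    qed
    \<comment> \<open>For elements of \<open>U'\<close> the coset of \<open>C\<close> determines the
      coset of \<open>U\<close>; the function \<open>g\<close> turns this into the bound
      \<open>card ?E \<le> p\<close>.\<close>
    have "\<exists>g. \<forall>a\<in>U'. g (C #> a) = U #> a"
    proof (intro exI ballI)
      fix a assume a: "a \<in> U'"
      define b where "b = (SOME b. b \<in> U' \<and> C #> b = C #> a)"
      have "b \<in> U' \<and> C #> b = C #> a" unfolding b_def by (rule someI[of _ a]) (use a in simp)
      thus "(\<lambda>X. U #> (SOME b. b \<in> U' \<and> C #> b = X)) (C #> a) = U #> a"
        using inj[of b a] a by (simp add: b_def)
    qed
    then obtain g where g: "\<And>a. a \<in> U' \<Longrightarrow> g (C #> a) = U #> a" by blast
    have "?E \<subseteq> g ` (\<lambda>a. C #> a) ` C'" using g U'C' by (force simp: image_iff)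
    hence le: "card ?E \<le> p" using surj_card_le[of "(\<lambda>a. C #> a) ` C'" ?E g] fin(1) cC by simp
    have cU': "card U' = card ?E * card U"
      by (rule card_subgroup_cosets[OF Cs(4,3) _]) (use U'(2) in auto)
    have "p dvd card U' div card U" by (rule p_power_index_dvd(1)[OF Cs(5) P(2) p Cs(4) U'(3) Cs(3) U'(2)])
    hence "p dvd card ?E" using cU' card_subgroup_pos[OF Cs(3) fin(3)] by simp
    moreover have "card ?E > 0" using fin(4) Cs(4) subgroup.one_closed by (fastforce simp: card_gt_0_iff)
    ultimately have "card ?E = p" using le by (simp add: dvd_imp_le le_antisym)
    thus False using cU' no by simp
  qed
qed

text \<open>Take \<open>X\<close> maximal among the proper \<open>S\<close>-invariant subgroups of
  \<open>V\<close> over \<open>U\<close>. The \<open>p\<close>-group \<open>S\<close> fixes a coset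
  of \<open>X\<close> in \<open>V\<close> other than \<open>X\<close>, and its representative
  \<open>z\<close> normalizes \<open>X\<close> because commutators lie in \<open>U\<close>.
  Adjoining \<open>z\<close> gives an invariant subgroup, hence all of \<open>V\<close>, and
  \<open>z [^] p\<close> in \<open>U\<close> makes the index \<open>p\<close>.\<close>

lemma invariant_subgroup_of_prime_index:
  assumes P: "subgroup P G" "card P = p ^ k" and p: "prime p"
    and S: "subgroup S G" "card S = p ^ l"
    and U: "subgroup U G" and V: "subgroup V G" "U \<subset> V" "V \<subseteq> P"
    and SU: "\<And>s u. s \<in> S \<Longrightarrow> u \<in> U \<Longrightarrow> conjg s u \<in> U" and SV: "\<And>s v. s \<in> S \<Longrightarrow> v \<in> V \<Longrightarrow> conjg s v \<in> V"
    and com: "\<And>x y. x \<in> P \<Longrightarrow> y \<in> P \<Longrightarrow> x \<otimes> y \<otimes> inv x \<otimes> inv y \<in> U" and pw: "\<And>x. x \<in> P \<Longrightarrow> x [^] p \<in> U"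
  shows "\<exists>X. subgroup X G \<and> U \<subseteq> X \<and> X \<subset> V \<and> card V = p * card X \<and> (\<forall>s\<in>S. \<forall>x\<in>X. conjg s x \<in> X)"
proof -
  have fP: "finite P" by (rule finite_p_power[OF P(2) p])
  note PG = subgroup.mem_carrier[OF P(1)]
  note SG = subgroup.mem_carrier[OF S(1)]
  let ?T = "{X. subgroup X G \<and> U \<subseteq> X \<and> X \<subset> V \<and> (\<forall>s\<in>S. \<forall>x\<in>X. conjg s x \<in> X)}"
  have "finite ?T" by (rule finite_subset[of _ "Pow P"]) (use fP V in auto)
  moreover have "U \<in> ?T" using U V(2) SU by auto
  ultimately obtain X where X: "X \<in> ?T" and mx: "\<And>Z. Z \<in> ?T \<Longrightarrow> X \<subseteq> Z \<Longrightarrow> Z = X"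
    using finite_has_maximal2[of ?T U] by (metis (no_types, lifting))
  have X': "subgroup X G" "U \<subseteq> X" "X \<subset> V" "\<And>s x. s \<in> S \<Longrightarrow> x \<in> X \<Longrightarrow> conjg s x \<in> X" using X by auto
  have fV: "finite V" using V(3) fP finite_subset by blast
  have fX: "finite X" using X'(3) fV finite_subset by blast
  have XG: "X \<subseteq> carrier G" by (rule subgroup.subset[OF X'(1)])
  have dX: "p dvd card V div card X" by (rule p_power_index_dvd(1)[OF P p V(1,3) X'(1,3)])
  have "\<exists>z\<in>V - X. \<forall>w\<in>S. conjg w z \<in> X #> z"
    by (rule p_group_centralizes_mod[OF S(1) p S(2) V(1) X'(1) _ fV SV X'(4) dX]) (use X' in auto)
  then obtain z where z: "z \<in> V" "z \<notin> X" "\<And>w. w \<in> S \<Longrightarrow> conjg w z \<in> X #> z" by blast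
  have zP: "z \<in> P" and zG: "z \<in> carrier G" using z V(3) PG by auto
  have zn: "z \<in> normalizes X"
  proof (subst normalizes_iff[OF fX XG], intro conjI ballI zG)
    fix x assume x: "x \<in> X"
    have xP: "x \<in> P" using x X'(3) V(3) by auto
    show "conjg z x \<in> X"
      by (rule conjg_mem_if_commutator_mem[OF X'(1) x zG]) (use com[OF zP xP] X'(2) in auto)
  qed
  note A = subgroup_adjoin[OF X'(1) zn]
  have AV: "adjoin X z \<subseteq> V" by (rule adjoin_subset[OF V(1) _ z(1)]) (use X' in auto)
  have "conjg s a \<in> adjoin X z" if s: "s \<in> S" and a: "a \<in> adjoin X z" for s a
  proof -
    from a obtain x i where x: "a = x \<otimes> z [^] (i::int)" "x \<in> X" by (auto simp: adjoin_def)
    interpret c: group_hom G G "conjg s"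
      by (simp add: group_hom_def group_hom_axioms_def conjg_hom SG[OF s] group_axioms)
    have "conjg s z \<otimes> inv z \<in> X" using z(3)[OF s] mem_rcos_iff[OF X'(1)] zG SG[OF s] by simp
    hence "conjg s z \<otimes> inv z \<otimes> z \<in> adjoin X z" by (intro subgroup.m_closed[OF A(1) subsetD[OF A(2)] A(3)])
    hence "conjg s z \<in> adjoin X z" using zG SG[OF s] by (simp add: m_assoc)
    hence "conjg s z [^] i \<in> adjoin X z" by (rule subgroup_int_pow_closed[OF A(1)])
    moreover have "conjg s x \<in> adjoin X z" using X'(4)[OF s x(2)] A(2) by auto
    ultimately have "conjg s x \<otimes> conjg s z [^] i \<in> adjoin X z" by (intro subgroup.m_closed[OF A(1)])
    moreover have "x \<in> carrier G" using x XG by auto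
    ultimately show ?thesis using x zG by (simp add: c.hom_int_pow)
  qed
  moreover have "adjoin X z \<notin> ?T" using mx[of "adjoin X z"] A(2,3) z(2) by auto
  moreover have "U \<subseteq> adjoin X z" using A(2) X'(2) by auto
  ultimately have "adjoin X z = V" using A(1) AV by (auto simp: psubset_eq)
  moreover have "card (adjoin X z) = p * card X"
    by (rule card_adjoin_p[OF P p X'(1) _ zP z(2) zn]) (use X' V(3) pw[OF zP] in auto)
  ultimately show ?thesis using X' by blast
qed

text \<open>\<open>P/U\<close> is a vector space over the field with \<open>p\<close> elements, and
  a hyperplane over \<open>X\<close> missing \<open>z\<close> is wanted: choose \<open>M\<close>
  maximal with these two properties. For \<open>y\<close> in \<open>P\<close> outside
  \<open>M\<close> the subgroup \<open>adjoin M y\<close> contains \<open>z\<close> and has the same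
  order as \<open>adjoin M z\<close>, so all these extensions coincide.\<close>

lemma maximal_subgroup_avoiding:
  assumes P: "subgroup P G" "card P = p ^ k" and p: "prime p"
    and U: "subgroup U G"
    and com: "\<And>x y. x \<in> P \<Longrightarrow> y \<in> P \<Longrightarrow> x \<otimes> y \<otimes> inv x \<otimes> inv y \<in> U" and pw: "\<And>x. x \<in> P \<Longrightarrow> x [^] p \<in> U"
    and X: "subgroup X G" "U \<subseteq> X" "X \<subseteq> P" and z: "z \<in> P" "z \<notin> X"
  shows "\<exists>M. maximal_subgroup M (G\<lparr>carrier := P\<rparr>) \<and> X \<subseteq> M \<and> z \<notin> M"
proof -
  have fP: "finite P" by (rule finite_p_power[OF P(2) p])
  note PG = subgroup.mem_carrier[OF P(1)]
  let ?T = "{M. subgroup M G \<and> X \<subseteq> M \<and> M \<subseteq> P \<and> z \<notin> M}"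
  have "finite ?T" by (rule finite_subset[of _ "Pow P"]) (use fP in auto)
  moreover have "X \<in> ?T" using X z by auto
  ultimately obtain M where M: "M \<in> ?T" and mx: "\<And>Z. Z \<in> ?T \<Longrightarrow> M \<subseteq> Z \<Longrightarrow> Z = M"
    using finite_has_maximal2[of ?T X] by (metis (no_types, lifting))
  have M': "subgroup M G" "X \<subseteq> M" "M \<subseteq> P" "z \<notin> M" using M by auto
  have fM: "finite M" using M'(3) fP finite_subset by blast
  have Mn: "y \<in> normalizes M" if y: "y \<in> P" for y
  proof (subst normalizes_iff[OF fM subgroup.subset[OF M'(1)]], intro conjI ballI PG[OF y])
    fix x assume x: "x \<in> M"
    have xP: "x \<in> P" using x M'(3) by auto
    show "conjg y x \<in> M"
      by (rule conjg_mem_if_commutator_mem[OF M'(1) x PG[OF y]]) (use com[OF y xP] X(2) M'(2) in auto)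
  qed
  have cM: "card (adjoin M y) = p * card M" if "y \<in> P" "y \<notin> M" for y
    by (rule card_adjoin_p[OF P p M'(1,3) that Mn[OF that(1)]]) (use pw[OF that(1)] X(2) M'(2) in auto)
  have "K = M \<or> K = P" if K: "subgroup K (G\<lparr>carrier := P\<rparr>)" "M \<subseteq> K" for K
  proof (cases "K = M")
    case False
    have Ks: "subgroup K G" by (rule incl_subgroup[OF P(1) K(1)])
    have KP: "K \<subseteq> P" using subgroup.subset[OF K(1)] by simp
    have zK: "z \<in> K" using mx[of K] False Ks K(2) KP M'(2) by auto
    have "y \<in> K" if y: "y \<in> P" for y
    proof (cases "y \<in> M")
      case True thus ?thesis using K(2) by auto
    next
      case False
      note A = subgroup_adjoin[OF M'(1) Mn[OF y]]
      have AP: "adjoin M y \<subseteq> P" by (rule adjoin_subset[OF P(1) M'(3) y])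
      have "z \<in> adjoin M y" using mx[of "adjoin M y"] A AP M'(2) False by auto
      hence sub: "adjoin M z \<subseteq> adjoin M y" by (rule adjoin_subset[OF A(1,2)])
      have "finite (adjoin M y)" using AP fP finite_subset by blast
      hence "adjoin M z = adjoin M y"
        using sub cM[OF y False] cM[OF z(1) M'(4)] by (simp add: card_subset_eq)
      moreover have "adjoin M z \<subseteq> K" by (rule adjoin_subset[OF Ks K(2) zK])
      ultimately show ?thesis using A(3) by auto
    qed
    thus ?thesis using KP by auto
  qed simp
  moreover have "subgroup M (G\<lparr>carrier := P\<rparr>)" by (rule subgroup_incl[OF M'(1) P(1) M'(3)])
  ultimately have "maximal_subgroup M (G\<lparr>carrier := P\<rparr>)"
    using M'(4) z(1) unfolding maximal_subgroup_def by auto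
  thus ?thesis using M' by blast
qed

text \<open>If no normal subgroup of order \<open>p |U|\<close> lies between \<open>U\<close> and \<open>P\<close>, then \<open>P/U\<close> is elementary abelian and
  contains a unique minimal normal subgroup \<open>V/U\<close> of \<open>G/U\<close>. A subgroup \<open>X\<close> of index \<open>p\<close> in \<open>V\<close> that is
  invariant under a Sylow \<open>p\<close>-subgroup of \<open>G\<close> has the form \<open>M \<inter> V\<close> with \<open>M\<close> maximal in \<open>P\<close>, and the
  hypothesis on \<open>M\<close> makes the index of the normalizer of \<open>X\<close> a power of \<open>p\<close>. So \<open>X\<close> is normal.\<close>

theorem hypercyclic_if_maximal_subgroups_partial_Pi:
  assumes fG: "finite (carrier G)" and P: "P \<lhd> G" "card P = p ^ k" and p: "prime p"
    and max: "\<And>M. maximal_subgroup M (G\<lparr>carrier := P\<rparr>) \<Longrightarrow> partial_Pi_property M G"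
    and U: "U \<lhd> G" "U \<subseteq> P"
  shows "prime_step\<^sup>*\<^sup>* U P"
  using U
proof (induction "card P - card U" arbitrary: U rule: less_induct)
  case less
  note U = less.prems
  have Ps: "subgroup P G" by (rule normal_imp_subgroup[OF P(1)])
  have Us: "subgroup U G" by (rule normal_imp_subgroup[OF U(1)])
  have fP: "finite P" by (rule finite_p_power[OF P(2) p])
  note PG = subgroup.mem_carrier[OF Ps]
  have IH: "prime_step\<^sup>*\<^sup>* W P" if "W \<lhd> G" "U \<subset> W" "W \<subseteq> P" for W
  proof (rule less.hyps[OF _ that(1,3)])
    have "card U < card W" "card W \<le> card P"
      using that fP finite_subset[OF that(3) fP] by (auto intro: psubset_card_mono card_mono)
    thus "card P - card W < card P - card U" by simp
  qed
  show ?case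
  proof (cases "U = P")
    case False
    hence UP: "U \<subset> P" using U by auto
    have pstep: "\<exists>A. A \<lhd> G \<and> W \<subseteq> A \<and> A \<subseteq> P \<and> card A = p * card W \<and> W \<noteq> A"
      if W: "prime_step\<^sup>*\<^sup>* W P" "W \<noteq> P" for W
    proof -
      from W obtain A where A: "prime_step W A" "prime_step\<^sup>*\<^sup>* A P" by (metis converse_rtranclpE)
      then obtain q where q: "A \<lhd> G" "W \<subseteq> A" "prime q" "card A = q * card W" "W \<lhd> G"
        by (auto simp: prime_step_def)
      have AP: "A \<subseteq> P" by (rule prime_step_chain_mono[OF A(2)])
      have "card A dvd p ^ k" using card_subgroup_dvd[OF Ps normal_imp_subgroup[OF q(1)] AP] P(2) by simp
      hence "q dvd p ^ k" using q(4) by (metis dvd_mult_left)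
      hence "q = p" using q(3) p by (metis prime_dvd_power primes_dvd_imp_eq)
      moreover have "finite W" by (rule finite_subset[OF subset_trans[OF q(2) AP] fP])
      hence "card W > 0" by (rule card_subgroup_pos[OF normal_imp_subgroup[OF q(5)]])
      ultimately have "W \<noteq> A" using q(4) p by (auto dest: prime_gt_1_nat)
      thus ?thesis using q AP \<open>q = p\<close> by blast
    qed
    show ?thesis
    proof (cases "\<exists>A. A \<lhd> G \<and> U \<subseteq> A \<and> A \<subseteq> P \<and> card A = p * card U")
      case True
      then obtain A where A: "A \<lhd> G" "U \<subseteq> A" "A \<subseteq> P" "card A = p * card U" by blast
      have "card U > 0" by (rule card_subgroup_pos[OF Us finite_subset[OF U(2) fP]])
      hence "U \<noteq> A" using A(4) p by (auto dest: prime_gt_1_nat)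
      hence "prime_step\<^sup>*\<^sup>* A P" using IH A by auto
      moreover have "prime_step U A" using A U p by (auto simp: prime_step_def)
      ultimately show ?thesis by (rule converse_rtranclp_into_rtranclp[rotated])
    next
      case False
      hence no: "card A \<noteq> p * card U" if "A \<lhd> G" "U \<subseteq> A" "A \<subseteq> P" for A using that by blast
      have step: "\<exists>A. A \<lhd> G \<and> W \<subseteq> A \<and> A \<subseteq> P \<and> card A = p * card W" if "W \<lhd> G" "U \<subset> W" "W \<subset> P" for W
        using pstep[OF IH[OF that(1,2)]] that(3) by blast
      have EA: "x \<otimes> y \<otimes> inv x \<otimes> inv y \<in> U" if "x \<in> P" "y \<in> P" for x y
        by (rule elementary_abelian_mod(1)[OF fG U(1) P p U(2) no step that])
      have EAp: "x [^] p \<in> U" if "x \<in> P" for x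
        by (rule elementary_abelian_mod(2)[OF fG U(1) P p U(2) no step that that])
      let ?T = "{W. W \<lhd> G \<and> U \<subset> W \<and> W \<subseteq> P}"
      have "finite ?T" by (rule finite_subset[of _ "Pow P"]) (use fP in auto)
      moreover have "P \<in> ?T" using P UP by auto
      ultimately obtain V where V: "V \<in> ?T" and mn: "\<And>Z. Z \<in> ?T \<Longrightarrow> Z \<subseteq> V \<Longrightarrow> Z = V"
        using finite_has_minimal2[of ?T P] by (metis (no_types, lifting))
      have V': "V \<lhd> G" "U \<subset> V" "V \<subseteq> P" using V by auto
      have Vs: "subgroup V G" by (rule normal_imp_subgroup[OF V'(1)])
      have fV: "finite V" using V'(3) fP finite_subset by blast
      have mn': "W = V" if "W \<lhd> G" "U \<subset> W" "W \<subseteq> V" for W using mn[of W] that V' by auto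
      \<comment> \<open>The chain above \<open>W\<close> forces \<open>W\<close> to meet
        \<open>V\<close> in more than \<open>U\<close>, and then minimality of \<open>V\<close>
        gives \<open>V \<subseteq> W\<close>.\<close>
      have uniq: "V \<subseteq> W" if W: "W \<lhd> G" "U \<subset> W" "W \<subseteq> P" for W
      proof -
        have "W \<inter> V \<noteq> U"
          using unique_minimal_over_hypercyclic[OF P p U(1) V' mn' no[OF V'(1) _ V'(3)] W(2) IH[OF W]] V'(2) by auto
        hence "W \<inter> V = V"
          using mn'[OF normal_subgroup_intersect[OF W(1) V'(1)]] W(2) V'(2) by auto
        thus ?thesis by auto
      qed
      obtain S where S: "sylow_in p S (carrier G)" using sylow_in_exists[OF subgroup_self fG p] by blast
      note S' = sylow_inD[OF S]
      then obtain l where l: "card S = p ^ l" by blast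
      have SG: "s \<in> carrier G" if "s \<in> S" for s using that S' by auto
      obtain X where X: "subgroup X G" "U \<subseteq> X" "X \<subset> V" "card V = p * card X" "\<And>s x. s \<in> S \<Longrightarrow> x \<in> X \<Longrightarrow> conjg s x \<in> X"
        using invariant_subgroup_of_prime_index[OF Ps P(2) p S'(2) l Us Vs V'(2,3)
            normal_conjg[OF U(1) SG] normal_conjg[OF V'(1) SG] EA EAp] by blast
      obtain z where z: "z \<in> V" "z \<notin> X" using X(3) by auto
      have zP: "z \<in> P" using z V' by auto
      obtain M where M: "maximal_subgroup M (G\<lparr>carrier := P\<rparr>)" "X \<subseteq> M" "z \<notin> M"
        using maximal_subgroup_avoiding[OF Ps P(2) p Us EA EAp X(1,2) _ zP z(2)] X(3) V'(3) by blast
      have Ms: "subgroup M G" and MP: "M \<subseteq> P"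
        using M(1) incl_subgroup[OF Ps] subgroup.subset[of M "G\<lparr>carrier := P\<rparr>"] by (auto simp: maximal_subgroup_def)
      have fX: "finite X" using X(3) fV finite_subset by blast
      have XG: "X \<subseteq> carrier G" by (rule subgroup.subset[OF X(1)])
      have MV: "M \<inter> V = X"
      proof (intro equalityI subsetI)
        fix w assume w: "w \<in> M \<inter> V"
        show "w \<in> X"
        proof (rule ccontr)
          assume nw: "w \<notin> X"
          have wP: "w \<in> P" using w MP by auto
          have "w \<in> normalizes X"
          proof (subst normalizes_iff[OF fX XG], intro conjI ballI PG[OF wP])
            fix x assume x: "x \<in> X"
            have xP: "x \<in> P" using x X(3) V'(3) by auto
            show "conjg w x \<in> X"
              by (rule conjg_mem_if_commutator_mem[OF X(1) x PG[OF wP]]) (use EA[OF wP xP] X(2) in auto)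
          qed
          hence "adjoin X w = V"
            by (intro adjoin_eq_if_prime_index[OF Vs fV X(1) _ p X(4) _ nw]) (use w X(3) in auto)
          moreover have "adjoin X w \<subseteq> M" by (rule adjoin_subset[OF Ms M(2)]) (use w in auto)
          ultimately show False using z(1) M(3) by auto
        qed
      qed (use X M in auto)
      have "card M dvd p ^ k" using card_subgroup_dvd[OF Ps Ms MP] P(2) by simp
      then obtain j where cM: "card M = p ^ j" using p by (metis divides_primepow_nat)
      obtain n T where T: "chief_series G n T" and E: "\<And>i. i < n \<Longrightarrow> \<exists>E r. subgroup E G \<and> card (carrier G) = p ^ r * card E
            \<and> (\<forall>g\<in>E. \<forall>x\<in>(M <#> T i) \<inter> T (Suc i). conjg g x \<in> (M <#> T i) \<inter> T (Suc i))"
        using partial_Pi_p_subgroup[OF fG max[OF M(1)] cM p] by blast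
      have T0: "T 0 = {\<one>}" and Tn: "T n = carrier G" and TN: "\<And>i. i \<le> n \<Longrightarrow> T i \<lhd> G"
        using T by (auto simp: chief_series_def)
      \<comment> \<open>\<open>m\<close> is the first index at which the given chief series,
        intersected with \<open>P\<close>, leaves \<open>U\<close>. With \<open>m = Suc i\<close>,
        \<open>P \<inter> T i\<close> lies in \<open>U\<close> and, by uniqueness of
        \<open>V\<close>, \<open>(P \<inter> T (Suc i)) <#> U\<close> contains
        \<open>V\<close>.\<close>
      define m where "m = (LEAST j. \<not> P \<inter> T j \<subseteq> U)"
      have "\<not> P \<inter> T n \<subseteq> U" using Tn UP PG by auto
      hence m: "\<not> P \<inter> T m \<subseteq> U" and mle: "m \<le> n"
        unfolding m_def by (rule LeastI, rule Least_le)
      have "m \<noteq> 0" using m T0 subgroup.one_closed[OF Us] by (cases m) auto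
      then obtain i where i: "m = Suc i" by (cases m) auto
      have Ti: "P \<inter> T i \<subseteq> U" using not_less_Least[of i "\<lambda>j. \<not> P \<inter> T j \<subseteq> U"] i m_def by auto
      have iN: "T i \<lhd> G" "T (Suc i) \<lhd> G" using TN i mle by auto
      have Tis: "subgroup (T i) G" "subgroup (T (Suc i)) G" using iN normal_imp_subgroup by auto
      let ?W = "(P \<inter> T (Suc i)) <#> U"
      have PT: "P \<inter> T (Suc i) \<lhd> G" by (rule normal_subgroup_intersect[OF P(1) iN(2)])
      have "?W \<lhd> G" by (rule normal_set_mult[OF PT U(1)])
      note Wsub = subgroup_set_mult_normal[OF normal_imp_subgroup[OF PT] U(1)]
      have "?W \<subseteq> P" using subgroup.m_closed[OF Ps] subsetD[OF U(2)] by (auto simp: set_mult_mem_iff)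
      moreover have "U \<subset> ?W" using Wsub(2,3) m i by auto
      ultimately have VW: "V \<subseteq> ?W" using uniq[OF \<open>?W \<lhd> G\<close>] by blast
      obtain E r where E: "subgroup E G" "card (carrier G) = p ^ r * card E"
        "\<And>g x. g \<in> E \<Longrightarrow> x \<in> (M <#> T i) \<inter> T (Suc i) \<Longrightarrow> conjg g x \<in> (M <#> T i) \<inter> T (Suc i)"
        using E[of i] i mle by auto
      have UM: "U \<subseteq> M" using X(2) M(2) by auto
      \<comment> \<open>Write \<open>x = y \<otimes> u\<close> with \<open>y\<close> in
        \<open>M \<inter> T (Suc i)\<close>. The conjugate of \<open>y\<close> is
        \<open>a \<otimes> t\<close> with \<open>a\<close> in \<open>M\<close> and \<open>t\<close>
        in \<open>T i\<close>. Since that conjugate and \<open>a\<close> lie in \<open>P\<close>, so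
        does \<open>t\<close>; hence \<open>t\<close> is in \<open>U\<close>, and the conjugate of
        \<open>x\<close> stays in \<open>M \<inter> V = X\<close>.\<close>
      have EX: "conjg g x \<in> X" if g: "g \<in> E" and x: "x \<in> X" for g x
      proof -
        have gG: "g \<in> carrier G" using g E(1) by (simp add: subgroup.mem_carrier)
        have "x \<in> ?W" using x X(3) VW by auto
        then obtain y u where y: "y \<in> P" "y \<in> T (Suc i)" "u \<in> U" "x = y \<otimes> u" by (auto simp: set_mult_mem_iff)
        have G: "y \<in> carrier G" "u \<in> carrier G" using y PG U(2) by auto
        have "y = x \<otimes> inv u" using y G by (simp add: m_assoc)
        hence "y \<in> M" using subsetD[OF M(2) x] subsetD[OF UM y(3)] Ms
          by (simp add: subgroup.m_closed subgroup.m_inv_closed)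
        hence "y \<in> (M <#> T i) \<inter> T (Suc i)" using subgroup_set_mult_normal(3)[OF Ms iN(1)] y by auto
        hence "conjg g y \<in> (M <#> T i)" using E(3)[OF g] by blast
        then obtain a t where a: "a \<in> M" "t \<in> T i" "conjg g y = a \<otimes> t" by (auto simp: set_mult_mem_iff)
        have aG: "a \<in> carrier G" "t \<in> carrier G" using a MP PG Tis(1) by (auto simp: subgroup.mem_carrier)
        have "conjg g y \<in> P" by (rule normal_conjg[OF P(1) gG y(1)])
        moreover have "t = inv a \<otimes> conjg g y" using a aG by simp
        ultimately have "t \<in> P" using a(1) MP Ps by (auto intro!: subgroup.m_closed subgroup.m_inv_closed)
        hence "t \<in> M" using a(2) Ti UM by auto
        hence "conjg g y \<in> M" using a Ms by (simp add: subgroup.m_closed)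
        moreover have "conjg g u \<in> M" using normal_conjg[OF U(1) gG y(3)] UM by auto
        ultimately have "conjg g x \<in> M" using y(4) G gG Ms by (simp add: conjg_mult subgroup.m_closed)
        moreover have "conjg g x \<in> V" using normal_conjg[OF V'(1) gG] x X(3) by auto
        ultimately show ?thesis using MV by auto
      qed
      have "normalizes X = carrier G"
      proof (rule subgroup_eq_if_coprime_indices[OF fG subgroup_normalizes[OF XG] E(1) _ E(2) S'(2) _ S'(5) p])
        show "E \<subseteq> normalizes X" using normalizes_iff[OF fX XG] EX E(1) by (auto simp: subgroup.mem_carrier)
        show "S \<subseteq> normalizes X" using normalizes_iff[OF fX XG] X(5) SG by auto
      qed
      hence "X \<lhd> G" using normal_conjgI[OF X(1)] normalizes_iff[OF fX XG] by auto
      \<comment> \<open>A normal \<open>X\<close> properly below \<open>V\<close> is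
        \<open>U\<close> by minimality, so \<open>card V = p * card U\<close>, which this case
        excludes.\<close>
      hence "X = U" using mn'[of X] X(2,3) by auto
      hence False using no[OF V'(1) _ V'(3)] X(4) V'(2) by auto
      thus ?thesis ..
    qed
  qed simp
qed

end

section \<open>Transfer\<close>

context group begin

text \<open>The transversal \<open>T\<close> is chosen so that it varies only by right factors \<open>\<sigma> c \<in> B\<close> inside a double coset.
  Then for \<open>b \<in> B\<close> every factor of the transfer is a conjugate of an element of \<open>B\<close>, and the
  value on \<open>B\<close> comes out without decomposing cosets into cycles.\<close>

lemma transfer_to_abelian_group:
  assumes C: "comm_group C" and H: "subgroup H G" "finite H" and B: "subgroup B G" "B \<subseteq> H"
    and \<phi>C: "\<And>b. b \<in> B \<Longrightarrow> \<phi> b \<in> carrier C"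
    and \<phi>m: "\<And>a b. a \<in> B \<Longrightarrow> b \<in> B \<Longrightarrow> \<phi> (a \<otimes> b) = \<phi> a \<otimes>\<^bsub>C\<^esub> \<phi> b"
    and fus: "\<And>b g. b \<in> B \<Longrightarrow> g \<in> H \<Longrightarrow> conjg g b \<in> B \<Longrightarrow> \<phi> (conjg g b) = \<phi> b"
  shows "\<exists>V. (\<forall>h\<in>H. V h \<in> carrier C) \<and> (\<forall>h\<in>H. \<forall>h'\<in>H. V (h \<otimes> h') = V h \<otimes>\<^bsub>C\<^esub> V h')
           \<and> (\<forall>b\<in>B. V b = \<phi> b [^]\<^bsub>C\<^esub> (card H div card B))"
proof -
  interpret C: comm_group C by (rule C)
  note HG = subgroup.mem_carrier[OF H(1)]
  have BH: "b \<in> H" if "b \<in> B" for b using that B by auto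
  have BG: "b \<in> carrier G" if "b \<in> B" for b using HG[OF BH[OF that]] .
  have BGs: "B \<subseteq> carrier G" using BG by auto
  have Hm: "a \<otimes> b \<in> H" if "a \<in> H" "b \<in> H" for a b using that H by (simp add: subgroup.m_closed)
  have Hi: "inv a \<in> H" if "a \<in> H" for a using that H by (simp add: subgroup.m_inv_closed)
  have Bm: "a \<otimes> b \<in> B" if "a \<in> B" "b \<in> B" for a b using that B by (simp add: subgroup.m_closed)
  have Bi: "inv a \<in> B" if "a \<in> B" for a using that B by (simp add: subgroup.m_inv_closed)
  have \<phi>i: "\<phi> (inv b) = inv\<^bsub>C\<^esub> \<phi> b" if b: "b \<in> B" for b
  proof -
    have "\<phi> \<one> \<otimes>\<^bsub>C\<^esub> \<phi> \<one> = \<phi> \<one>" using \<phi>m[of \<one> \<one>] subgroup.one_closed[OF B(1)] by simp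
    hence "\<phi> \<one> = \<one>\<^bsub>C\<^esub>" using \<phi>C[of \<one>] subgroup.one_closed[OF B(1)] by (metis C.r_cancel_one)
    hence "\<phi> (inv b) \<otimes>\<^bsub>C\<^esub> \<phi> b = \<one>\<^bsub>C\<^esub>" using \<phi>m[OF Bi[OF b] b] BG[OF b] by simp
    thus ?thesis using \<phi>C[OF b] \<phi>C[OF Bi[OF b]] by (simp add: C.inv_equality)
  qed
  let ?E = "(\<lambda>a. B #> a) ` H"
  have "card B > 0" using card_subgroup_pos[OF B(1)] B(2) H(2) finite_subset by blast
  hence cE: "card ?E = card H div card B" using card_subgroup_cosets[OF H(1) B(1,2)] by simp
  have act: "B #> a #> h = B #> (a \<otimes> h)" if "a \<in> H" "h \<in> H" for a h
    by (rule coset_mult_assoc[OF BGs HG[OF that(1)] HG[OF that(2)]])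
  have Ecl: "c #> h \<in> ?E" if "c \<in> ?E" "h \<in> H" for c h using that act Hm by auto
  have EG: "c \<subseteq> carrier G" if "c \<in> ?E" for c using that BG HG by (auto simp: r_coset_def)
  have actact: "c #> h #> h' = c #> (h \<otimes> h')" if "c \<in> ?E" "h \<in> H" "h' \<in> H" for c h h'
    by (rule coset_mult_assoc[OF EG[OF that(1)] HG[OF that(2)] HG[OF that(3)]])
  have bij: "bij_betw (\<lambda>c. c #> h) ?E ?E" if h: "h \<in> H" for h
  proof (rule bij_betw_byWitness[where f' = "\<lambda>c. c #> inv h"])
    show "\<forall>c\<in>?E. c #> h #> inv h = c"
      using actact[OF _ h Hi[OF h]] HG[OF h] coset_mult_one EG by simp
    show "\<forall>c\<in>?E. c #> inv h #> h = c"
      using actact[OF _ Hi[OF h] h] HG[OF h] coset_mult_one EG by simp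
  qed (use Ecl h Hi in auto)
  define g where "g D = (SOME h. h \<in> D)" for D :: "'a set"
  have ex: "\<exists>s. s \<in> B \<and> g (c <#> B) \<otimes> s \<in> c" and gH: "g (c <#> B) \<in> H" if c: "c \<in> ?E" for c
  proof -
    from c obtain h where h: "h \<in> H" "c = B #> h" by auto
    have "h \<otimes> \<one> \<in> c <#> B" using h rcos_self[OF HG[OF h(1)] B(1)] subgroup.one_closed[OF B(1)]
      unfolding set_mult_def by blast
    hence "g (c <#> B) \<in> c <#> B" unfolding g_def by (rule someI)
    then obtain x a where x: "x \<in> c" "a \<in> B" "g (c <#> B) = x \<otimes> a" by (auto simp: set_mult_mem_iff)
    have xH: "x \<in> H" using x(1) h BH Hm by (auto simp: r_coset_def)
    show "g (c <#> B) \<in> H" using x xH BH Hm by simp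
    have "g (c <#> B) \<otimes> inv a = x" using x xH HG BG by (simp add: m_assoc)
    thus "\<exists>s. s \<in> B \<and> g (c <#> B) \<otimes> s \<in> c"
      using x(1,2) Bi by (intro exI[of _ "inv a"]) simp
  qed
  define \<sigma> where "\<sigma> c = (SOME s. s \<in> B \<and> g (c <#> B) \<otimes> s \<in> c)" for c
  define T where "T c = g (c <#> B) \<otimes> \<sigma> c" for c
  have \<sigma>B: "\<sigma> c \<in> B" and Tc: "T c \<in> c" if "c \<in> ?E" for c
    using someI_ex[OF ex[OF that]] by (auto simp: \<sigma>_def T_def)
  have TH: "T c \<in> H" if "c \<in> ?E" for c using gH[OF that] \<sigma>B[OF that] BH Hm by (simp add: T_def)
  have cT: "c = B #> T c" if c: "c \<in> ?E" for c
  proof -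
    from c obtain h where h: "h \<in> H" "c = B #> h" by auto
    show ?thesis using repr_independence[of "T c" B h] Tc[OF c] HG[OF h(1)] B(1) h(2) by simp
  qed
  define w where "w c h = T c \<otimes> h \<otimes> inv (T (c #> h))" for c h
  have wB: "w c h \<in> B" if "c \<in> ?E" "h \<in> H" for c h
  proof -
    have "B #> (T c \<otimes> h) = c #> h" using act[OF TH[OF that(1)] that(2)] cT[OF that(1)] by simp
    also have "\<dots> = B #> T (c #> h)" by (rule cT[OF Ecl[OF that]])
    finally show ?thesis
      unfolding w_def using rcos_eq_iff[OF B(1)] HG TH that Ecl Hm by simp
  qed
  define V where "V h = finprod C (\<lambda>c. \<phi> (w c h)) ?E" for h
  have VC: "V h \<in> carrier C" if "h \<in> H" for h
    unfolding V_def by (rule C.finprod_closed) (use wB \<phi>C that in auto)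
  have reindex: "finprod C (\<lambda>c. f (c #> h)) ?E = finprod C f ?E"
    if "h \<in> H" "\<And>c. c \<in> ?E \<Longrightarrow> f c \<in> carrier C" for f h
  proof -
    have b: "inj_on (\<lambda>c. c #> h) ?E" "(\<lambda>c. c #> h) ` ?E = ?E"
      using bij[OF that(1)] by (auto simp: bij_betw_def)
    show ?thesis using C.finprod_reindex[of f "\<lambda>c. c #> h" ?E] b that(2) by (simp add: Pi_iff)
  qed
  \<comment> \<open>The factors satisfy
    \<open>w c (h \<otimes> h') = w c h \<otimes> w (c #> h) h'\<close>, and right multiplication by
    \<open>h\<close> permutes the cosets, so the products over all cosets multiply.\<close>
  have Vm: "V (h \<otimes> h') = V h \<otimes>\<^bsub>C\<^esub> V h'" if h: "h \<in> H" "h' \<in> H" for h h'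
  proof -
    have "\<phi> (w c (h \<otimes> h')) = \<phi> (w c h) \<otimes>\<^bsub>C\<^esub> \<phi> (w (c #> h) h')" if c: "c \<in> ?E" for c
    proof -
      have "w c (h \<otimes> h') = w c h \<otimes> w (c #> h) h'"
        unfolding w_def actact[OF c h] using HG[OF TH[OF c]] HG[OF TH[OF Ecl[OF c h(1)]]] 
          HG[OF TH[OF Ecl[OF c Hm[OF h]]]] HG h by (simp add: m_assoc)
      thus ?thesis using \<phi>m wB c h Ecl by simp
    qed
    hence "V (h \<otimes> h') = finprod C (\<lambda>c. \<phi> (w c h) \<otimes>\<^bsub>C\<^esub> \<phi> (w (c #> h) h')) ?E"
      unfolding V_def by (intro C.finprod_cong') (use \<phi>C wB Ecl h in auto)
    also have "\<dots> = V h \<otimes>\<^bsub>C\<^esub> finprod C (\<lambda>c. \<phi> (w (c #> h) h')) ?E"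
      unfolding V_def by (rule C.finprod_multf) (use \<phi>C wB Ecl h in auto)
    also have "finprod C (\<lambda>c. \<phi> (w (c #> h) h')) ?E = V h'"
      unfolding V_def by (rule reindex[OF h(1)]) (use \<phi>C wB h in auto)
    finally show ?thesis .
  qed
  have VB: "V b = \<phi> b [^]\<^bsub>C\<^esub> (card H div card B)" if b: "b \<in> B" for b
  proof -
    have bH: "b \<in> H" using BH[OF b] .
    \<comment> \<open>Right multiplication by \<open>b\<close> stays in the double coset, so both
      representatives share the factor \<open>g (c <#> B)\<close> and \<open>w c b\<close> is a
      conjugate of \<open>?x\<close> by it; trivial fusion removes the conjugation. In the product
      the \<open>\<sigma>\<close> factors cancel after reindexing, leaving one
      \<open>\<phi> b\<close> per coset.\<close>
    have "\<phi> (w c b) = (\<phi> (\<sigma> c) \<otimes>\<^bsub>C\<^esub> \<phi> b) \<otimes>\<^bsub>C\<^esub> inv\<^bsub>C\<^esub> \<phi> (\<sigma> (c #> b))" if c: "c \<in> ?E" for c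
    proof -
      have c': "c #> b \<in> ?E" by (rule Ecl[OF c bH])
      have "c #> b <#> B = c <#> B"
      proof -
        have "c #> b <#> B = c <#> (b <# B)" using rcos_assoc_lcos[OF EG[OF c] BGs BG[OF b]] by simp
        also have "b <# B = B" by (rule coset_join3[OF BG[OF b] B(1) b])
        finally show ?thesis .
      qed
      hence eq: "T (c #> b) = g (c <#> B) \<otimes> \<sigma> (c #> b)" by (simp add: T_def)
      let ?x = "\<sigma> c \<otimes> b \<otimes> inv (\<sigma> (c #> b))"
      have xB: "?x \<in> B" using \<sigma>B[OF c] \<sigma>B[OF c'] b Bm Bi by simp
      have "w c b = conjg (g (c <#> B)) ?x"
        unfolding w_def eq using HG[OF gH[OF c]] BG[OF \<sigma>B[OF c]] BG[OF \<sigma>B[OF c']] BG[OF b]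
        by (simp add: T_def conjg_def m_assoc inv_mult_group)
      hence "\<phi> (w c b) = \<phi> ?x" using fus[OF xB gH[OF c]] wB[OF c bH] by simp
      thus ?thesis using \<phi>m \<phi>i \<sigma>B[OF c] \<sigma>B[OF c'] b Bm Bi by simp
    qed
    hence "V b = finprod C (\<lambda>c. (\<phi> (\<sigma> c) \<otimes>\<^bsub>C\<^esub> \<phi> b) \<otimes>\<^bsub>C\<^esub> inv\<^bsub>C\<^esub> \<phi> (\<sigma> (c #> b))) ?E"
      unfolding V_def by (intro C.finprod_cong') (use \<phi>C \<sigma>B Ecl b bH in auto)
    also have "\<dots> = (finprod C (\<lambda>c. \<phi> (\<sigma> c)) ?E \<otimes>\<^bsub>C\<^esub> finprod C (\<lambda>c. \<phi> b) ?E)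
        \<otimes>\<^bsub>C\<^esub> finprod C (\<lambda>c. inv\<^bsub>C\<^esub> \<phi> (\<sigma> (c #> b))) ?E"
      using \<phi>C \<sigma>B Ecl b bH by (simp add: C.finprod_multf Pi_iff)
    also have "finprod C (\<lambda>c. inv\<^bsub>C\<^esub> \<phi> (\<sigma> (c #> b))) ?E = finprod C (\<lambda>c. inv\<^bsub>C\<^esub> \<phi> (\<sigma> c)) ?E"
      by (rule reindex[OF bH]) (use \<phi>C \<sigma>B in auto)
    also have "finprod C (\<lambda>c. \<phi> b) ?E = \<phi> b [^]\<^bsub>C\<^esub> card ?E" by (rule C.finprod_const[OF \<phi>C[OF b]])
    also have "finprod C (\<lambda>c. \<phi> (\<sigma> c)) ?E \<otimes>\<^bsub>C\<^esub> \<phi> b [^]\<^bsub>C\<^esub> card ?E \<otimes>\<^bsub>C\<^esub> finprod C (\<lambda>c. inv\<^bsub>C\<^esub> \<phi> (\<sigma> c)) ?E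
       = \<phi> b [^]\<^bsub>C\<^esub> card ?E \<otimes>\<^bsub>C\<^esub> (finprod C (\<lambda>c. \<phi> (\<sigma> c)) ?E \<otimes>\<^bsub>C\<^esub> finprod C (\<lambda>c. inv\<^bsub>C\<^esub> \<phi> (\<sigma> c)) ?E)"
      using \<phi>C \<sigma>B b by (simp add: C.m_ac Pi_iff)
    also have "finprod C (\<lambda>c. \<phi> (\<sigma> c)) ?E \<otimes>\<^bsub>C\<^esub> finprod C (\<lambda>c. inv\<^bsub>C\<^esub> \<phi> (\<sigma> c)) ?E
        = finprod C (\<lambda>c. \<phi> (\<sigma> c) \<otimes>\<^bsub>C\<^esub> inv\<^bsub>C\<^esub> \<phi> (\<sigma> c)) ?E"
      by (rule C.finprod_multf[symmetric]) (use \<phi>C \<sigma>B in auto)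
    also have "\<dots> = \<one>\<^bsub>C\<^esub>" by (rule C.finprod_one_eqI) (use \<phi>C \<sigma>B in auto)
    finally show ?thesis using \<phi>C[OF b] cE by simp
  qed
  show ?thesis using VC Vm VB by blast
qed

text \<open>The transfer of \<open>H\<close> into the abelian group \<open>B/K\<close> acts on
  \<open>B\<close> as the power with exponent \<open>card H div card B\<close>, which is prime to
  the order of \<open>B/K\<close>; so it is onto, and its kernel \<open>L\<close> has the right
  order.\<close>

lemma normal_complement_if_fusion_trivial:
  assumes H: "subgroup H G" "finite H" and B: "subgroup B G" "B \<subseteq> H" and K: "subgroup K G" "K \<subseteq> B"
    and nK: "\<And>h k. h \<in> H \<Longrightarrow> k \<in> K \<Longrightarrow> conjg h k \<in> K"
    and com: "\<And>x y. x \<in> B \<Longrightarrow> y \<in> B \<Longrightarrow> x \<otimes> y \<otimes> inv x \<otimes> inv y \<in> K"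
    and fus: "\<And>b g. b \<in> B \<Longrightarrow> g \<in> H \<Longrightarrow> conjg g b \<in> B \<Longrightarrow> conjg g b \<otimes> inv b \<in> K"
    and cop: "coprime (card H div card B) (card B div card K)"
  shows "\<exists>L. subgroup L G \<and> K \<subseteq> L \<and> L \<subseteq> H \<and> (\<forall>h\<in>H. \<forall>l\<in>L. conjg h l \<in> L) \<and> card L = card K * (card H div card B)"
proof -
  note HG = subgroup.mem_carrier[OF H(1)]
  have BH: "b \<in> H" if "b \<in> B" for b using that B by auto
  have BG: "b \<in> carrier G" if "b \<in> B" for b using HG[OF BH[OF that]] .
  have fB: "finite B" by (rule finite_subset[OF B(2) H(2)])
  have fK: "finite K" by (rule finite_subset[OF K(2) fB])
  let ?B = "G\<lparr>carrier := B\<rparr>" and ?n = "card H div card B"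
  let ?C = "?B Mod K" and ?\<phi> = "\<lambda>b. K #> b"
  interpret B: group ?B by (rule subgroup.subgroup_is_group[OF B(1) group_axioms])
  interpret N: normal K ?B
  proof (rule B.normal_invI[OF subgroup_incl[OF K(1) B(1) K(2)]])
    fix x h assume "x \<in> carrier ?B" "h \<in> K"
    thus "x \<otimes>\<^bsub>?B\<^esub> h \<otimes>\<^bsub>?B\<^esub> inv\<^bsub>?B\<^esub> x \<in> K"
      using nK[of x h] BH m_inv_consistent[OF B(1)] by (simp add: conjg_def)
  qed
  have \<phi>m: "K #> (a \<otimes> b) = (K #> a) \<otimes>\<^bsub>?C\<^esub> (K #> b)" if "a \<in> B" "b \<in> B" for a b
    using N.rcos_sum[of a b] that by simp
  have cC: "carrier ?C = ?\<phi> ` B" by (auto simp: carrier_FactGroup)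
  have "comm_group ?C"
  proof (rule group.group_comm_groupI[OF N.factorgroup_is_group])
    fix X Y assume "X \<in> carrier ?C" "Y \<in> carrier ?C"
    then obtain a b where ab: "a \<in> B" "b \<in> B" "X = K #> a" "Y = K #> b" by (auto simp: cC)
    have "K #> (a \<otimes> b) = K #> (b \<otimes> a)"
      by (rule iffD2[OF rcos_eq_iff[OF K(1)]]) (use ab BG com[OF ab(1,2)] in \<open>auto simp: inv_mult_group m_assoc\<close>)
    thus "X \<otimes>\<^bsub>?C\<^esub> Y = Y \<otimes>\<^bsub>?C\<^esub> X" using \<phi>m ab by simp
  qed
  then interpret C: comm_group ?C .
  have \<phi>f: "?\<phi> (conjg g b) = ?\<phi> b" if "b \<in> B" "g \<in> H" "conjg g b \<in> B" for b g
    by (rule iffD2[OF rcos_eq_iff[OF K(1)]]) (use that BG HG fus in auto)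
  have "\<exists>V. (\<forall>h\<in>H. V h \<in> carrier ?C) \<and> (\<forall>h\<in>H. \<forall>h'\<in>H. V (h \<otimes> h') = V h \<otimes>\<^bsub>?C\<^esub> V h')
           \<and> (\<forall>b\<in>B. V b = ?\<phi> b [^]\<^bsub>?C\<^esub> ?n)"
    by (rule transfer_to_abelian_group[OF C.comm_group_axioms H B _ \<phi>m \<phi>f]) (simp_all add: cC)
  then obtain V where V: "\<forall>h\<in>H. V h \<in> carrier ?C" "\<forall>h\<in>H. \<forall>h'\<in>H. V (h \<otimes> h') = V h \<otimes>\<^bsub>?C\<^esub> V h'"
      "\<forall>b\<in>B. V b = ?\<phi> b [^]\<^bsub>?C\<^esub> ?n"
    by (elim exE conjE)
  note VC = bspec[OF V(1)] and Vm = bspec[OF bspec[OF V(2)]] and VB = bspec[OF V(3)]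
  define L where "L = {h \<in> H. V h = \<one>\<^bsub>?C\<^esub>}"
  have cardC: "card B = card (carrier ?C) * card K"
    unfolding cC by (rule card_subgroup_cosets[OF B(1) K])
  have cK: "card K > 0" by (rule card_subgroup_pos[OF K(1) fK])
  have cB: "card B > 0" by (rule card_subgroup_pos[OF B(1) fB])
  have oC: "card (carrier ?C) = card B div card K" using cardC cK by simp
  have "V ` H = carrier ?C"
  proof (intro equalityI subsetI)
    fix c assume "c \<in> carrier ?C"
    then obtain b where b: "b \<in> B" "c = ?\<phi> b" by (auto simp: cC)
    have fC: "finite (carrier ?C)" using fB by (simp add: cC)
    have cin: "c \<in> carrier ?C" using b cC by auto
    have "card (carrier ?C) > 0" using fC C.one_closed by (auto simp: card_gt_0_iff)
    have "coprime ?n (card (carrier ?C))" using cop oC by simp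
    moreover have "?n \<noteq> 0"
      using card_subgroup_pos[OF H] card_subgroup_dvd[OF H(1) B] cB by (auto elim!: dvdE)
    \<comment> \<open>\<open>m\<close> inverts \<open>?n\<close> modulo the order of
      \<open>?C\<close>, so \<open>V\<close> sends \<open>b [^] m\<close> to the given coset
      \<open>c\<close>.\<close>
    ultimately obtain m k where m: "?n * m = card (carrier ?C) * k + 1"
      using bezout_nat[of ?n "card (carrier ?C)"] by (auto simp: coprime_iff_gcd_eq_1)
    have bm: "b [^] m \<in> B" using b(1) B(1) by (induction m) (auto simp: subgroup.one_closed subgroup.m_closed)
    have "K #> b [^] m = c [^]\<^bsub>?C\<^esub> m"
      using N.FactGroup_pow[of b m] b nat_pow_consistent by simp
    hence "V (b [^] m) = c [^]\<^bsub>?C\<^esub> (?n * m)" using VB[OF bm] cin by (simp add: C.nat_pow_pow mult.commute)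
    also have "\<dots> = c"
    proof -
      have "c [^]\<^bsub>?C\<^esub> (card (carrier ?C) * k) = \<one>\<^bsub>?C\<^esub>"
        using C.pow_order_eq_1[OF cin] C.nat_pow_pow[OF cin, of "card (carrier ?C)" k] C.nat_pow_one[of k]
        by (simp add: order_def)
      hence "c [^]\<^bsub>?C\<^esub> (?n * m) = c"
        unfolding m using C.nat_pow_mult[OF cin, of "card (carrier ?C) * k" 1, symmetric] C.l_one[OF cin] cin by simp
      thus ?thesis using cin by simp
    qed
    finally show "c \<in> V ` H" using BH[OF bm] by (metis image_eqI)
  qed (use VC in auto)
  note im = card_hom_image_subgroup[OF C.is_group H(1,2), of V]
  have "card (V ` H) * card L = card H" unfolding L_def by (rule im(2)) (use VC Vm in auto)
  moreover have "card H = ?n * card B" using card_subgroup_dvd[OF H(1) B] by simp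
  ultimately have "card (carrier ?C) * card L = card (carrier ?C) * (card K * ?n)"
    using \<open>V ` H = carrier ?C\<close> cardC by (simp add: ac_simps)
  moreover have "card (carrier ?C) > 0" using cardC cB by (metis gr0I mult_0)
  ultimately have cL: "card L = card K * ?n" by simp
  have V1: "V \<one> = \<one>\<^bsub>?C\<^esub>"
    using Vm[of \<one> \<one>] VC[of \<one>] subgroup.one_closed[OF H(1)] by (metis C.r_cancel_one one_closed r_one)
  have Vi: "V (inv h) = inv\<^bsub>?C\<^esub> V h" if h: "h \<in> H" for h
  proof -
    have "inv h \<in> H" using h H by (simp add: subgroup.m_inv_closed)
    moreover have "V (inv h) \<otimes>\<^bsub>?C\<^esub> V h = \<one>\<^bsub>?C\<^esub>"
      using Vm[OF \<open>inv h \<in> H\<close> h] V1 HG[OF h] by simp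
    ultimately show ?thesis using VC h by (intro C.inv_equality[symmetric]) auto
  qed
  have "\<one> \<in> L" using V1 subgroup.one_closed[OF H(1)] by (simp add: L_def)
  have Li: "inv a \<in> L" if a: "a \<in> L" for a
  proof -
    have "V (inv a) = inv\<^bsub>?C\<^esub> \<one>\<^bsub>?C\<^esub>" using Vi[of a] a by (simp only: L_def mem_Collect_eq)
    also have "\<dots> = \<one>\<^bsub>?C\<^esub>" by (rule C.inv_one)
    finally show ?thesis using a H(1) unfolding L_def by (blast intro: subgroup.m_inv_closed)
  qed
  have Lm: "a \<otimes> b \<in> L" if ab: "a \<in> L" "b \<in> L" for a b
  proof -
    have "V (a \<otimes> b) = \<one>\<^bsub>?C\<^esub> \<otimes>\<^bsub>?C\<^esub> \<one>\<^bsub>?C\<^esub>" using Vm[of a b] ab by (simp only: L_def mem_Collect_eq)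
    also have "\<dots> = \<one>\<^bsub>?C\<^esub>" by (rule C.l_one[OF C.one_closed])
    finally show ?thesis using ab H(1) unfolding L_def by (blast intro: subgroup.m_closed)
  qed
  have "L \<subseteq> carrier G" using HG by (auto simp: L_def)
  with \<open>\<one> \<in> L\<close> Li Lm have Ls: "subgroup L G" by (intro subgroupI) auto
  have KL: "K \<subseteq> L"
  proof
    fix k assume k: "k \<in> K"
    have kB: "k \<in> B" using k K by auto
    have "?\<phi> k = K" using k K(1) BG[OF kB] coset_join2 by blast
    hence "V k = \<one>\<^bsub>?C\<^esub> [^]\<^bsub>?C\<^esub> ?n" using VB[OF kB] by simp
    thus "k \<in> L" using BH[OF kB] C.nat_pow_one unfolding L_def by simp
  qed
  have "conjg h l \<in> L" if h: "h \<in> H" and l: "l \<in> L" for h l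
  proof -
    have lH: "l \<in> H" and Vl: "V l = \<one>\<^bsub>?C\<^esub>" using l by (auto simp: L_def)
    have iH: "inv h \<in> H" and hl: "h \<otimes> l \<in> H" using h lH H by (auto simp: subgroup.m_inv_closed subgroup.m_closed)
    have "V (conjg h l) = \<one>\<^bsub>?C\<^esub>"
      unfolding conjg_def using Vm[OF hl iH] Vm[OF h lH] Vl Vi[OF h] VC[OF h] C.r_one C.r_inv by metis
    thus ?thesis using hl iH H(1) by (simp add: L_def conjg_def subgroup.m_closed)
  qed
  thus ?thesis using Ls KL cL unfolding L_def by blast
qed

end

section \<open>Normal p-complements\<close>

lemma card_image_le_if_factors:
  assumes "finite A" and "\<And>a b. a \<in> A \<Longrightarrow> b \<in> A \<Longrightarrow> u a = u b \<Longrightarrow> v a = v b"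
  shows "card (v ` A) \<le> card (u ` A)"
proof -
  have "v a \<in> (\<lambda>c. v (inv_into A u c)) ` u ` A" if a: "a \<in> A" for a
  proof -
    have "v (inv_into A u (u a)) = v a"
      by (rule assms(2)) (use a in \<open>simp_all add: inv_into_into f_inv_into_f\<close>)
    thus ?thesis using a by (metis image_eqI)
  qed
  hence "v ` A \<subseteq> (\<lambda>c. v (inv_into A u c)) ` u ` A" by auto
  thus ?thesis using surj_card_le[of "u ` A" "v ` A" "\<lambda>c. v (inv_into A u c)"] assms(1) by simp
qed

lemma card_image_eq_if_same_fibres:
  assumes "finite A" and "\<And>a b. a \<in> A \<Longrightarrow> b \<in> A \<Longrightarrow> f a = f b \<longleftrightarrow> g a = g b"
  shows "card (f ` A) = card (g ` A)"
  by (rule le_antisym; rule card_image_le_if_factors[OF assms(1)]) (simp_all add: assms(2))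

context group begin

text \<open>Cosets of \<open>C\<close> represented in \<open>Y\<close> correspond to cosets of
  \<open>C \<inter> Y\<close> in \<open>Y\<close>. When the Frattini argument shows that
  \<open>Y\<close> represents every coset of \<open>C\<close>, this gives the index of
  \<open>C\<close> in the whole group.\<close>

lemma card_cosets_Int:
  assumes C: "subgroup C G" and Y: "subgroup Y G" "finite Y"
  shows "card ((\<lambda>y. C #> y) ` Y) * card (C \<inter> Y) = card Y"
proof -
  have CY: "subgroup (C \<inter> Y) G" by (rule subgroups_Inter_pair[OF C Y(1)])
  note YG = subgroup.mem_carrier[OF Y(1)]
  have "card ((\<lambda>y. C #> y) ` Y) = card ((\<lambda>y. (C \<inter> Y) #> y) ` Y)"
  proof (rule card_image_eq_if_same_fibres[OF Y(2)])
    fix a b assume ab: "a \<in> Y" "b \<in> Y"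
    have "a \<otimes> inv b \<in> Y" using ab Y by (simp add: subgroup.m_closed subgroup.m_inv_closed)
    thus "C #> a = C #> b \<longleftrightarrow> (C \<inter> Y) #> a = (C \<inter> Y) #> b"
      using rcos_eq_iff[OF C] rcos_eq_iff[OF CY] ab YG by auto
  qed
  thus ?thesis using card_subgroup_cosets[OF Y(1) CY _] by simp
qed

lemma card_set_mult_normal:
  assumes M: "subgroup M G" "finite M" and U: "U \<lhd> G"
  shows "card (M <#> U) * card (U \<inter> M) = card M * card U"
proof -
  have Us: "subgroup U G" by (rule normal_imp_subgroup[OF U])
  note MU = subgroup_set_mult_normal[OF M(1) U]
  have "(\<lambda>x. U #> x) ` (M <#> U) = (\<lambda>x. U #> x) ` M"
  proof (intro equalityI subsetI)
    fix X assume "X \<in> (\<lambda>x. U #> x) ` (M <#> U)"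
    then obtain u m where um: "u \<in> U" "m \<in> M" "X = U #> (u \<otimes> m)"
      by (auto simp: MU(4) set_mult_mem_iff)
    have G: "u \<in> carrier G" "m \<in> carrier G" using um M Us by (auto simp: subgroup.mem_carrier)
    have "U #> (u \<otimes> m) = U #> m" using rcos_eq_iff[OF Us, of "u \<otimes> m" m] G um(1) by (simp add: m_assoc)
    thus "X \<in> (\<lambda>x. U #> x) ` M" using um by auto
  qed (use MU(3) in auto)
  moreover have "card (M <#> U) = card ((\<lambda>x. U #> x) ` (M <#> U)) * card U"
    by (rule card_subgroup_cosets[OF MU(1) Us MU(2)])
  moreover have "card ((\<lambda>x. U #> x) ` M) * card (U \<inter> M) = card M" by (rule card_cosets_Int[OF Us M])
  ultimately show ?thesis by (metis mult.assoc mult.commute)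
qed

lemma p_power_index_if_covered:
  assumes V: "subgroup V G" "card V = p ^ j" and p: "prime p" and K: "K \<lhd> G" "finite K"
  shows "\<exists>i. card (V <#> K) div card K = p ^ i"
proof -
  have Ks: "subgroup K G" by (rule normal_imp_subgroup[OF K(1)])
  note VK = subgroup_set_mult_normal[OF V(1) K(1)]
  have cK: "card K > 0" by (rule card_subgroup_pos[OF Ks K(2)])
  obtain c where c: "card (V <#> K) = card K * c" using card_subgroup_dvd[OF VK(1) Ks VK(2)] by blast
  have "card (V <#> K) * card (K \<inter> V) = p ^ j * card K"
    using card_set_mult_normal[OF V(1) finite_p_power[OF V(2) p] K(1)] V(2) by simp
  hence "c * card (K \<inter> V) = p ^ j" using c cK by (simp add: ac_simps)
  hence "c dvd p ^ j" by (metis dvd_triv_left)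
  thus ?thesis using c cK p by (simp add: divides_primepow_nat) blast
qed

lemma mem_if_coprime_powers_mem:
  assumes K: "subgroup K G" and x: "x \<in> carrier G" "x [^] (m::nat) \<in> K" "x [^] (n::nat) \<in> K" and c: "coprime m n"
  shows "x \<in> K"
proof (cases "m = 0")
  case True thus ?thesis using c x by simp
next
  case False
  then obtain u v where uv: "m * u = n * v + 1"
    using bezout_nat[of m n] c by (auto simp: coprime_iff_gcd_eq_1)
  have pw: "y [^] (k::nat) \<in> K" if "y \<in> K" for y k
    using that K by (induction k) (auto simp: subgroup.one_closed subgroup.m_closed)
  have "x [^] (m * u) \<in> K" "x [^] (n * v) \<in> K"
    using pw[OF x(2), of u] pw[OF x(3), of v] x(1) by (simp_all add: nat_pow_pow)
  hence "inv (x [^] (n * v)) \<otimes> x [^] (n * v + 1) \<in> K"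
    using K uv by (simp add: subgroup.m_closed subgroup.m_inv_closed)
  moreover have "x [^] (n * v + 1) = x [^] (n * v) \<otimes> x" by simp
  ultimately show ?thesis using x(1) by simp
qed

text \<open>\<open>L\<close> is a normal Hall subgroup of \<open>H\<close> modulo \<open>K\<close>,
  hence characteristic there. Elementwise: a conjugate of \<open>l\<close> has its power with
  exponent \<open>card L div card K\<close> in \<open>K\<close> and its power with exponent
  \<open>card H div card L\<close> in \<open>L\<close>, and these exponents are coprime.\<close>

lemma normal_if_coprime_indices:
  assumes fG: "finite (carrier G)" and K: "K \<lhd> G" and H: "H \<lhd> G" and L: "subgroup L G" "K \<subseteq> L" "L \<subseteq> H"
    and HL: "\<And>h l. h \<in> H \<Longrightarrow> l \<in> L \<Longrightarrow> conjg h l \<in> L"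
    and c: "coprime (card L div card K) (card H div card L)"
  shows "L \<lhd> G"
proof (rule normal_conjgI[OF L(1)])
  fix g l assume g: "g \<in> carrier G" and l: "l \<in> L"
  have Ks: "subgroup K G" and Hs: "subgroup H G" using K H normal_imp_subgroup by auto
  have G: "K \<subseteq> carrier G" "L \<subseteq> carrier G" "H \<subseteq> carrier G" using Ks Hs L(1) subgroup.subset by auto
  have fin: "finite K" "finite L" "finite H" using finite_subset[OF _ fG] G by auto
  have lG: "l \<in> carrier G" using l G by auto
  have hH: "conjg g l \<in> H" by (rule normal_conjg[OF H g]) (use l L in auto)
  have "L \<subseteq> normalizes K" using normalizes_iff[OF fin(1) G(1)] normal_conjg[OF K] G(2) by auto
  hence "l [^] (card L div card K) \<in> K" by (rule pow_index_mem[OF L(1) fin(2) Ks L(2) _ l])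
  hence "conjg g l [^] (card L div card K) \<in> L"
    using normal_conjg[OF K g] L(2) g lG by (auto simp flip: conjg_pow)
  moreover have "H \<subseteq> normalizes L" using normalizes_iff[OF fin(2) G(2)] HL G(3) by auto
  hence "conjg g l [^] (card H div card L) \<in> L" by (rule pow_index_mem[OF Hs fin(3) L(1,3) _ hH])
  ultimately show "conjg g l \<in> L" using mem_if_coprime_powers_mem[OF L(1) _ _ _ c] g lG by simp
qed

text \<open>Modulo \<open>K\<close>, \<open>B\<close> is an abelian Sylow \<open>p\<close>-subgroup
  of \<open>H\<close> without fusion, so transfer produces a normal \<open>p\<close>-complement
  \<open>L\<close> of \<open>H\<close> over \<open>K\<close>. Coprimality of the indices makes
  \<open>L\<close> normal in \<open>G\<close>, as the next stage of the descent requires.\<close>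

lemma extend_p_complement:
  assumes fG: "finite (carrier G)" and p: "prime p" and K: "K \<lhd> G" and H: "H \<lhd> G"
    and B: "subgroup B G" "K \<subseteq> B" "B \<subseteq> H"
    and pH: "\<not> p dvd card H div card B" and pB: "card B div card K = p ^ j"
    and com: "\<And>x y. x \<in> B \<Longrightarrow> y \<in> B \<Longrightarrow> x \<otimes> y \<otimes> inv x \<otimes> inv y \<in> K"
    and fus: "\<And>b g. b \<in> B \<Longrightarrow> g \<in> H \<Longrightarrow> conjg g b \<in> B \<Longrightarrow> conjg g b \<otimes> inv b \<in> K"
  shows "\<exists>L. L \<lhd> G \<and> K \<subseteq> L \<and> L \<subseteq> H \<and> \<not> p dvd card L div card K \<and> (\<exists>j. card H = p ^ j * card L)"
proof -
  have Ks: "subgroup K G" and Hs: "subgroup H G" using K H normal_imp_subgroup by auto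
  have fH: "finite H" using subgroup.subset[OF Hs] fG finite_subset by blast
  have fB: "finite B" using B(3) fH finite_subset by blast
  have fK: "finite K" using B(2) fB finite_subset by blast
  have cop: "coprime (card H div card B) (card B div card K)"
    using pH p unfolding pB by (simp add: prime_imp_coprime coprime_commute)
  obtain L where L: "subgroup L G" "K \<subseteq> L" "L \<subseteq> H" "\<And>h l. h \<in> H \<Longrightarrow> l \<in> L \<Longrightarrow> conjg h l \<in> L"
      "card L = card K * (card H div card B)"
    using normal_complement_if_fusion_trivial[OF Hs fH B(1,3) Ks B(2) _ com fus cop]
      normal_conjg[OF K] subgroup.mem_carrier[OF Hs] by blast
  have cK: "card K > 0" by (rule card_subgroup_pos[OF Ks fK])
  have "card H = (card H div card B) * card B" using card_subgroup_dvd[OF Hs B(1,3)] by simp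
  moreover have "card B = p ^ j * card K" using card_subgroup_dvd[OF B(1) Ks B(2)] pB by (metis dvd_div_mult_self)
  ultimately have cH: "card H = p ^ j * card L" using L(5) by (metis mult.assoc mult.commute)
  have LK: "card L div card K = card H div card B" using L(5) cK by simp
  have "card L > 0" using card_subgroup_pos[OF L(1)] L(3) fH finite_subset by blast
  hence "card H div card L = card B div card K" using cH pB by simp
  hence "L \<lhd> G" using normal_if_coprime_indices[OF fG K H L(1-4)] cop LK by simp
  thus ?thesis using L cH LK pH by auto
qed

lemma derived_subset_iff:
  assumes "subgroup Y G" "\<And>x y. x \<in> P \<Longrightarrow> y \<in> P \<Longrightarrow> x \<otimes> y \<otimes> inv x \<otimes> inv y \<in> Y"
  shows "derived G P \<subseteq> Y"
  unfolding derived_def by (rule generate_subgroup_incl[OF _ assms(1)]) (use assms(2) in auto)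

lemma commutator_mem_derived:
  "x \<in> P \<Longrightarrow> y \<in> P \<Longrightarrow> x \<otimes> y \<otimes> inv x \<otimes> inv y \<in> derived G P"
  unfolding derived_def by (rule generate.incl) auto

lemma sylow_in_of_coprime_index:
  assumes P: "sylow_in p P A" and A: "subgroup A G" "A \<subseteq> H" and H: "subgroup H G" "finite H"
    and c: "\<not> p dvd card H div card A"
  shows "sylow_in p P H"
proof -
  note P' = sylow_inD[OF P]
  have fA: "finite A" using A H finite_subset by blast
  have fP: "finite P" using P' fA finite_subset by blast
  obtain d where d: "card H = card A * d" using card_subgroup_dvd[OF H(1) A] by blast
  obtain e where e: "card A = card P * e" using card_subgroup_dvd[OF A(1) P'(2,3)] by blast
  have "card A > 0" "card P > 0" using card_subgroup_pos A P'(2) fA fP by auto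
  hence "\<not> p dvd d" "\<not> p dvd e" "card H div card P = e * d" using c d e P'(5) by (auto simp: mult.assoc)
  hence "\<not> p dvd card H div card P" using P'(1) by (simp add: prime_dvd_mult_iff)
  thus ?thesis using P' A(2) by (auto simp: sylow_in_def)
qed


text \<open>For a prime \<open>q \<noteq> p\<close> the Frattini argument gives a Sylow \<open>q\<close>-subgroup \<open>R\<close> of \<open>H\<close> and \<open>P\<^sub>1 \<le> N\<^sub>P(R)\<close> with
  \<open>P = P\<^sub>1 (P \<inter> A)\<close>. As \<open>A \<le> P' K\<close>, this forces \<open>P \<le> P\<^sub>1 K\<close>, so \<open>R\<close> centralizes \<open>A\<close> modulo \<open>K\<close>. Hence
  \<open>A/K\<close> is central in \<open>H/K\<close>.\<close>

lemma p_complement_step_covered: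
  assumes fG: "finite (carrier G)" and P: "sylow_in p P (carrier G)"
    and K: "K \<lhd> G" and A: "A \<lhd> G" and H: "H \<lhd> G" and KA: "K \<subseteq> A" and AH: "A \<subseteq> H"
    and pH: "\<not> p dvd card H div card A" and GH: "card (carrier G) = p ^ e * card H"
    and cov: "A \<subseteq> derived G P <#> K"
    and com: "\<And>x y. x \<in> A \<Longrightarrow> y \<in> A \<Longrightarrow> x \<otimes> y \<otimes> inv x \<otimes> inv y \<in> K"
  shows "\<exists>L. L \<lhd> G \<and> K \<subseteq> L \<and> L \<subseteq> H \<and> \<not> p dvd card L div card K \<and> (\<exists>j. card H = p ^ j * card L)"
proof -
  note P' = sylow_inD[OF P]
  note p = P'(1)
  obtain k where cP: "card P = p ^ k" using P'(4) by blast
  have s: "subgroup K G" "subgroup A G" "subgroup H G" using K A H normal_imp_subgroup by auto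
  have sub: "K \<subseteq> carrier G" "A \<subseteq> carrier G" "H \<subseteq> carrier G" using s subgroup.subset by auto
  have fin: "finite K" "finite A" "finite H" "finite P" using finite_subset[OF _ fG] sub P'(3) by auto
  have PG: "x \<in> carrier G" if "x \<in> P" for x using that P'(3) by auto
  have KG: "x \<in> carrier G" if "x \<in> K" for x using that sub by auto
  have AG: "x \<in> carrier G" if "x \<in> A" for x using that sub by auto
  have HG: "x \<in> carrier G" if "x \<in> H" for x using that sub by auto
  have KA': "x \<in> A" if "x \<in> K" for x using that KA by auto
  define D where "D = derived G P"
  have DP: "D \<subseteq> P" unfolding D_def by (rule derived_incl[OF order_refl P'(2)])
  have dec: "\<exists>d\<in>D. \<exists>c\<in>K. a = d \<otimes> c \<and> d \<in> A" if a: "a \<in> A" for a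
  proof -
    obtain d c where dc: "d \<in> D" "c \<in> K" "a = d \<otimes> c" using subsetD[OF cov a] by (auto simp: D_def set_mult_mem_iff)
    have "d = a \<otimes> inv c" using dc DP PG KG by (simp add: m_assoc subset_iff)
    hence "d \<in> A" using a KA'[OF dc(2)] s(2) by (simp add: subgroup.m_closed subgroup.m_inv_closed)
    thus ?thesis using dc by blast
  qed
  have PA: "sylow_in p (P \<inter> A) A"
    by (rule sylow_in_normal_Int[OF subgroup_self fG P s(2) sub(2) normal_conjg[OF A]])
  have PAH: "sylow_in p (P \<inter> A) H" by (rule sylow_in_of_coprime_index[OF PA s(2) AH s(3) fin(3) pH])
  have "(P \<inter> A) <#> K = A"
  proof (intro equalityI subsetI)
    fix a assume "a \<in> A"
    thus "a \<in> (P \<inter> A) <#> K" using dec DP by (fastforce simp: set_mult_mem_iff)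
  qed (use subsetD[OF KA] subgroup.m_closed[OF s(2)] in \<open>auto simp: set_mult_mem_iff\<close>)
  hence "\<exists>j. card A div card K = p ^ j"
    using p_power_index_if_covered[OF sylow_inD(2)[OF PA] _ p K fin(1)] sylow_inD(4)[OF PA] by metis
  then obtain j where pB: "card A div card K = p ^ j" by blast
  have nK: "A \<subseteq> normalizes K" using normalizes_iff[OF fin(1) sub(1)] normal_conjg[OF K] AG by auto
  have PHA: "P \<inter> H = P \<inter> A"
  proof -
    have PH: "sylow_in p (P \<inter> H) H"
      by (rule sylow_in_normal_Int[OF subgroup_self fG P s(3) sub(3) normal_conjg[OF H]])
    have "card (P \<inter> A) = card (P \<inter> H)" by (rule card_sylow_in_eq[OF s(3) fin(3) PAH PH])
    moreover have "P \<inter> A \<subseteq> P \<inter> H" using AH by auto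
    ultimately show ?thesis using fin(4) by (metis card_subset_eq finite_Int)
  qed
  \<comment> \<open>\<open>Z\<close> is the centralizer of \<open>A/K\<close> in \<open>H\<close>.
    It is shown to be \<open>H\<close> one prime at a time; for \<open>q = p\<close> the Sylow
    subgroup \<open>P \<inter> A\<close> lies in it because \<open>A/K\<close> is abelian.\<close>
  define Z where "Z = {h \<in> H. \<forall>a\<in>A. conjg h a \<otimes> inv a \<in> K}"
  have "Z = H"
  proof (rule subgroup_eq_if_contains_sylows[OF s(3) fin(3)])
    show "subgroup Z G" unfolding Z_def by (rule subgroup_commuting_mod[OF K sub(2) s(3)])
    show "Z \<subseteq> H" by (auto simp: Z_def)
    fix q :: nat assume q: "prime q"
    show "\<exists>R. sylow_in q R H \<and> R \<subseteq> Z"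
    proof (cases "q = p")
      case True
      have "P \<inter> A \<subseteq> Z" using AH com by (auto simp: Z_def conjg_def)
      thus ?thesis using PAH True by blast
    next
      case False
      obtain R0 where R0: "sylow_in q R0 H" using sylow_in_exists[OF s(3) fin(3) q] by blast
      note R0' = sylow_inD[OF R0]
      have fR0: "finite R0" using R0'(3) fin(3) finite_subset by blast
      have R0G: "R0 \<subseteq> carrier G" using R0'(3) sub by auto
      define Y where "Y = normalizes R0"
      have Ys: "subgroup Y G" unfolding Y_def by (rule subgroup_normalizes[OF R0G])
      have YG: "Y \<subseteq> carrier G" by (rule subgroup.subset[OF Ys])
      have fY: "finite Y" by (rule finite_subset[OF YG fG])
      obtain P0 where P0: "sylow_in p P0 Y" using sylow_in_exists[OF Ys fY p] by blast
      note P0' = sylow_inD[OF P0]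
      obtain l where l: "card P0 = p ^ l" using P0'(4) by blast
      have P0G: "x \<in> carrier G" if "x \<in> P0" for x using that P0'(3) YG by auto
      have fP0: "finite P0" by (rule finite_subset[OF P0'(3) fY])
      obtain g where g: "g \<in> carrier G" "conjg g ` P0 \<subseteq> P"
        using p_subgroup_conj_into_sylow[OF subgroup_self fG P P0'(2) subset_trans[OF P0'(3) YG] l] by blast
      define C where "C = P0 <#> H"
      note Csub = subgroup_set_mult_normal[OF P0'(2) H, folded C_def]
      \<comment> \<open>The index of \<open>C\<close> is a power of \<open>p\<close> because
        \<open>C\<close> contains \<open>H\<close>. By the Frattini argument it is also the index of
        \<open>C \<inter> Y\<close> in \<open>Y\<close>, which is prime to \<open>p\<close> since
        the Sylow subgroup \<open>P0\<close> of \<open>Y\<close> lies in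
        \<open>C \<inter> Y\<close>.\<close>
      have CG: "C = carrier G"
      proof -
        let ?E = "(\<lambda>x. C #> x) ` carrier G"
        have "?E = (\<lambda>x. C #> x) ` Y"
        proof (intro equalityI subsetI)
          fix X assume "X \<in> ?E"
          then obtain n where n: "n \<in> carrier G" "X = C #> n" by auto
          obtain h where h: "h \<in> H" "conjg (h \<otimes> n) ` R0 = R0"
            using frattini_argument[OF s(3) fin(3) R0 n(1) normal_conjg[OF H n(1)]] by blast
          have hG: "h \<in> carrier G" using h HG by auto
          have "h \<otimes> n \<in> Y" using h n hG by (simp add: Y_def normalizes_def)
          moreover have "h \<otimes> n \<otimes> inv n \<in> C" using h Csub(2) hG n(1) by (auto simp: m_assoc)
          hence "C #> (h \<otimes> n) = C #> n" using rcos_eq_iff[OF Csub(1)] hG n(1) by simp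
          ultimately show "X \<in> (\<lambda>x. C #> x) ` Y" using n(2) by (metis image_eqI)
        qed (use YG in auto)
        hence eY: "card ?E * card (C \<inter> Y) = card Y" using card_cosets_Int[OF Csub(1) Ys fY] by simp
        have eG: "card (carrier G) = card ?E * card C"
          by (rule card_subgroup_cosets[OF subgroup_self Csub(1) subgroup.subset[OF Csub(1)]])
        obtain c where c: "card C = card H * c" using card_subgroup_dvd[OF Csub(1) s(3) Csub(2)] by blast
        have "card H > 0" by (rule card_subgroup_pos[OF s(3) fin(3)])
        hence "card ?E * c = p ^ e" using eG c GH by (simp add: ac_simps)
        hence "card ?E dvd p ^ e" by (metis dvd_triv_left)
        then obtain i where i: "card ?E = p ^ i" using p by (metis divides_primepow_nat)
        have CYs: "subgroup (C \<inter> Y) G" by (rule subgroups_Inter_pair[OF Csub(1) Ys])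
        have "P0 \<subseteq> C \<inter> Y" using Csub(3) P0'(3) by auto
        hence "card P0 dvd card (C \<inter> Y)" by (rule card_subgroup_dvd[OF CYs P0'(2)])
        then obtain t where t: "card (C \<inter> Y) = card P0 * t" by blast
        have "card Y = card P0 * (card ?E * t)" using eY t by (simp add: ac_simps)
        moreover have "card P0 > 0" by (rule card_subgroup_pos[OF P0'(2) fP0])
        ultimately have "card Y div card P0 = card ?E * t" by simp
        hence "i = 0" using P0'(5) i by (cases i) auto
        hence "card C = card (carrier G)" using eG i by simp
        thus ?thesis using subgroup.subset[OF Csub(1)] fG by (simp add: card_subset_eq)
      qed
      define R where "R = conjg g ` R0"
      define P1 where "P1 = conjg g ` P0"
      have RH: "sylow_in q R H"
        unfolding R_def by (rule conjg_sylow_in[OF R0 fR0 g(1)]) (use normal_conjg[OF H g(1)] R0'(3) in auto)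
      note R' = sylow_inD[OF RH]
      have RG: "x \<in> carrier G" if "x \<in> R" for x using that R'(3) HG by auto
      have P1s: "subgroup P1 G" unfolding P1_def by (rule subgroup_conjg[OF g(1) P0'(2)])
      have P1P: "P1 \<subseteq> P" using g(2) by (simp add: P1_def)
      have P1R: "conjg y r \<in> R" if yr: "y \<in> P1" "r \<in> R" for y r
      proof -
        obtain y0 r0 where 0: "y0 \<in> P0" "y = conjg g y0" "r0 \<in> R0" "r = conjg g r0"
          using yr by (auto simp: P1_def R_def)
        have "conjg y0 r0 \<in> R0" using 0 P0'(3) by (auto simp: Y_def normalizes_def)
        moreover have "conjg y r = conjg g (conjg y0 r0)"
          using 0 g(1) P0G R0G by (auto simp: conjg_def m_assoc inv_mult_group subset_iff)
        ultimately show ?thesis by (simp add: R_def)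
      qed
      have PP1: "\<exists>y\<in>P1. \<exists>h\<in>P \<inter> A. x = y \<otimes> h" if x: "x \<in> P" for x
      proof -
        have xG: "x \<in> carrier G" using x PG by auto
        have "conjg (inv g) x \<in> C" using CG g xG by simp
        then obtain y0 h0 where 0: "y0 \<in> P0" "h0 \<in> H" "conjg (inv g) x = y0 \<otimes> h0"
          by (auto simp: C_def set_mult_mem_iff)
        have "x = conjg g (conjg (inv g) x)" using g(1) xG by simp
        also have "\<dots> = conjg g y0 \<otimes> conjg g h0" using 0 g(1) P0G HG by (simp add: conjg_mult)
        finally have eq: "x = conjg g y0 \<otimes> conjg g h0" .
        have y: "conjg g y0 \<in> P1" using 0 by (simp add: P1_def)
        have h: "conjg g h0 \<in> H" by (rule normal_conjg[OF H g(1) 0(2)])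
        have "conjg g h0 = inv (conjg g y0) \<otimes> x" using eq 0 g(1) P0G HG by simp
        hence "conjg g h0 \<in> P" using y P1P x P'(2) by (auto simp: subgroup.m_closed subgroup.m_inv_closed)
        hence "conjg g h0 \<in> P \<inter> A" using h PHA by auto
        thus ?thesis using y eq by blast
      qed
      define U where "U = P \<inter> (P1 <#> K)"
      note PK = subgroup_set_mult_normal[OF P1s K]
      have Us: "subgroup U G" unfolding U_def by (rule subgroups_Inter_pair[OF P'(2) PK(1)])
      \<comment> \<open>A proper \<open>U\<close> would lie together with \<open>D\<close> in a
        proper subgroup \<open>W\<close> of \<open>P\<close>. But \<open>P\<close> is the product of
        \<open>P1\<close> and \<open>P \<inter> A\<close>, and elements of \<open>A\<close> are
        products from \<open>D\<close> and \<open>K\<close>, so \<open>W\<close> would be all of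
        \<open>P\<close>.\<close>
      have "U = P"
      proof (rule ccontr)
        assume "U \<noteq> P"
        hence "U \<subset> P" by (auto simp: U_def)
        then obtain W where W: "subgroup W G" "U \<subseteq> W" "W \<subset> P" "\<forall>x\<in>P. \<forall>y\<in>P. x \<otimes> y \<otimes> inv x \<otimes> inv y \<in> W"
          using proper_subgroup_of_p_group[OF P'(2) cP p Us] by blast
        have DW: "D \<subseteq> W" unfolding D_def by (rule derived_subset_iff[OF W(1)]) (use W(4) in blast)
        have "x \<in> W" if x: "x \<in> P" for x
        proof -
          obtain y h where yh: "y \<in> P1" "h \<in> P \<inter> A" "x = y \<otimes> h" using PP1[OF x] by blast
          obtain d c where dc: "d \<in> D" "c \<in> K" "h = d \<otimes> c" using dec[of h] yh(2) by blast
          have "c = inv d \<otimes> h" using dc DP PG KG by (auto simp: subset_iff)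
          hence "c \<in> P" using dc(1) DP yh(2) P'(2) by (auto simp: subgroup.m_closed subgroup.m_inv_closed)
          moreover have "c \<in> P1 <#> K" using PK(2) dc(2) by auto
          ultimately have "c \<in> W" using W(2) by (auto simp: U_def)
          moreover have "y \<in> W" using yh(1) PK(3) P1P W(2) by (auto simp: U_def)
          moreover have "d \<in> W" using dc(1) DW by auto
          ultimately show ?thesis using yh(3) dc(3) W(1) by (simp add: subgroup.m_closed)
        qed
        thus False using W(3) by auto
      qed
      \<comment> \<open>Modulo \<open>K\<close> the element \<open>a\<close> is some
        \<open>y\<close> of \<open>P1\<close> that lies in \<open>A\<close>. The commutator
        \<open>t\<close> of \<open>y\<close> and \<open>r\<close> lies in the \<open>q\<close>-group
        \<open>R\<close> and in \<open>A\<close>, which is a \<open>p\<close>-group modulo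
        \<open>K\<close>; so \<open>t\<close> is in \<open>K\<close>.\<close>
      have "conjg r a \<otimes> inv a \<in> K" if r: "r \<in> R" and a: "a \<in> A" for r a
      proof -
        obtain d c where dc: "d \<in> D" "c \<in> K" "a = d \<otimes> c" using dec[OF a] by blast
        have "d \<in> U" using dc(1) DP \<open>U = P\<close> by auto
        then obtain y c' where yc: "y \<in> P1" "c' \<in> K" "d = y \<otimes> c'" by (auto simp: U_def set_mult_mem_iff)
        define b where "b = c' \<otimes> c"
        have b: "b \<in> K" using yc dc s(1) by (simp add: b_def subgroup.m_closed)
        have G: "y \<in> carrier G" "b \<in> carrier G" "r \<in> carrier G" "a \<in> carrier G"
          using yc(1) P1P PG b KG RG[OF r] AG[OF a] by auto
        have ayb: "a = y \<otimes> b" using dc yc KG G by (simp add: b_def m_assoc)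
        hence "y = a \<otimes> inv b" using G by (simp add: m_assoc)
        hence yA: "y \<in> A" using a KA'[OF b] s(2) by (simp add: subgroup.m_closed subgroup.m_inv_closed)
        define t where "t = conjg y r \<otimes> inv r"
        have tR: "t \<in> R"
          unfolding t_def by (intro subgroup.m_closed[OF R'(2)] P1R yc r subgroup.m_inv_closed[OF R'(2)])
        have "t = y \<otimes> conjg r (inv y)" using G by (simp add: t_def conjg_def m_assoc)
        hence tA: "t \<in> A"
          using yA normal_conjg[OF A G(3)] s(2) by (simp add: subgroup.m_closed subgroup.m_inv_closed)
        have tK: "t \<in> K"
        proof (rule mem_if_coprime_powers_mem[OF s(1) AG[OF tA]])
          show "t [^] (card A div card K) \<in> K" by (rule pow_index_mem[OF s(2) fin(2) s(1) KA nK tA])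
          have "t [^] (card R div card {\<one>}) \<in> {\<one>}"
            by (rule pow_index_mem[OF R'(2) _ triv_subgroup _ _ tR])
              (use R' fin RG subgroup.one_closed finite_subset in \<open>auto simp: normalizes_def\<close>)
          thus "t [^] card R \<in> K" using subgroup.one_closed[OF s(1)] by simp
          obtain l where "card R = q ^ l" using R'(4) by blast
          thus "coprime (card A div card K) (card R)"
            using pB p q False by (simp add: primes_coprime)
        qed
        have "conjg r a \<otimes> inv a = inv t \<otimes> conjg y (conjg r b \<otimes> inv b)"
          using G by (simp add: ayb t_def conjg_def m_assoc inv_mult_group)
        moreover have "conjg y (conjg r b \<otimes> inv b) \<in> K"
          by (intro normal_conjg[OF K G(1)] subgroup.m_closed[OF s(1)] normal_conjg[OF K G(3) b] subgroup.m_inv_closed[OF s(1) b])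
        ultimately show ?thesis using tK s(1) by (simp add: subgroup.m_closed subgroup.m_inv_closed)
      qed
      hence "R \<subseteq> Z" using R'(3) by (auto simp: Z_def)
      thus ?thesis using RH by blast
    qed
  qed
  hence "conjg g b \<otimes> inv b \<in> K" if "b \<in> A" "g \<in> H" for b g using that by (auto simp: Z_def)
  thus ?thesis using extend_p_complement[OF fG p K H s(2) KA AH pH pB com] by blast
qed

text \<open>Here \<open>P\<close> centralizes \<open>P \<inter> A\<close> modulo \<open>K\<close>, so by Sylow's theorem in the centralizer of \<open>v K\<close> the elements of
  \<open>P \<inter> A\<close> that are fused modulo \<open>K\<close> are already fused by \<open>N(P)\<close>, which acts trivially.\<close>

lemma p_complement_step_avoided:
  assumes fG: "finite (carrier G)" and P: "sylow_in p P (carrier G)"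
    and K: "K \<lhd> G" and A: "A \<lhd> G" and H: "H \<lhd> G" and KA: "K \<subseteq> A" and AH: "A \<subseteq> H"
    and pH: "\<not> p dvd card H div card A"
    and avoid: "derived G P \<inter> A \<subseteq> K"
    and cent: "\<And>q R r x. \<lbrakk>prime q; q \<noteq> p; sylow_in q R (normalizes P); r \<in> R; x \<in> P\<rbrakk> \<Longrightarrow> conjg r x = x"
  shows "\<exists>L. L \<lhd> G \<and> K \<subseteq> L \<and> L \<subseteq> H \<and> \<not> p dvd card L div card K \<and> (\<exists>j. card H = p ^ j * card L)"
proof -
  note P' = sylow_inD[OF P]
  note p = P'(1)
  obtain k where cP: "card P = p ^ k" using P'(4) by blast
  have s: "subgroup K G" "subgroup A G" "subgroup H G" using K A H normal_imp_subgroup by auto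
  have sub: "K \<subseteq> carrier G" "A \<subseteq> carrier G" "H \<subseteq> carrier G" using s subgroup.subset by auto
  have fin: "finite K" "finite A" "finite H" "finite P" using finite_subset[OF _ fG] sub P'(3) by auto
  have PG: "x \<in> carrier G" if "x \<in> P" for x using that P'(3) by auto
  have KG: "x \<in> carrier G" if "x \<in> K" for x using that sub by auto
  have AG: "x \<in> carrier G" if "x \<in> A" for x using that sub by auto
  interpret K: normal K G by (rule K)
  interpret \<pi>: group_hom G "G Mod K" "\<lambda>x. K #> x" by (rule group_hom_Mod[OF K])
  let ?\<pi> = "\<lambda>x. K #> x"
  have PA: "sylow_in p (P \<inter> A) A"
    by (rule sylow_in_normal_Int[OF subgroup_self fG P s(2) sub(2) normal_conjg[OF A]])
  note PA' = sylow_inD[OF PA]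
  \<comment> \<open>\<open>B\<close> is a Sylow \<open>p\<close>-subgroup of \<open>H\<close> modulo
    \<open>K\<close>. Its cosets of \<open>K\<close> are represented by elements of
    \<open>P \<inter> A\<close>, on which commutators and fusion are checked.\<close>
  define B where "B = (P \<inter> A) <#> K"
  note Bs = subgroup_set_mult_normal[OF PA'(2) K, folded B_def]
  have BA: "B \<subseteq> A" using subsetD[OF KA] subgroup.m_closed[OF s(2)] by (auto simp: B_def set_mult_mem_iff)
  have fB: "finite B" by (rule finite_subset[OF BA fin(2)])
  have BG: "x \<in> carrier G" if "x \<in> B" for x using that BA AG by auto
  have PAcent: "conjg x v \<otimes> inv v \<in> K" if "x \<in> P" "v \<in> P \<inter> A" for x v
  proof -
    have "conjg x v \<otimes> inv v \<in> derived G P" using commutator_mem_derived[of x P v] that by (simp add: conjg_def)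
    moreover have "conjg x v \<otimes> inv v \<in> A"
      using normal_conjg[OF A PG[OF that(1)]] that(2) s(2) by (simp add: subgroup.m_closed subgroup.m_inv_closed)
    ultimately show ?thesis using avoid by auto
  qed
  have "\<exists>j. card B div card K = p ^ j"
    using p_power_index_if_covered[OF PA'(2) _ p K fin(1)] PA'(4) unfolding B_def by metis
  then obtain j where pB: "card B div card K = p ^ j" by blast
  have pHB: "\<not> p dvd card H div card B"
  proof -
    have "card A div card B dvd card A div card (P \<inter> A)"
    proof -
      obtain u where u: "card B = card (P \<inter> A) * u" using card_subgroup_dvd[OF Bs(1) PA'(2) Bs(3)] by blast
      obtain v where v: "card A = card B * v" using card_subgroup_dvd[OF s(2) Bs(1) BA] by blast
      have "card B > 0" "card (P \<inter> A) > 0" using card_subgroup_pos Bs(1) PA'(2) fB fin by auto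
      thus ?thesis using u v by (simp add: mult.assoc)
    qed
    hence "\<not> p dvd card A div card B" using PA'(5) dvd_trans by blast
    moreover obtain u where u: "card A = card B * u" using card_subgroup_dvd[OF s(2) Bs(1) BA] by blast
    moreover obtain v where v: "card H = card A * v" using card_subgroup_dvd[OF s(3,2) AH] by blast
    moreover have "card B > 0" "card A > 0" using card_subgroup_pos Bs(1) s(2) fB fin by auto
    ultimately show ?thesis using pH p by (simp add: mult.assoc prime_dvd_mult_iff)
  qed
  have \<pi>B: "\<exists>u\<in>P \<inter> A. ?\<pi> b = ?\<pi> u" if "b \<in> B" for b
  proof -
    from that obtain c u where cu: "c \<in> K" "u \<in> P \<inter> A" "b = c \<otimes> u" by (auto simp: Bs(4) set_mult_mem_iff)
    hence "?\<pi> b = ?\<pi> u" using rcos_eq_iff[OF s(1), of b u] KG PG by (simp add: m_assoc)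
    thus ?thesis using cu(2) by blast
  qed
  have \<pi>eq: "?\<pi> x = ?\<pi> y \<longleftrightarrow> x \<otimes> inv y \<in> K" if "x \<in> carrier G" "y \<in> carrier G" for x y
    by (rule rcos_eq_iff[OF s(1) that])
  have \<pi>m: "?\<pi> (x \<otimes> y) = ?\<pi> x <#> ?\<pi> y" if "x \<in> carrier G" "y \<in> carrier G" for x y
    using K.rcos_sum[OF that] by simp
  have com: "x \<otimes> y \<otimes> inv x \<otimes> inv y \<in> K" if xy: "x \<in> B" "y \<in> B" for x y
  proof -
    obtain u v where uv: "u \<in> P \<inter> A" "?\<pi> x = ?\<pi> u" "v \<in> P \<inter> A" "?\<pi> y = ?\<pi> v" using \<pi>B xy by meson
    have G: "x \<in> carrier G" "y \<in> carrier G" "u \<in> carrier G" "v \<in> carrier G" using xy BG uv PG by auto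
    have "?\<pi> (u \<otimes> v) = ?\<pi> (v \<otimes> u)"
    proof (rule iffD2[OF \<pi>eq])
      show "u \<otimes> v \<otimes> inv (v \<otimes> u) \<in> K"
        using PAcent[of u v] uv G by (simp add: conjg_def m_assoc inv_mult_group)
    qed (use G in auto)
    hence "?\<pi> (x \<otimes> y) = ?\<pi> (y \<otimes> x)" using uv \<pi>m G by metis
    hence "x \<otimes> y \<otimes> inv (y \<otimes> x) \<in> K" by (rule iffD1[OF \<pi>eq, rotated 2]) (use G in auto)
    thus ?thesis using G by (simp add: m_assoc inv_mult_group)
  qed
  have PNz: "subgroup (normalizes P) G" by (rule subgroup_normalizes[OF P'(3)])
  have fNz: "finite (normalizes P)" by (rule finite_subset[OF subgroup.subset[OF PNz] fG])
  define Z where "Z = {y \<in> normalizes P. \<forall>u\<in>P \<inter> A. conjg y u \<otimes> inv u \<in> K}"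
  \<comment> \<open>The normalizer of \<open>P\<close> acts trivially on \<open>P \<inter> A\<close>
    modulo \<open>K\<close>: for the prime \<open>p\<close> because \<open>derived G P\<close>
    avoids the factor, for the other primes by \<open>cent\<close>.\<close>
  have ZN: "Z = normalizes P"
  proof (rule subgroup_eq_if_contains_sylows[OF PNz fNz])
    show "subgroup Z G" unfolding Z_def by (rule subgroup_commuting_mod[OF K _ PNz]) (use PG in auto)
    show "Z \<subseteq> normalizes P" by (auto simp: Z_def)
    fix q :: nat assume q: "prime q"
    show "\<exists>R. sylow_in q R (normalizes P) \<and> R \<subseteq> Z"
    proof (cases "q = p")
      case True
      have Pn: "P \<subseteq> normalizes P" by (rule subgroup_subset_normalizes[OF P'(2) fin(4)])
      have "sylow_in p P (normalizes P)"
        by (rule sylow_in_larger[OF P'(2) Pn cP PNz subgroup.subset[OF PNz] subgroup_self fG P'(5) p])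
      moreover have "P \<subseteq> Z" using Pn PAcent by (auto simp: Z_def)
      ultimately show ?thesis using True by blast
    next
      case False
      obtain R where R: "sylow_in q R (normalizes P)" using sylow_in_exists[OF PNz fNz q] by blast
      have "conjg r u \<otimes> inv u \<in> K" if "r \<in> R" "u \<in> P \<inter> A" for r u
        using cent[OF q False R that(1), of u] that(2) PG subgroup.one_closed[OF s(1)] by simp
      hence "R \<subseteq> Z" using sylow_inD(3)[OF R] by (auto simp: Z_def)
      thus ?thesis using R by blast
    qed
  qed
  have fus: "conjg g b \<otimes> inv b \<in> K" if b: "b \<in> B" and g: "g \<in> H" and gb: "conjg g b \<in> B" for b g
  proof -
    obtain u v where uv: "u \<in> P \<inter> A" "?\<pi> b = ?\<pi> u" "v \<in> P \<inter> A" "?\<pi> (conjg g b) = ?\<pi> v"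
      using \<pi>B[OF b] \<pi>B[OF gb] by blast
    have G: "g \<in> carrier G" "b \<in> carrier G" "u \<in> carrier G" "v \<in> carrier G"
      using g sub(3) b BG uv PG by auto
    have cong: "?\<pi> (conjg x y) = ?\<pi> (conjg x y')"
      if "x \<in> carrier G" "y \<in> carrier G" "y' \<in> carrier G" "?\<pi> y = ?\<pi> y'" for x y y'
      using that \<pi>m by (simp add: conjg_def)
    have gu: "?\<pi> (conjg g u) = ?\<pi> v" using cong[of g b u] G uv by simp
    define C where "C = {x \<in> carrier G. \<forall>a\<in>{v}. conjg x a \<otimes> inv a \<in> K}"
    have Cs: "subgroup C G" unfolding C_def by (rule subgroup_commuting_mod[OF K _ subgroup_self]) (use G in auto)
    have CG: "C \<subseteq> carrier G" by (rule subgroup.subset[OF Cs])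
    have C\<pi>: "x \<in> C \<longleftrightarrow> ?\<pi> (conjg x v) = ?\<pi> v" if "x \<in> carrier G" for x
      using \<pi>eq[of "conjg x v" v] that G by (simp add: C_def)
    have PC: "P \<subseteq> C" using PAcent uv(3) PG by (auto simp: C_def)
    \<comment> \<open>\<open>P\<close> centralizes \<open>u\<close> modulo \<open>K\<close>, so its
      conjugate by \<open>g\<close> centralizes the conjugate of \<open>u\<close>, which is
      \<open>v\<close> modulo \<open>K\<close>.\<close>
    have gPC: "conjg g ` P \<subseteq> C"
    proof
      fix x assume "x \<in> conjg g ` P"
      then obtain y where y: "y \<in> P" "x = conjg g y" by auto
      have yG: "y \<in> carrier G" using y PG by auto
      have "?\<pi> (conjg x v) = ?\<pi> (conjg x (conjg g u))" by (rule cong) (use y yG G gu in auto)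
      also have "conjg x (conjg g u) = conjg g (conjg y u)"
        using y yG G by (simp add: conjg_def m_assoc inv_mult_group)
      also have "?\<pi> (conjg g (conjg y u)) = ?\<pi> (conjg g u)"
        by (rule cong) (use G yG y uv(1) PAcent \<pi>eq[of "conjg y u" u] in auto)
      finally show "x \<in> C" using C\<pi> gu y yG G by simp
    qed
    have gPs: "subgroup (conjg g ` P) G" by (rule subgroup_conjg[OF G(1) P'(2)])
    have cgP: "card (conjg g ` P) = card P" by (rule card_conjg[OF G(1) P'(3)])
    have S1: "sylow_in p P C"
      by (rule sylow_in_larger[OF P'(2) PC cP Cs CG subgroup_self fG P'(5) p])
    have S2: "sylow_in p (conjg g ` P) C"
      by (rule sylow_in_larger[OF gPs gPC _ Cs CG subgroup_self fG _ p]) (use cgP cP P'(5) in auto)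
    obtain c where c: "c \<in> C" "conjg c ` conjg g ` P = P"
      using sylow_in_conj[OF Cs finite_subset[OF CG fG] S1 S2] by blast
    have cG: "c \<in> carrier G" using c CG by auto
    have "conjg (c \<otimes> g) ` P = P" using c(2) conjg_image_conjg[OF cG G(1) P'(3)] by simp
    hence "c \<otimes> g \<in> Z" using ZN cG G by (simp add: normalizes_def)
    hence "conjg (c \<otimes> g) u \<otimes> inv u \<in> K" using uv(1) by (auto simp: Z_def)
    hence "?\<pi> u = ?\<pi> (conjg (c \<otimes> g) u)" using \<pi>eq[of "conjg (c \<otimes> g) u" u] cG G by simp
    also have "\<dots> = ?\<pi> (conjg c v)" using cong[of c "conjg g u" v] gu cG G by (simp add: conjg_conjg)
    also have "\<dots> = ?\<pi> v" using C\<pi>[OF cG] c(1) by simp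
    finally have "?\<pi> (conjg g b) = ?\<pi> b" using uv by simp
    thus ?thesis using \<pi>eq[of "conjg g b" b] G by simp
  qed
  show ?thesis
    by (rule extend_p_complement[OF fG p K H Bs(1,2) _ pHB pB com fus]) (use BA AH in auto)
qed

text \<open>Descent from \<open>n\<close> to \<open>0\<close>: at stage \<open>i\<close> there is a
  normal \<open>H\<close> over \<open>K i\<close> whose index in \<open>G\<close> is a power of
  \<open>p\<close>, while the index of \<open>K i\<close> in \<open>H\<close> is prime to
  \<open>p\<close>. It starts with \<open>G\<close> and ends with a \<open>p\<close>-complement.
  \<open>K\<close> is merely a normal series, as it will be a chief series of a larger group
  intersected with a normal subgroup; commutativity of covered factors is therefore a
  hypothesis.\<close>

lemma normal_p_complement_exists:
  assumes fG: "finite (carrier G)" and P: "sylow_in p P (carrier G)"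
    and K0: "K 0 = {\<one>}" and Kn: "K n = carrier G"
    and KN: "\<And>i. i \<le> n \<Longrightarrow> K i \<lhd> G" and KK: "\<And>i. i < n \<Longrightarrow> K i \<subseteq> K (Suc i)"
    and alt: "\<And>i. i < n \<Longrightarrow> derived G P \<inter> K (Suc i) \<subseteq> K i \<or>
        K (Suc i) \<subseteq> derived G P <#> K i \<and> (\<forall>x\<in>K (Suc i). \<forall>y\<in>K (Suc i). x \<otimes> y \<otimes> inv x \<otimes> inv y \<in> K i)"
    and cent: "\<And>q R r x. \<lbrakk>prime q; q \<noteq> p; sylow_in q R (normalizes P); r \<in> R; x \<in> P\<rbrakk> \<Longrightarrow> conjg r x = x"
  shows "\<exists>L. L \<lhd> G \<and> \<not> p dvd card L \<and> (\<exists>j. card (carrier G) = p ^ j * card L)"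
proof -
  have p: "prime p" using P by (simp add: sylow_in_def)
  have "\<exists>H. H \<lhd> G \<and> K i \<subseteq> H \<and> \<not> p dvd card H div card (K i) \<and> (\<exists>j. card (carrier G) = p ^ j * card H)"
    if "i \<le> n" for i
    using that
  proof (induction rule: inc_induct)
    case base
    have "card (carrier G) > 0" by (rule card_subgroup_pos[OF subgroup_self fG])
    hence "\<not> p dvd card (carrier G) div card (K n)" using Kn p by (simp add: prime_nat_iff)
    moreover have "card (carrier G) = p ^ 0 * card (carrier G)" by simp
    ultimately show ?case using Kn normal_self by blast
  next
    case (step i)
    then obtain H e where H: "H \<lhd> G" "K (Suc i) \<subseteq> H" "\<not> p dvd card H div card (K (Suc i))"
      "card (carrier G) = p ^ e * card H" by blast
    have i: "i < n" using step by simp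
    have N: "K i \<lhd> G" "K (Suc i) \<lhd> G" using KN i by auto
    have "\<exists>L. L \<lhd> G \<and> K i \<subseteq> L \<and> L \<subseteq> H \<and> \<not> p dvd card L div card (K i) \<and> (\<exists>j. card H = p ^ j * card L)"
      using alt[OF i]
    proof
      assume "derived G P \<inter> K (Suc i) \<subseteq> K i"
      thus ?thesis by (rule p_complement_step_avoided[OF fG P N H(1) KK[OF i] H(2,3) _ cent])
    next
      assume "K (Suc i) \<subseteq> derived G P <#> K i \<and> (\<forall>x\<in>K (Suc i). \<forall>y\<in>K (Suc i). x \<otimes> y \<otimes> inv x \<otimes> inv y \<in> K i)"
      thus ?thesis using p_complement_step_covered[OF fG P N H(1) KK[OF i] H(2,3,4)] by blast
    qed
    then obtain L j where L: "L \<lhd> G" "K i \<subseteq> L" "\<not> p dvd card L div card (K i)" "card H = p ^ j * card L" by blast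
    have "card (carrier G) = p ^ (e + j) * card L" using H(4) L(4) by (simp add: power_add)
    thus ?case using L by blast
  qed
  from this[of 0] show ?thesis using K0 by auto
qed


section \<open>Taking a subgroup as the ambient group\<close>

lemma group_restrict: "subgroup H G \<Longrightarrow> group (G\<lparr>carrier := H\<rparr>)"
  by (rule subgroup.subgroup_is_group[OF _ group_axioms])

lemma conjg_restrict:
  assumes H: "subgroup H G" and g: "g \<in> H"
  shows "group.conjg (G\<lparr>carrier := H\<rparr>) g x = conjg g x"
  using g m_inv_consistent[OF H] by (simp add: conjg_def group.conjg_def[OF group_restrict[OF H]])

lemma normal_restrict_iff:
  assumes H: "subgroup H G"
  shows "B \<lhd> G\<lparr>carrier := H\<rparr> \<longleftrightarrow> subgroup B G \<and> B \<subseteq> H \<and> (\<forall>g\<in>H. \<forall>b\<in>B. conjg g b \<in> B)"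
proof -
  interpret H: group "G\<lparr>carrier := H\<rparr>" by (rule group_restrict[OF H])
  have "subgroup B (G\<lparr>carrier := H\<rparr>) \<longleftrightarrow> subgroup B G \<and> B \<subseteq> H"
    using incl_subgroup[OF H] subgroup_incl[OF _ H] subgroup.subset[of B "G\<lparr>carrier := H\<rparr>"] by auto
  moreover have "H.conjg g b = conjg g b" if "g \<in> H" for g b by (rule conjg_restrict[OF H that])
  moreover have "B \<lhd> G\<lparr>carrier := H\<rparr> \<longleftrightarrow> subgroup B (G\<lparr>carrier := H\<rparr>) \<and> (\<forall>g\<in>H. \<forall>b\<in>B. H.conjg g b \<in> B)"
    by (simp add: H.normal_inv_iff H.conjg_def)
  ultimately show ?thesis by simp
qed

lemma sylow_in_restrict:
  assumes H: "subgroup H G"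
  shows "group.sylow_in (G\<lparr>carrier := H\<rparr>) p P N \<longleftrightarrow> sylow_in p P N \<and> P \<subseteq> H"
proof -
  interpret H: group "G\<lparr>carrier := H\<rparr>" by (rule group_restrict[OF H])
  have "subgroup P (G\<lparr>carrier := H\<rparr>) \<longleftrightarrow> subgroup P G \<and> P \<subseteq> H"
    using incl_subgroup[OF H] subgroup_incl[OF _ H] subgroup.subset[of P "G\<lparr>carrier := H\<rparr>"] by auto
  thus ?thesis by (auto simp: sylow_in_def H.sylow_in_def)
qed

lemma normalizes_restrict:
  assumes H: "subgroup H G"
  shows "group.normalizes (G\<lparr>carrier := H\<rparr>) X = normalizes X \<inter> H"
proof -
  interpret H: group "G\<lparr>carrier := H\<rparr>" by (rule group_restrict[OF H])
  have "H.conjg g ` X = conjg g ` X" if "g \<in> H" for g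
    by (rule image_cong[OF refl conjg_restrict[OF H that]])
  hence "{g \<in> H. H.conjg g ` X = X} = {g \<in> H. conjg g ` X = X}" by (intro Collect_cong conj_cong) simp_all
  thus ?thesis using subgroup.mem_carrier[OF H] unfolding normalizes_def H.normalizes_def by auto
qed

text \<open>On a factor of order \<open>p\<close> the number of cosets fixed by \<open>R\<close> is
  congruent to \<open>p\<close> modulo \<open>q\<close> and at most \<open>p < q\<close>, so all are
  fixed. Each coset has \<open>p\<close>-power size, prime to \<open>q\<close>, hence contains a
  fixed element \<open>b \<otimes> x\<close>; \<open>b\<close> is fixed by induction, and so
  \<open>x\<close> is.\<close>

lemma larger_prime_group_centralizes_hypercyclic:
  assumes R: "subgroup R G" "card R = q ^ l" and q: "prime q" "p < q" and p: "prime p"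
    and fP: "finite P" and cP: "card P = p ^ k" and ch: "prime_step\<^sup>*\<^sup>* {\<one>} P"
    and r: "r \<in> R" and x: "x \<in> P"
  shows "conjg r x = x"
proof -
  note RG = subgroup.mem_carrier[OF R(1)]
  have "\<forall>w\<in>R. \<forall>x\<in>C. conjg w x = x" if "prime_step\<^sup>*\<^sup>* {\<one>} C" "card C dvd p ^ k" "finite C" for C
    using that
  proof (induction rule: rtranclp_induct)
    case base
    show ?case using RG by simp
  next
    case (step B C)
    obtain t where t: "B \<lhd> G" "C \<lhd> G" "B \<subseteq> C" "prime t" "card C = t * card B"
      using step(2) by (auto simp: prime_step_def)
    have s: "subgroup B G" "subgroup C G" using t normal_imp_subgroup by auto
    have fB: "finite B" using t(3) step(5) finite_subset by blast
    have "t dvd p ^ k" using t(5) step(4) by (metis dvd_mult_left)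
    hence "t = p" using t(4) p by (metis prime_dvd_power primes_dvd_imp_eq)
    have dB: "card B dvd p ^ k" using t(5) step(4) by (metis dvd_mult_right)
    have IH: "conjg w b = b" if "w \<in> R" "b \<in> B" for w b using step.IH[OF dB fB] that by blast
    note BG = subgroup.mem_carrier[OF s(1)]
    note CG = subgroup.mem_carrier[OF s(2)]
    have cB: "card B > 0" by (rule card_subgroup_pos[OF s(1) fB])
    let ?E = "(\<lambda>a. B #> a) ` C"
    let ?F = "{X \<in> ?E. \<forall>w\<in>R. conjg w ` X = X}"
    have cE: "card ?E = p"
      using card_subgroup_cosets[OF s(2,1) t(3)] t(5) cB \<open>t = p\<close> by simp
    have "card ?F mod q = (card C div card B) mod q"
      by (rule card_fixed_cosets_mod[OF R(1) q(1) R(2) s(2,1) t(3) step(5)])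
        (use normal_conjg[OF t(1)] normal_conjg[OF t(2)] RG in auto)
    hence "card ?F mod q = p mod q" using t(5) cB \<open>t = p\<close> by simp
    moreover have "card ?F \<le> p" using card_mono[of ?E ?F] step(5) cE by auto
    ultimately have "card ?F = card ?E" using q(2) cE by simp
    hence FE: "?F = ?E" using step(5) by (intro card_subset_eq) auto
    show ?case
    proof (intro ballI)
      fix w x assume w: "w \<in> R" and x: "x \<in> C"
      let ?X = "B #> x"
      have XG: "?X \<subseteq> carrier G" using BG CG[OF x] by (auto simp: r_coset_def)
      have Xf: "finite ?X" using fB by (simp add: r_coset_def)
      have "?X \<in> ?F" unfolding FE using x by (rule imageI)
      hence inv: "conjg v ` ?X = ?X" if "v \<in> R" for v using that by simp
      have "card {y \<in> ?X. \<forall>v\<in>R. conjg v y = y} mod q = card ?X mod q"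
      proof (rule card_fixed_points_mod[OF R(1) q(1) R(2) Xf])
        show "conjg v y \<in> ?X" if "v \<in> R" "y \<in> ?X" for v y
          using imageI[OF that(2), of "conjg v"] unfolding inv[OF that(1)] .
        show "conjg \<one> y = y" if "y \<in> ?X" for y using subsetD[OF XG that] by simp
        show "conjg (v \<otimes> v') y = conjg v (conjg v' y)" if "v \<in> R" "v' \<in> R" "y \<in> ?X" for v v' y
          using subsetD[OF XG that(3)] RG that(1,2) by (simp add: conjg_conjg)
      qed
      moreover have "card ?X = card B"
        using card_cosets_equal[OF rcosetsI[OF subgroup.subset[OF s(1)] CG[OF x]] subgroup.subset[OF s(1)]]
        by (auto dest: bij_betw_same_card)
      moreover have "\<not> q dvd card B"
      proof
        assume "q dvd card B"
        hence "q dvd p ^ k" using dB dvd_trans by blast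
        hence "q = p" using q(1) p by (metis prime_dvd_power primes_dvd_imp_eq)
        thus False using q(2) by simp
      qed
      ultimately have "card {y \<in> ?X. \<forall>v\<in>R. conjg v y = y} \<noteq> 0" by (metis dvd_eq_mod_eq_0 mod_0)
      hence "{y \<in> ?X. \<forall>v\<in>R. conjg v y = y} \<noteq> {}" by fastforce
      then obtain b where b: "b \<in> B" "\<And>v. v \<in> R \<Longrightarrow> conjg v (b \<otimes> x) = b \<otimes> x" by (auto simp: r_coset_def)
      have G: "w \<in> carrier G" "b \<in> carrier G" "x \<in> carrier G" using RG[OF w] BG[OF b(1)] CG[OF x] by auto
      have "conjg w b \<otimes> conjg w x = b \<otimes> x" using b(2)[OF w] G by (simp add: conjg_mult)
      hence "b \<otimes> conjg w x = b \<otimes> x" using IH[OF w b(1)] by simp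
      thus "conjg w x = x" using G by simp
    qed
  qed
  thus ?thesis using ch cP fP r x by auto
qed

text \<open>Being covered by a \<open>p\<close>-subgroup, \<open>A/B\<close> is a nontrivial
  \<open>p\<close>-group and has a nontrivial centre. The preimage \<open>Z\<close> of the centre is
  normal in \<open>G\<close>; since the factor is chief, \<open>Z = A\<close>.\<close>

lemma chief_factor_covered_by_p_subgroup_abelian:
  assumes fG: "finite (carrier G)" and W: "subgroup W G" "card W = p ^ k" and p: "prime p"
    and A: "A \<lhd> G" and B: "B \<lhd> G" and BA: "B \<subset> A" and chief: "\<And>L. L \<lhd> G \<Longrightarrow> B \<subseteq> L \<Longrightarrow> L \<subseteq> A \<Longrightarrow> L = B \<or> L = A"
    and cov: "A \<subseteq> W <#> B" and x: "x \<in> A" and y: "y \<in> A"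
  shows "x \<otimes> y \<otimes> inv x \<otimes> inv y \<in> B"
proof -
  have s: "subgroup A G" "subgroup B G" using A B normal_imp_subgroup by auto
  have sub: "A \<subseteq> carrier G" "B \<subseteq> carrier G" using s subgroup.subset by auto
  have fin: "finite A" "finite B" using finite_subset[OF _ fG] sub by auto
  have AG: "a \<in> carrier G" if "a \<in> A" for a using that sub by auto
  have BG: "a \<in> carrier G" if "a \<in> B" for a using that sub by auto
  define V where "V = W \<inter> A"
  have Vs: "subgroup V G" unfolding V_def by (rule subgroups_Inter_pair[OF W(1) s(1)])
  have "card V dvd p ^ k" using card_subgroup_dvd[OF W(1) Vs _] W(2) by (auto simp: V_def)
  then obtain j where cV: "card V = p ^ j" using p by (metis divides_primepow_nat)
  have VA: "V \<subseteq> A" by (simp add: V_def)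
  have dec: "\<exists>v\<in>V. \<exists>b\<in>B. a = v \<otimes> b" if a: "a \<in> A" for a
  proof -
    obtain v b where vb: "v \<in> W" "b \<in> B" "a = v \<otimes> b" using subsetD[OF cov a] by (auto simp: set_mult_mem_iff)
    have "v = a \<otimes> inv b" using vb BG W(1) by (simp add: m_assoc subgroup.mem_carrier)
    moreover have "b \<in> A" using vb(2) BA by auto
    ultimately have "v \<in> A" using a s(1) by (simp add: subgroup.m_closed subgroup.m_inv_closed)
    thus ?thesis using vb by (auto simp: V_def)
  qed
  have "A \<subseteq> V <#> B" using dec by (auto simp: set_mult_mem_iff)
  moreover have "V <#> B \<subseteq> A" using subsetD[OF VA] psubsetD[OF BA] subgroup.m_closed[OF s(1)] by (auto simp: set_mult_mem_iff)
  ultimately have "V <#> B = A" by auto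
  then obtain i where i: "card A div card B = p ^ i"
    using p_power_index_if_covered[OF Vs cV p B fin(2)] by auto
  have "card B < card A" using BA fin(1) by (rule psubset_card_mono[rotated])
  moreover have "card A = card A div card B * card B" using card_subgroup_dvd[OF s] BA by auto
  ultimately have "card A div card B \<noteq> 1" by auto
  hence dv: "p dvd card A div card B" using i by (cases i) auto
  have "\<exists>z\<in>A - B. \<forall>w\<in>V. conjg w z \<in> B #> z"
    by (rule p_group_centralizes_mod[OF Vs p cV s _ fin(1) _ _ dv])
      (use BA normal_conjg[OF A] normal_conjg[OF B] AG VA in auto)
  then obtain z where z: "z \<in> A" "z \<notin> B" "\<And>w. w \<in> V \<Longrightarrow> conjg w z \<in> B #> z" by blast
  define Z where "Z = {g \<in> A. \<forall>a\<in>A. conjg g a \<otimes> inv a \<in> B}"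
  have "Z \<lhd> G" unfolding Z_def by (rule normal_commuting_mod[OF B A A])
  moreover have "B \<subseteq> Z"
  proof
    fix b assume b: "b \<in> B"
    have "conjg b a \<otimes> inv a \<in> B" if a: "a \<in> A" for a
    proof -
      have "b \<otimes> conjg a (inv b) \<in> B"
        using b normal_conjg[OF B AG[OF a]] s(2) by (simp add: subgroup.m_closed subgroup.m_inv_closed)
      thus ?thesis using BG[OF b] AG[OF a] by (simp add: conjg_def m_assoc)
    qed
    thus "b \<in> Z" using b BA by (auto simp: Z_def)
  qed
  moreover have "z \<in> Z"
  proof -
    have "conjg z a \<otimes> inv a \<in> B" if a: "a \<in> A" for a
    proof -
      obtain v b where vb: "v \<in> V" "b \<in> B" "a = v \<otimes> b" using dec[OF a] by blast
      have G: "z \<in> carrier G" "v \<in> carrier G" "b \<in> carrier G" using z AG vb VA BG by auto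
      have "conjg v z \<otimes> inv z \<in> B" using z(3)[OF vb(1)] mem_rcos_iff[OF s(2)] G by simp
      hence 1: "inv (conjg v z \<otimes> inv z) \<in> B" using s(2) by (simp add: subgroup.m_inv_closed)
      have "conjg z b \<otimes> inv b \<in> B"
        using vb(2) normal_conjg[OF B G(1)] s(2) by (simp add: subgroup.m_closed subgroup.m_inv_closed)
      hence "conjg v (conjg z b \<otimes> inv b) \<in> B" by (rule normal_conjg[OF B G(2)])
      with 1 have "inv (conjg v z \<otimes> inv z) \<otimes> conjg v (conjg z b \<otimes> inv b) \<in> B"
        by (rule subgroup.m_closed[OF s(2)])
      thus ?thesis using G vb(3) by (simp add: conjg_def m_assoc inv_mult_group)
    qed
    thus ?thesis using z(1) by (simp add: Z_def)
  qed
  ultimately have "Z = A" using chief[of Z] z(2) by (auto simp: Z_def)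
  hence "conjg x y \<otimes> inv y \<in> B" using x y by (auto simp: Z_def)
  thus ?thesis using x y AG by (simp add: conjg_def)
qed

end

section \<open>The normal subgroup is hypercyclically embedded\<close>

context group begin

text \<open>By the Frattini argument the elements of \<open>N\<close> represent all cosets of the
  normalizer \<open>T\<close>, so the index of \<open>T\<close> is that of
  \<open>T \<inter> N\<close> in \<open>N\<close>, and \<open>T \<inter> N\<close> contains
  \<open>P\<close>.\<close>

lemma index_normalizer_sylow:
  assumes fG: "finite (carrier G)" and N: "N \<lhd> G" and P: "sylow_in p P N"
  shows "\<not> p dvd card (carrier G) div card (normalizes P)"
proof -
  note P' = sylow_inD[OF P]
  have Ns: "subgroup N G" by (rule normal_imp_subgroup[OF N])
  have NG: "N \<subseteq> carrier G" by (rule subgroup.subset[OF Ns])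
  have fN: "finite N" by (rule finite_subset[OF NG fG])
  have fP: "finite P" by (rule finite_subset[OF P'(3) fN])
  define T where "T = normalizes P"
  have Ts: "subgroup T G" unfolding T_def by (rule subgroup_normalizes[OF subset_trans[OF P'(3) NG]])
  have fT: "finite T" by (rule finite_subset[OF subgroup.subset[OF Ts] fG])
  have PT: "P \<subseteq> T" unfolding T_def by (rule subgroup_subset_normalizes[OF P'(2) fP])
  have "(\<lambda>x. T #> x) ` carrier G = (\<lambda>x. T #> x) ` N"
  proof (intro equalityI subsetI)
    fix X assume "X \<in> (\<lambda>x. T #> x) ` carrier G"
    then obtain g where g: "g \<in> carrier G" "X = T #> g" by auto
    obtain n where n: "n \<in> N" "conjg (n \<otimes> inv g) ` P = P"
      using frattini_argument[OF Ns fN P, of "inv g"] normal_conjg[OF N] g(1) by auto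
    have nG: "n \<in> carrier G" using n NG by auto
    have "n \<otimes> inv g \<in> T" using n nG g(1) by (simp add: T_def normalizes_def)
    hence "T #> n = T #> g" using rcos_eq_iff[OF Ts nG g(1)] by simp
    thus "X \<in> (\<lambda>x. T #> x) ` N" using g n by auto
  qed (use NG in auto)
  moreover have "card (carrier G) = card ((\<lambda>x. T #> x) ` carrier G) * card T"
    by (rule card_subgroup_cosets[OF subgroup_self Ts subgroup.subset[OF Ts]])
  moreover have "card T > 0" by (rule card_subgroup_pos[OF Ts fT])
  ultimately have ix: "card (carrier G) div card T = card ((\<lambda>x. T #> x) ` N)" by simp
  have e: "card ((\<lambda>x. T #> x) ` N) * card (T \<inter> N) = card N" by (rule card_cosets_Int[OF Ts Ns fN])
  have TN: "subgroup (T \<inter> N) G" by (rule subgroups_Inter_pair[OF Ts Ns])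
  have "card P dvd card (T \<inter> N)" by (rule card_subgroup_dvd[OF TN P'(2)]) (use PT P'(3) fN in auto)
  then obtain t where "card (T \<inter> N) = card P * t" by blast
  hence "card N = card P * (card ((\<lambda>x. T #> x) ` N) * t)" using e by (simp add: ac_simps)
  moreover have "card P > 0" by (rule card_subgroup_pos[OF P'(2) fP])
  ultimately have "card N div card P = card ((\<lambda>x. T #> x) ` N) * t" by simp
  thus ?thesis using P'(5) ix by (auto simp: T_def)
qed

lemma conjg_derived:
  assumes P: "P \<subseteq> carrier G" and g: "g \<in> normalizes P" and x: "x \<in> derived G P"
  shows "conjg g x \<in> derived G P"
proof -
  have g': "g \<in> carrier G" "conjg g ` P = P" using g by (auto simp: normalizes_def)
  interpret c: group_hom G G "conjg g"
    by (simp add: group_hom_def group_hom_axioms_def conjg_hom g' group_axioms)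
  have "conjg g ` derived G P = derived G P" using c.derived_img[OF P] g'(2) by simp
  thus ?thesis using x by blast
qed

text \<open>By the Frattini argument \<open>N\<^sub>G(P)\<close> has index prime to \<open>p\<close>. It normalizes \<open>P' S i \<inter> S (Suc i)\<close>,
  whose normalizer has \<open>p\<close>-power index by the hypothesis; so this subgroup is normal in \<open>G\<close>.\<close>

lemma derived_sylow_covers_or_avoids:
  assumes fG: "finite (carrier G)" and N: "N \<lhd> G" and P: "sylow_in p P N"
    and Pi: "partial_Pi_property (derived G P) G"
  shows "\<exists>n S. chief_series G n S \<and> (\<forall>i<n. derived G P \<inter> S (Suc i) \<subseteq> S i \<or>
            S (Suc i) \<subseteq> derived G P <#> S i \<and> (\<forall>x\<in>S (Suc i). \<forall>y\<in>S (Suc i). x \<otimes> y \<otimes> inv x \<otimes> inv y \<in> S i))"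
proof -
  note P' = sylow_inD[OF P]
  have Ns: "subgroup N G" by (rule normal_imp_subgroup[OF N])
  have PG: "P \<subseteq> carrier G" using subset_trans[OF P'(3) subgroup.subset[OF Ns]] .
  define D where "D = derived G P"
  have Ds: "subgroup D G" unfolding D_def by (rule derived_is_subgroup[OF PG])
  have DP: "D \<subseteq> P" unfolding D_def by (rule derived_incl[OF order_refl P'(2)])
  obtain k where "card P = p ^ k" using P'(4) by blast
  hence "card D dvd p ^ k" using card_subgroup_dvd[OF P'(2) Ds DP] by simp
  then obtain l where cD: "card D = p ^ l" using P'(1) by (metis divides_primepow_nat)
  define T where "T = normalizes P"
  have Ts: "subgroup T G" unfolding T_def by (rule subgroup_normalizes[OF PG])
  note TG = subgroup.mem_carrier[OF Ts]
  obtain n S where ch: "chief_series G n S" and E: "\<And>i. i < n \<Longrightarrow> \<exists>E r. subgroup E G \<and> card (carrier G) = p ^ r * card E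
            \<and> (\<forall>g\<in>E. \<forall>x\<in>(D <#> S i) \<inter> S (Suc i). conjg g x \<in> (D <#> S i) \<inter> S (Suc i))"
    using partial_Pi_p_subgroup[OF fG Pi[folded D_def] cD P'(1)] by blast
  have "D \<inter> S (Suc i) \<subseteq> S i \<or>
      S (Suc i) \<subseteq> D <#> S i \<and> (\<forall>x\<in>S (Suc i). \<forall>y\<in>S (Suc i). x \<otimes> y \<otimes> inv x \<otimes> inv y \<in> S i)" if i: "i < n" for i
  proof -
    have SN: "S i \<lhd> G" "S (Suc i) \<lhd> G" and SS: "S i \<subset> S (Suc i)"
      and chief: "\<And>L. L \<lhd> G \<Longrightarrow> S i \<subseteq> L \<Longrightarrow> L \<subseteq> S (Suc i) \<Longrightarrow> L = S i \<or> L = S (Suc i)"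
      using ch i by (auto simp: chief_series_def)
    have s: "subgroup (S i) G" "subgroup (S (Suc i)) G" using SN normal_imp_subgroup by auto
    define K where "K = (D <#> S i) \<inter> S (Suc i)"
    note DS = subgroup_set_mult_normal[OF Ds SN(1)]
    have Ks: "subgroup K G" unfolding K_def by (rule subgroups_Inter_pair[OF DS(1) s(2)])
    have KG: "K \<subseteq> carrier G" by (rule subgroup.subset[OF Ks])
    have fK: "finite K" by (rule finite_subset[OF KG fG])
    obtain E r where E': "subgroup E G" "card (carrier G) = p ^ r * card E" "\<And>g x. g \<in> E \<Longrightarrow> x \<in> K \<Longrightarrow> conjg g x \<in> K"
      using E[OF i] unfolding K_def by blast
    have TK: "conjg g x \<in> K" if g: "g \<in> T" and x: "x \<in> K" for g x
    proof -
      obtain d c where dc: "d \<in> D" "c \<in> S i" "x = d \<otimes> c" using x by (auto simp: K_def set_mult_mem_iff)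
      have "d \<in> carrier G" "c \<in> carrier G" using dc Ds s(1) by (auto simp: subgroup.mem_carrier)
      hence "conjg g x = conjg g d \<otimes> conjg g c" using dc(3) TG[OF g] by (simp add: conjg_mult)
      moreover have "conjg g d \<in> D" using conjg_derived[OF PG] g dc(1) by (simp add: T_def D_def)
      moreover have "conjg g c \<in> S i" by (rule normal_conjg[OF SN(1) TG[OF g] dc(2)])
      ultimately have "conjg g x \<in> D <#> S i" by (auto simp: set_mult_mem_iff)
      thus ?thesis using normal_conjg[OF SN(2) TG[OF g]] x by (auto simp: K_def)
    qed
    have "normalizes K = carrier G"
    proof (rule subgroup_eq_if_coprime_indices[OF fG subgroup_normalizes[OF KG] E'(1) _ E'(2) Ts _ _ P'(1)])
      show "E \<subseteq> normalizes K" using normalizes_iff[OF fK KG] E'(1,3) by (auto simp: subgroup.mem_carrier)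
      show "T \<subseteq> normalizes K" using normalizes_iff[OF fK KG] TK TG by auto
      show "\<not> p dvd card (carrier G) div card T" unfolding T_def by (rule index_normalizer_sylow[OF fG N P])
    qed
    hence "K \<lhd> G" using normal_conjgI[OF Ks] normalizes_iff[OF fK KG] by auto
    moreover have "S i \<subseteq> K" using DS(2) SS by (auto simp: K_def)
    ultimately consider "K = S i" | "K = S (Suc i)" using chief[of K] by (auto simp: K_def)
    thus ?thesis
    proof cases
      case 1
      have "D \<inter> S (Suc i) \<subseteq> K" using DS(3) by (auto simp: K_def)
      thus ?thesis using 1 by simp
    next
      case 2
      hence cov: "S (Suc i) \<subseteq> D <#> S i" by (auto simp: K_def)
      have "x \<otimes> y \<otimes> inv x \<otimes> inv y \<in> S i" if "x \<in> S (Suc i)" "y \<in> S (Suc i)" for x y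
        by (rule chief_factor_covered_by_p_subgroup_abelian[OF fG Ds cD P'(1) SN(2,1) SS chief cov that])
      thus ?thesis using cov by blast
    qed
  qed
  thus ?thesis using ch unfolding D_def by blast
qed

theorem normal_hypercyclic:
  assumes fG: "finite (carrier G)" and N: "N \<lhd> G"
    and max: "\<And>p P M. \<lbrakk>prime p; p dvd card N; sylow_in p P N; maximal_subgroup M (G\<lparr>carrier := P\<rparr>)\<rbrakk>
          \<Longrightarrow> partial_Pi_property M (G\<lparr>carrier := normalizer G P\<rparr>)"
    and der: "\<And>p P. \<lbrakk>prime p; p dvd card N; sylow_in p P N\<rbrakk> \<Longrightarrow> partial_Pi_property (derived G P) G"
  shows "prime_step\<^sup>*\<^sup>* {\<one>} N"
  using N max der
proof (induction "card N" arbitrary: N rule: less_induct)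
  case less
  note N = less.prems(1) and max = less.prems(2) and der = less.prems(3)
  have Ns: "subgroup N G" by (rule normal_imp_subgroup[OF N])
  have NG: "N \<subseteq> carrier G" by (rule subgroup.subset[OF Ns])
  have fN: "finite N" by (rule finite_subset[OF NG fG])
  show ?case
  proof (cases "card N = 1")
    case True
    hence "N = {\<one>}" using subgroup.one_closed[OF Ns] by (metis card_1_singletonE singletonD)
    thus ?thesis by simp
  next
    case False
    define p where "p = (LEAST q. prime q \<and> q dvd card N)"
    have ex: "\<exists>q. prime q \<and> q dvd card N" using prime_factor_nat[OF False] .
    have p: "prime p" and pN: "p dvd card N" using LeastI_ex[OF ex] by (auto simp: p_def)
    have pmin: "p \<le> q" if "prime q" "q dvd card N" for q unfolding p_def by (rule Least_le) (use that in simp)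
    obtain P where P: "sylow_in p P N" using sylow_in_exists[OF Ns fN p] by blast
    note P' = sylow_inD[OF P]
    have PG: "P \<subseteq> carrier G" using P'(3) NG by auto
    have fP: "finite P" by (rule finite_subset[OF PG fG])
    obtain k where cP: "card P = p ^ k" using P'(4) by blast
    define T where "T = normalizes P"
    have Ts: "subgroup T G" unfolding T_def by (rule subgroup_normalizes[OF PG])
    have TG: "T \<subseteq> carrier G" by (rule subgroup.subset[OF Ts])
    have PT: "P \<subseteq> T" unfolding T_def by (rule subgroup_subset_normalizes[OF P'(2) fP])
    have nT: "normalizer G P = T" unfolding T_def by (rule normalizer_eq_normalizes[OF PG])
    let ?T = "G\<lparr>carrier := T\<rparr>" and ?N = "G\<lparr>carrier := N\<rparr>"
    interpret T: group ?T by (rule group_restrict[OF Ts])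
    interpret N: group ?N by (rule group_restrict[OF Ns])
    have fT: "finite (carrier ?T)" using finite_subset[OF TG fG] by simp
    have PnT: "P \<lhd> ?T" using normal_restrict_iff[OF Ts] P'(2) PT by (auto simp: T_def normalizes_def)
    \<comment> \<open>The members of this chain are normal in \<open>T\<close>, the normalizer of
      \<open>P\<close>, and not yet in \<open>G\<close>.\<close>
    have chT: "T.prime_step\<^sup>*\<^sup>* {\<one>} P"
    proof -
      have "partial_Pi_property M ?T" if "maximal_subgroup M (?T\<lparr>carrier := P\<rparr>)" for M
        using max[OF p pN P, of M] that nT by simp
      moreover have "{\<one>} \<lhd> ?T" using T.one_is_normal by simp
      moreover have "{\<one>} \<subseteq> P" using subgroup.one_closed[OF P'(2)] by simp
      ultimately show ?thesis by (rule T.hypercyclic_if_maximal_subgroups_partial_Pi[OF fT PnT cP p])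
    qed
    have cent: "N.conjg r x = x" if q: "prime q" "q \<noteq> p" and R: "N.sylow_in q R (N.normalizes P)" and r: "r \<in> R" and x: "x \<in> P"
      for q R r x
    proof -
      have R': "sylow_in q R (T \<inter> N)" using R by (simp add: sylow_in_restrict[OF Ns] normalizes_restrict[OF Ns] T_def)
      note R'' = sylow_inD[OF R']
      have RT: "R \<subseteq> T" and RN: "R \<subseteq> N" using R'' by auto
      obtain l where l: "card R = q ^ l" using R''(4) by blast
      have "conjg r x = x"
      \<comment> \<open>The Sylow \<open>q\<close>-subgroup may be trivial; otherwise
        \<open>q\<close> divides \<open>card N\<close> and minimality of \<open>p\<close> gives
        \<open>p < q\<close>.\<close>
      proof (cases "l = 0")
        case True
        hence "R = {\<one>}" using l subgroup.one_closed[OF R''(2)] by (metis card_1_singletonE power_0 singletonD)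
        thus ?thesis using r x PG by auto
      next
        case False
        have "card R dvd card N" by (rule card_subgroup_dvd[OF Ns R''(2) RN])
        hence "q dvd card N" using l False dvd_power[of l q] dvd_trans by auto
        hence "p < q" using pmin[OF q(1)] q(2) by simp
        moreover have "subgroup R ?T" by (rule subgroup_incl[OF R''(2) Ts RT])
        ultimately have "T.conjg r x = x"
          using T.larger_prime_group_centralizes_hypercyclic[of R q l p P k r x] l q(1) p fP cP chT r x by simp
        thus ?thesis using conjg_restrict[OF Ts, of r x] r RT by auto
      qed
      thus ?thesis using conjg_restrict[OF Ns, of r x] r RN by auto
    qed
    define D where "D = derived G P"
    have DN: "derived ?N P = D" unfolding D_def by (rule derived_consistent[OF P'(3) Ns])
    have DP: "D \<subseteq> P" unfolding D_def by (rule derived_incl[OF order_refl P'(2)])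
    obtain n S where S: "chief_series G n S" "\<And>i. i < n \<Longrightarrow> D \<inter> S (Suc i) \<subseteq> S i \<or>
            S (Suc i) \<subseteq> D <#> S i \<and> (\<forall>x\<in>S (Suc i). \<forall>y\<in>S (Suc i). x \<otimes> y \<otimes> inv x \<otimes> inv y \<in> S i)"
      using derived_sylow_covers_or_avoids[OF fG N P der[OF p pN P]] unfolding D_def by blast
    \<comment> \<open>The complement is sought in \<open>N\<close> as ambient group. Intersecting
      the chief series of \<open>G\<close> with \<open>N\<close> keeps the alternative of covering
      and avoiding, because \<open>D\<close> lies in \<open>N\<close>.\<close>
    have "\<exists>L. L \<lhd> ?N \<and> \<not> p dvd card L \<and> (\<exists>j. card (carrier ?N) = p ^ j * card L)"
    proof (rule N.normal_p_complement_exists[where P = P and K = "\<lambda>i. N \<inter> S i" and n = n])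
      show "finite (carrier ?N)" using fN by simp
      show "N.sylow_in p P (carrier ?N)" using P P'(3) by (simp add: sylow_in_restrict[OF Ns])
      show "N \<inter> S 0 = {\<one>\<^bsub>?N\<^esub>}" using S(1) subgroup.one_closed[OF Ns] by (auto simp: chief_series_def)
      show "N \<inter> S n = carrier ?N" using S(1) NG by (auto simp: chief_series_def)
      show "N \<inter> S i \<lhd> ?N" if "i \<le> n" for i
      proof -
        have "S i \<lhd> G" using S(1) that by (simp add: chief_series_def)
        hence "N \<inter> S i \<lhd> G" by (rule normal_subgroup_intersect[OF N])
        thus ?thesis by (rule normal_restrict_supergroup[OF Ns]) simp
      qed
      show "N \<inter> S i \<subseteq> N \<inter> S (Suc i)" if "i < n" for i using S(1) that by (auto simp: chief_series_def)
      show "N.conjg r x = x" if "prime q" "q \<noteq> p" "N.sylow_in q R (N.normalizes P)" "r \<in> R" "x \<in> P" for q R r x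
        by (rule cent[OF that])
      show "derived ?N P \<inter> (N \<inter> S (Suc i)) \<subseteq> N \<inter> S i \<or>
        N \<inter> S (Suc i) \<subseteq> derived ?N P <#>\<^bsub>?N\<^esub> (N \<inter> S i) \<and>
        (\<forall>x\<in>N \<inter> S (Suc i). \<forall>y\<in>N \<inter> S (Suc i). x \<otimes>\<^bsub>?N\<^esub> y \<otimes>\<^bsub>?N\<^esub> inv\<^bsub>?N\<^esub> x \<otimes>\<^bsub>?N\<^esub> inv\<^bsub>?N\<^esub> y \<in> N \<inter> S i)"
        if i: "i < n" for i
        using S(2)[OF i]
      proof
        assume "D \<inter> S (Suc i) \<subseteq> S i"
        thus ?thesis unfolding DN by auto
      next
        assume a: "S (Suc i) \<subseteq> D <#> S i \<and> (\<forall>x\<in>S (Suc i). \<forall>y\<in>S (Suc i). x \<otimes> y \<otimes> inv x \<otimes> inv y \<in> S i)"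
        have "S i \<lhd> G" using S(1) i by (simp add: chief_series_def)
        hence Sis: "subgroup (S i) G" by (rule normal_imp_subgroup)
        have "x \<in> D <#> (N \<inter> S i)" if x: "x \<in> N \<inter> S (Suc i)" for x
        proof -
          obtain d c where dc: "d \<in> D" "c \<in> S i" "x = d \<otimes> c" using a x by (auto simp: set_mult_mem_iff subset_iff)
          have dN: "d \<in> N" using dc DP P'(3) by auto
          have "d \<in> carrier G" "c \<in> carrier G" using dN NG dc(2) Sis by (auto simp: subgroup.mem_carrier)
          hence "c = inv d \<otimes> x" using dc(3) by simp
          hence "c \<in> N" using dN x Ns by (simp add: subgroup.m_closed subgroup.m_inv_closed)
          thus ?thesis using dc by (auto simp: set_mult_mem_iff)
        qed
        moreover have "x \<otimes> y \<otimes> inv x \<otimes> inv y \<in> N \<inter> S i" if xy: "x \<in> N \<inter> S (Suc i)" "y \<in> N \<inter> S (Suc i)" for x y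
        proof -
          have "x \<otimes> y \<otimes> inv x \<otimes> inv y \<in> S i" using a xy by blast
          moreover have "x \<otimes> y \<otimes> inv x \<otimes> inv y \<in> N" using xy Ns by (simp add: subgroup.m_closed subgroup.m_inv_closed)
          ultimately show ?thesis by simp
        qed
        ultimately show ?thesis unfolding DN using m_inv_consistent[OF Ns] by auto
      qed
    qed
    then obtain L j where LN: "L \<lhd> ?N" "\<not> p dvd card L" "card N = p ^ j * card L" by auto
    have Ls: "subgroup L G" and LsubN: "L \<subseteq> N" and NL: "\<And>h l. h \<in> N \<Longrightarrow> l \<in> L \<Longrightarrow> conjg h l \<in> L"
      using LN(1) normal_restrict_iff[OF Ns] by auto
    have fL: "finite L" by (rule finite_subset[OF LsubN fN])
    have cL: "card L > 0" by (rule card_subgroup_pos[OF Ls fL])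
    have cNL: "card N div card L = p ^ j" using LN(3) cL by simp
    have oneL: "{\<one>} \<subseteq> L" using subgroup.one_closed[OF Ls] by simp
    have "L \<lhd> G"
      by (rule normal_if_coprime_indices[OF fG one_is_normal N Ls oneL LsubN NL])
        (use LN(2) p cNL in \<open>simp_all add: prime_imp_coprime coprime_commute\<close>)
    have "card L < card N"
      using LN pN cL by (metis dvd_refl mult.left_neutral nat_neq_iff le_eq_less_or_eq card_mono[OF fN LsubN])
    have sylN: "sylow_in q Q N" if q: "prime q" "q dvd card L" "sylow_in q Q L" for q Q
    proof (rule sylow_in_of_coprime_index[OF q(3) Ls LsubN Ns fN])
      have "q \<noteq> p" using q(2) LN(2) by auto
      thus "\<not> q dvd card N div card L" unfolding cNL using q(1) p by (metis prime_dvd_power primes_dvd_imp_eq)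
    qed
    have qN: "q dvd card N" if "q dvd card L" for q using that LN(3) by simp
    have chL: "prime_step\<^sup>*\<^sup>* {\<one>} L"
    proof (rule less.hyps[OF \<open>card L < card N\<close> \<open>L \<lhd> G\<close>])
      fix q Q M assume "prime q" "q dvd card L" "sylow_in q Q L" "maximal_subgroup M (G\<lparr>carrier := Q\<rparr>)"
      thus "partial_Pi_property M (G\<lparr>carrier := normalizer G Q\<rparr>)" using max qN sylN by blast
    next
      fix q Q assume "prime q" "q dvd card L" "sylow_in q Q L"
      thus "partial_Pi_property (derived G Q) G" using der qN sylN by blast
    qed
    \<comment> \<open>Subgroups of \<open>P\<close> meet \<open>L\<close> trivially, so multiplying
      by \<open>L\<close> preserves the ratios of orders and hence the prime order of the
      factors.\<close>
    have LB: "L \<inter> B = {\<one>}" and cLB: "card (B <#> L) = card B * card L" if B: "subgroup B G" "B \<subseteq> P" for B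
    proof -
      have fB: "finite B" by (rule finite_subset[OF B(2) fP])
      have LBs: "subgroup (L \<inter> B) G" by (rule subgroups_Inter_pair[OF Ls B(1)])
      have "card (L \<inter> B) dvd card L" by (rule card_subgroup_dvd[OF Ls LBs _]) auto
      moreover have "card (L \<inter> B) dvd p ^ k" using card_subgroup_dvd[OF P'(2) LBs _] B(2) cP by auto
      moreover have "coprime (card L) (p ^ k)" using LN(2) p by (simp add: prime_imp_coprime coprime_commute)
      ultimately have "card (L \<inter> B) = 1" by (metis coprime_common_divisor_nat)
      thus LB: "L \<inter> B = {\<one>}" using subgroup.one_closed[OF LBs] by (metis card_1_singletonE singletonD)
      show "card (B <#> L) = card B * card L"
        using card_set_mult_normal[OF B(1) fB \<open>L \<lhd> G\<close>] LB by simp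
    qed
    note PL = subgroup_set_mult_normal[OF P'(2) \<open>L \<lhd> G\<close>]
    have PLN: "P <#> L = N"
    proof -
      have sub: "P <#> L \<subseteq> N"
        using subsetD[OF P'(3)] subsetD[OF LsubN] subgroup.m_closed[OF Ns] by (auto simp: set_mult_mem_iff)
      obtain c where c: "card N = card (P <#> L) * c" using card_subgroup_dvd[OF Ns PL(1) sub] by blast
      have "card N = card P * (card L * c)" using c cLB[OF P'(2) order_refl] by (simp add: ac_simps)
      moreover have "card P > 0" by (rule card_subgroup_pos[OF P'(2) fP])
      ultimately have "card N div card P = card L * c" by simp
      hence "\<not> p dvd c" using P'(5) by auto
      moreover have "card L * p ^ j = card N" using LN(3) by simp
      hence "card L * p ^ j = card L * (card P * c)" using c cLB[OF P'(2) order_refl] by (simp add: ac_simps)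
      hence "p ^ j = card P * c" using cL by simp
      hence "c dvd p ^ j" by simp
      then obtain i where "c = p ^ i" using p by (metis divides_primepow_nat)
      ultimately have "c = 1" by (cases i) auto
      thus ?thesis using c sub fN by (simp add: card_subset_eq)
    qed
    \<comment> \<open>The normalizer of \<open>B <#> L\<close> contains \<open>T\<close>, which
      normalizes both factors, and contains \<open>P\<close> and \<open>L\<close>, hence
      \<open>N\<close>; by the Frattini argument \<open>N\<close> and \<open>T\<close> give all of
      \<open>G\<close>.\<close>
    have up: "B <#> L \<lhd> G" if B: "B \<lhd> ?T" "B \<subseteq> P" for B
    proof -
      have Bs: "subgroup B G" and TB: "\<And>g b. g \<in> T \<Longrightarrow> b \<in> B \<Longrightarrow> conjg g b \<in> B"
        using B(1) normal_restrict_iff[OF Ts] by auto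
      note BL = subgroup_set_mult_normal[OF Bs \<open>L \<lhd> G\<close>]
      have BLG: "B <#> L \<subseteq> carrier G" by (rule subgroup.subset[OF BL(1)])
      have fBL: "finite (B <#> L)" by (rule finite_subset[OF BLG fG])
      define Y where "Y = normalizes (B <#> L)"
      have Ys: "subgroup Y G" unfolding Y_def by (rule subgroup_normalizes[OF BLG])
      have "T \<subseteq> Y"
      proof
        fix t assume t: "t \<in> T"
        have tG: "t \<in> carrier G" using t TG by auto
        have "conjg t x \<in> B <#> L" if x: "x \<in> B <#> L" for x
        proof -
          obtain b l where bl: "b \<in> B" "l \<in> L" "x = b \<otimes> l" using x by (auto simp: set_mult_mem_iff)
          have "b \<in> carrier G" "l \<in> carrier G" using bl Bs Ls by (auto simp: subgroup.mem_carrier)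
          hence "conjg t x = conjg t b \<otimes> conjg t l" using bl(3) tG by (simp add: conjg_mult)
          thus ?thesis using TB[OF t bl(1)] normal_conjg[OF \<open>L \<lhd> G\<close> tG bl(2)] by (auto simp: set_mult_mem_iff)
        qed
        thus "t \<in> Y" using normalizes_iff[OF fBL BLG] tG by (simp add: Y_def)
      qed
      have "L \<subseteq> Y" using BL(2) subgroup_subset_normalizes[OF BL(1) fBL] by (auto simp: Y_def)
      have NY: "N \<subseteq> Y"
        unfolding PLN[symmetric] using \<open>L \<subseteq> Y\<close> \<open>T \<subseteq> Y\<close> PT subgroup.m_closed[OF Ys] by (auto simp: set_mult_mem_iff subset_iff)
      have "g \<in> Y" if g: "g \<in> carrier G" for g
      proof -
        obtain n where n: "n \<in> N" "conjg (n \<otimes> g) ` P = P"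
          using frattini_argument[OF Ns fN P g normal_conjg[OF N g]] by blast
        have nG: "n \<in> carrier G" using n NG by auto
        have "n \<otimes> g \<in> T" using n nG g by (simp add: T_def normalizes_def)
        hence "inv n \<otimes> (n \<otimes> g) \<in> Y"
          using n(1) NY \<open>T \<subseteq> Y\<close> Ys by (meson subgroup.m_closed subgroup.m_inv_closed subsetD)
        thus ?thesis using nG g by simp
      qed
      thus ?thesis using normal_conjgI[OF BL(1)] normalizes_iff[OF fBL BLG] by (auto simp: Y_def)
    qed
    have "prime_step\<^sup>*\<^sup>* ({\<one>} <#> L) (C <#> L)" if "T.prime_step\<^sup>*\<^sup>* {\<one>} C" "C \<subseteq> P" for C
      using that
    proof (induction rule: rtranclp_induct)
      case (step B C)
      obtain t where t: "B \<lhd> ?T" "C \<lhd> ?T" "B \<subseteq> C" "prime t" "card C = t * card B"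
        using step(2) by (auto simp: T.prime_step_def)
      have BP: "B \<subseteq> P" using t(3) step(4) by auto
      have s: "subgroup B G" "subgroup C G" using t(1,2) normal_restrict_iff[OF Ts] by auto
      have "prime_step (B <#> L) (C <#> L)"
        unfolding prime_step_def
        using up[OF t(1) BP] up[OF t(2) step(4)] mono_set_mult[OF t(3), of L L] t(4,5) cLB[OF s(1) BP] cLB[OF s(2) step(4)]
        by (auto simp: mult.assoc)
      thus ?case using step.IH[OF BP] by (rule rtranclp.rtrancl_into_rtrancl[rotated])
    qed simp
    from this[OF chT order_refl] have "prime_step\<^sup>*\<^sup>* ({\<one>} <#> L) N" using PLN by simp
    moreover have "{\<one>} <#> L = L" using subgroup.mem_carrier[OF Ls] by (auto simp: set_mult_def)
    ultimately show ?thesis using chL by simp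
  qed
qed

end

section \<open>Saturated formations\<close>

text \<open>Transport of structure along an injection of the carrier into the natural numbers; the
  members of a class live there, so a quotient needs such a copy before it can be compared with the
  class.\<close>

lemma nat_copy_exists:
  fixes G :: "('a, 'b) monoid_scheme" (structure)
  assumes "group G" and fG: "finite (carrier G)"
  shows "\<exists>H :: nat monoid. group H \<and> finite (carrier H) \<and> G \<cong> H"
proof -
  interpret group G by (rule assms(1))
  obtain f :: "'a \<Rightarrow> nat" where f: "inj_on f (carrier G)" using finite_imp_inj_to_nat_seg[OF fG] by blast
  define g where "g = inv_into (carrier G) f"
  have gf: "g (f x) = x" if "x \<in> carrier G" for x using f that by (simp add: g_def)
  define H where "H = \<lparr>carrier = f ` carrier G, monoid.mult = (\<lambda>x y. f (g x \<otimes> g y)), one = f \<one>\<rparr>"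
  have "group H"
  proof (rule groupI)
    show "\<exists>y\<in>carrier H. y \<otimes>\<^bsub>H\<^esub> x = \<one>\<^bsub>H\<^esub>" if "x \<in> carrier H" for x
    proof -
      from that obtain a where a: "a \<in> carrier G" "x = f a" by (auto simp: H_def)
      thus ?thesis by (intro bexI[of _ "f (inv a)"]) (auto simp: H_def gf)
    qed
  qed (auto simp: H_def gf m_assoc)
  moreover have "f \<in> iso G H"
    by (rule isoI) (auto simp: hom_def H_def gf bij_betw_def f)
  moreover have "finite (carrier H)" using fG by (simp add: H_def)
  ultimately show ?thesis by (blast intro: is_isoI)
qed

lemma in_class_iso:
  assumes "in_class G \<F>" "group G" "G \<cong> H" shows "in_class H \<F>"
proof -
  obtain K where K: "K \<in> \<F>" "G \<cong> K" using assms(1) by (auto simp: in_class_def)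
  have "H \<cong> G" by (rule group.iso_sym[OF assms(2,3)])
  thus ?thesis using K iso_trans by (auto simp: in_class_def)
qed

lemma in_class_epi:
  assumes \<F>: "formation \<F>" and G: "in_class G \<F>" "group G" and H: "group H" and f: "f \<in> epi G H"
  shows "in_class H \<F>"
proof -
  obtain K where K: "K \<in> \<F>" "G \<cong> K" using G(1) by (auto simp: in_class_def)
  have gK: "group K" "finite (carrier K)" using \<F> K(1) by (auto simp: formation_def finite_group_def)
  have "K \<cong> G" by (rule group.iso_sym[OF G(2) K(2)])
  then obtain k where k: "k \<in> iso K G" by (auto simp: is_iso_def)
  have fk: "f \<circ> k \<in> epi K H" by (rule epi_compose) (use k f in \<open>auto simp: iso_iff_mon_epi\<close>)
  hence "carrier H = (f \<circ> k) ` carrier K" by (simp add: epi_def)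
  hence "finite (carrier H)" using gK(2) by simp
  then obtain H' :: "nat monoid" where H': "group H'" "H \<cong> H'" using nat_copy_exists[OF H] by blast
  then obtain h where h: "h \<in> iso H H'" by (auto simp: is_iso_def)
  have "h \<circ> (f \<circ> k) \<in> epi K H'" by (rule epi_compose[OF fk]) (use h in \<open>simp add: iso_iff_mon_epi\<close>)
  hence "H' \<in> \<F>" using \<F> K(1) H'(1) unfolding formation_def by blast
  thus ?thesis using H'(2) by (auto simp: in_class_def)
qed

text \<open>A surjection of \<open>G\<close> that kills \<open>V\<close> factors through
  \<open>G Mod V\<close>. In this form quotients of quotients and quotients of isomorphic copies are
  handled without constructing isomorphisms between them.\<close>

lemma in_class_image_of_quotient:
  assumes \<F>: "formation \<F>" and V: "V \<lhd> G" and G: "in_class (G Mod V) \<F>"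
    and H: "group H" and h: "h \<in> hom G H" "h ` carrier G = carrier H" and k: "\<And>v. v \<in> V \<Longrightarrow> h v = \<one>\<^bsub>H\<^esub>"
  shows "in_class H \<F>"
proof -
  interpret V: normal V G by (rule V)
  interpret h: group_hom G H h using h(1) H V.group_axioms by (simp add: group_hom_def group_hom_axioms_def)
  have "h x = h y" if "x \<in> carrier G" "y \<in> carrier G" "V #>\<^bsub>G\<^esub> x = V #>\<^bsub>G\<^esub> y" for x y
  proof -
    have "x \<otimes>\<^bsub>G\<^esub> inv\<^bsub>G\<^esub> y \<in> V" using V.rcos_eq_iff[OF V.is_subgroup that(1,2)] that(3) by simp
    hence "h (x \<otimes>\<^bsub>G\<^esub> inv\<^bsub>G\<^esub> y) = \<one>\<^bsub>H\<^esub>" by (rule k)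
    hence "h x \<otimes>\<^bsub>H\<^esub> inv\<^bsub>H\<^esub> h y = \<one>\<^bsub>H\<^esub>" using that by simp
    thus ?thesis using that by (metis h.H.inv_equality h.H.inv_inv h.hom_closed h.H.inv_closed)
  qed
  then obtain g where g: "g \<in> hom (G Mod V) H" "\<And>x. x \<in> carrier G \<Longrightarrow> g (V #>\<^bsub>G\<^esub> x) = h x"
    using FactGroup_universal[OF h(1) V] by metis
  have "g ` carrier (G Mod V) = carrier H"
    using g(2) h(2) by (force simp: carrier_FactGroup image_image)
  hence "g \<in> epi (G Mod V) H" using g(1) by (simp add: epi_def)
  thus ?thesis by (rule in_class_epi[OF \<F> G V.factorgroup_is_group H])
qed

text \<open>The two quotient maps together are injective on \<open>G\<close> because their kernels
  meet trivially, and the image projects onto both factors. The factors are replaced by isomorphic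
  members \<open>A0\<close>, \<open>A1\<close> of the class, indexed by 0 and 1.\<close>

lemma in_class_subdirect:
  assumes \<F>: "formation \<F>" and V: "V \<lhd> G" and C: "C \<lhd> G" and VC: "V \<inter> C = {\<one>\<^bsub>G\<^esub>}"
    and GV: "in_class (G Mod V) \<F>" and GC: "in_class (G Mod C) \<F>"
  shows "in_class G \<F>"
proof -
  interpret V: normal V G by (rule V)
  interpret C: normal C G by (rule C)
  interpret GV: group "G Mod V" by (rule V.factorgroup_is_group)
  interpret GC: group "G Mod C" by (rule C.factorgroup_is_group)
  obtain A0 f0 where A0: "A0 \<in> \<F>" "f0 \<in> iso (G Mod V) A0" using GV by (auto simp: in_class_def is_iso_def)
  obtain A1 f1 where A1: "A1 \<in> \<F>" "f1 \<in> iso (G Mod C) A1" using GC by (auto simp: in_class_def is_iso_def)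
  define I where "I = {0, 1::nat}"
  define A where "A i = (if i = (0::nat) then A0 else A1)" for i
  have AF: "A i \<in> \<F>" for i using A0 A1 by (simp add: A_def)
  have gA: "group (A i)" for i using \<F> AF[of i] by (auto simp: formation_def finite_group_def)
  interpret f0: group_hom "G Mod V" A0 f0
    using A0(2) gA[of 0] GV.group_axioms by (simp add: group_hom_def group_hom_axioms_def iso_def A_def)
  interpret f1: group_hom "G Mod C" A1 f1
    using A1(2) gA[of 1] GC.group_axioms by (simp add: group_hom_def group_hom_axioms_def iso_def A_def)
  define \<theta> where "\<theta> x = (\<lambda>i\<in>I. if i = 0 then f0 (V #>\<^bsub>G\<^esub> x) else f1 (C #>\<^bsub>G\<^esub> x))" for x
  let ?P = "product_group I A"
  interpret P: group ?P by (rule product_group) (rule gA)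
  have mem: "V #>\<^bsub>G\<^esub> x \<in> carrier (G Mod V)" "C #>\<^bsub>G\<^esub> x \<in> carrier (G Mod C)" if "x \<in> carrier G" for x
    using that by (auto simp: carrier_FactGroup)
  have hom: "\<theta> \<in> hom G ?P"
  proof (rule homI)
    show "\<theta> x \<in> carrier ?P" if "x \<in> carrier G" for x
      using mem[OF that] by (auto simp: \<theta>_def A_def I_def)
    fix x y assume xy: "x \<in> carrier G" "y \<in> carrier G"
    have "f0 (V #>\<^bsub>G\<^esub> (x \<otimes>\<^bsub>G\<^esub> y)) = f0 (V #>\<^bsub>G\<^esub> x) \<otimes>\<^bsub>A0\<^esub> f0 (V #>\<^bsub>G\<^esub> y)"
      using f0.hom_mult[OF mem(1)[OF xy(1)] mem(1)[OF xy(2)]] V.rcos_sum[OF xy] by simp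
    moreover have "f1 (C #>\<^bsub>G\<^esub> (x \<otimes>\<^bsub>G\<^esub> y)) = f1 (C #>\<^bsub>G\<^esub> x) \<otimes>\<^bsub>A1\<^esub> f1 (C #>\<^bsub>G\<^esub> y)"
      using f1.hom_mult[OF mem(2)[OF xy(1)] mem(2)[OF xy(2)]] C.rcos_sum[OF xy] by simp
    ultimately show "\<theta> (x \<otimes>\<^bsub>G\<^esub> y) = \<theta> x \<otimes>\<^bsub>?P\<^esub> \<theta> y"
      by (auto simp: \<theta>_def A_def I_def restrict_def fun_eq_iff)
  qed
  interpret \<theta>: group_hom G ?P \<theta>
    using hom P.group_axioms V.group_axioms by (simp add: group_hom_def group_hom_axioms_def)
  have inj: "inj_on \<theta> (carrier G)"
  proof (rule inj_onI)
    fix x y assume xy: "x \<in> carrier G" "y \<in> carrier G" "\<theta> x = \<theta> y"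
    have "f0 (V #>\<^bsub>G\<^esub> x) = f0 (V #>\<^bsub>G\<^esub> y)" "f1 (C #>\<^bsub>G\<^esub> x) = f1 (C #>\<^bsub>G\<^esub> y)"
      using fun_cong[OF xy(3), of 0] fun_cong[OF xy(3), of 1] by (auto simp: \<theta>_def I_def)
    hence "V #>\<^bsub>G\<^esub> x = V #>\<^bsub>G\<^esub> y" "C #>\<^bsub>G\<^esub> x = C #>\<^bsub>G\<^esub> y"
      using A0(2) A1(2) mem xy(1,2) by (auto simp: iso_def bij_betw_def dest: inj_onD)
    hence "x \<otimes>\<^bsub>G\<^esub> inv\<^bsub>G\<^esub> y \<in> V \<inter> C"
      using V.rcos_eq_iff[OF V.is_subgroup xy(1,2)] V.rcos_eq_iff[OF C.is_subgroup xy(1,2)] by simp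
    hence "x \<otimes>\<^bsub>G\<^esub> inv\<^bsub>G\<^esub> y = \<one>\<^bsub>G\<^esub>" using VC by simp
    thus "x = y" using xy(1,2) by (metis V.inv_equality V.inv_inv V.inv_closed)
  qed
  define S where "S = \<theta> ` carrier G"
  have "subgroup S ?P" unfolding S_def by (rule \<theta>.img_is_subgroup)
  moreover have "(\<lambda>x. x i) ` S = carrier (A i)" if "i \<in> I" for i
  proof -
    have "(\<lambda>x. x i) ` S = (\<lambda>x. if i = 0 then f0 (V #>\<^bsub>G\<^esub> x) else f1 (C #>\<^bsub>G\<^esub> x)) ` carrier G"
      using that by (simp add: S_def image_image \<theta>_def)
    also have "\<dots> = (if i = 0 then f0 ` carrier (G Mod V) else f1 ` carrier (G Mod C))"
      by (auto simp: carrier_FactGroup)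
    also have "\<dots> = carrier (A i)" using A0(2) A1(2) by (simp add: A_def iso_def bij_betw_def)
    finally show ?thesis .
  qed
  ultimately have "subdirect_product I A S" by (simp add: subdirect_product_def)
  moreover have "finite I" "I \<noteq> {}" by (auto simp: I_def)
  ultimately have cl: "in_class (?P\<lparr>carrier := S\<rparr>) \<F>" using \<F> AF unfolding formation_def by blast
  have "\<theta> \<in> iso G (?P\<lparr>carrier := S\<rparr>)"
    using hom inj by (auto simp: iso_def hom_def bij_betw_def S_def)
  hence "G \<cong> ?P\<lparr>carrier := S\<rparr>" by (rule is_isoI)
  thus ?thesis using cl iso_trans by (auto simp: in_class_def)
qed

section \<open>The Frattini subgroup and a criterion for supersolubility\<close>

context group begin

lemma cyclic_section:
  assumes A: "subgroup A G" and B: "B \<lhd> G" "B \<subseteq> A" and x: "x \<in> A"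
    and gen: "\<And>a. a \<in> A \<Longrightarrow> \<exists>i::int. \<exists>b\<in>B. a = b \<otimes> x [^] i"
  shows "cyclic_group (G\<lparr>carrier := A\<rparr> Mod B)"
proof -
  let ?A = "G\<lparr>carrier := A\<rparr>"
  have "B \<lhd> ?A" by (rule normal_restrict_supergroup[OF A B])
  then interpret N: normal B ?A .
  interpret Q: group "?A Mod B" by (rule N.factorgroup_is_group)
  have Bs: "subgroup B G" by (rule normal_imp_subgroup[OF B(1)])
  have xQ: "B #> x \<in> carrier (?A Mod B)" using x by (auto simp: carrier_FactGroup)
  have pw: "(B #> x) [^]\<^bsub>?A Mod B\<^esub> i = B #> x [^] i" for i :: int
    using N.FactGroup_int_pow[of x i] x int_pow_consistent[OF A x, of i] by simp
  have "carrier (?A Mod B) = range (\<lambda>i::int. (B #> x) [^]\<^bsub>?A Mod B\<^esub> i)"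
  proof (intro equalityI subsetI)
    fix X assume "X \<in> carrier (?A Mod B)"
    then obtain a where a: "a \<in> A" "X = B #> a" by (auto simp: carrier_FactGroup)
    obtain i b where ib: "b \<in> B" "a = b \<otimes> x [^] (i::int)" using gen[OF a(1)] by blast
    have "x \<in> carrier G" "b \<in> carrier G" using x A ib(1) Bs by (auto simp: subgroup.mem_carrier)
    hence "B #> a = B #> x [^] i" using rcos_eq_iff[OF Bs, of a "x [^] i"] ib by (simp add: m_assoc)
    thus "X \<in> range (\<lambda>i::int. (B #> x) [^]\<^bsub>?A Mod B\<^esub> i)" using a pw by auto
  qed (use Q.int_pow_closed[OF xQ] in auto)
  thus ?thesis using Q.cyclic_group xQ by blast
qed

lemma frattini_normal: "frattini G \<lhd> G"
proof (rule normal_conjgI)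
  show s: "subgroup (frattini G) G"
  proof -
    have "frattini G = \<Inter> (insert (carrier G) {M. maximal_subgroup M G})" by (simp add: frattini_def)
    moreover have "subgroup (\<Inter> (insert (carrier G) {M. maximal_subgroup M G})) G"
      by (rule subgroups_Inter) (auto simp: maximal_subgroup_def subgroup_self)
    ultimately show ?thesis by simp
  qed
  fix g a assume g: "g \<in> carrier G" and a: "a \<in> frattini G"
  have aG: "a \<in> carrier G" using a by (simp add: frattini_def)
  have "conjg g a \<in> M" if M: "maximal_subgroup M G" for M
  proof -
    have Ms: "subgroup M G" and MG: "M \<subseteq> carrier G" and Mn: "M \<noteq> carrier G"
      and mx: "\<And>K. subgroup K G \<Longrightarrow> M \<subseteq> K \<Longrightarrow> K = M \<or> K = carrier G"
      using M subgroup.subset[of M G] by (auto simp: maximal_subgroup_def)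
    have undo: "conjg g ` conjg (inv g) ` X = X" "conjg (inv g) ` conjg g ` X = X" if "X \<subseteq> carrier G" for X
      using that g by (force simp: image_image subset_iff image_iff)+
    have cG: "conjg h ` carrier G = carrier G" if "h \<in> carrier G" for h
    proof
      show "carrier G \<subseteq> conjg h ` carrier G"
      proof
        fix x assume "x \<in> carrier G"
        thus "x \<in> conjg h ` carrier G" using that by (intro image_eqI[of _ _ "conjg (inv h) x"]) auto
      qed
    qed (use that in auto)
    have "maximal_subgroup (conjg (inv g) ` M) G"
      unfolding maximal_subgroup_def
    proof (intro conjI allI impI)
      show "subgroup (conjg (inv g) ` M) G" using subgroup_conjg[OF _ Ms] g by simp
      show "conjg (inv g) ` M \<noteq> carrier G" using undo(1)[OF MG] cG[OF g] Mn by metis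
      fix K assume K: "subgroup K G \<and> conjg (inv g) ` M \<subseteq> K"
      have KG: "K \<subseteq> carrier G" using K subgroup.subset by blast
      have "conjg g ` conjg (inv g) ` M \<subseteq> conjg g ` K" using K by blast
      hence "M \<subseteq> conjg g ` K" using undo(1)[OF MG] by simp
      moreover have "subgroup (conjg g ` K) G" using subgroup_conjg[OF g] K by blast
      ultimately have "conjg g ` K = M \<or> conjg g ` K = carrier G" by (rule mx[rotated])
      thus "K = conjg (inv g) ` M \<or> K = carrier G"
        using undo(2)[OF KG] cG[of "inv g"] g by auto
    qed
    hence "a \<in> conjg (inv g) ` M" using a by (auto simp: frattini_def)
    then obtain m where "m \<in> M" "a = conjg (inv g) m" by auto
    thus ?thesis using MG g by auto
  qed
  thus "conjg g a \<in> frattini G" using g aG by (auto simp: frattini_def)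
qed

end

text \<open>The multiplicative group modulo \<open>q\<close> is cyclic. Read on exponents, this says
  that the automorphisms of a group of order \<open>q\<close> are iterates of one power map.\<close>

lemma prime_primroot_powers:
  assumes q: "prime q"
  shows "\<exists>g::nat. \<not> q dvd g \<and> (\<forall>k. \<not> q dvd k \<longrightarrow> (\<exists>e. g ^ e mod q = k mod q))"
proof -
  obtain g where "residue_primroot q g" using prime_primitive_root_exists[OF prime_gt_1_nat[OF q] q] by blast
  hence g: "coprime q g" "ord q g = q - 1" by (auto simp: residue_primroot_def totient_prime[OF q])
  have q1: "q > 1" by (rule prime_gt_1_nat[OF q])
  have nd: "\<not> q dvd g ^ e" for e
    using g(1) q by (metis coprime_dvd_mult_right_iff coprime_power_right_iff dvd_refl coprime_absorb_left q1 less_irrefl is_unit_right_imp_coprime not_prime_unit)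
  have "(\<lambda>k. g ^ k mod q) ` {..<q - 1} = {1..<q}"
  proof (rule card_subset_eq)
    show "(\<lambda>k. g ^ k mod q) ` {..<q - 1} \<subseteq> {1..<q}"
      using nd q1 by (auto simp: Suc_le_eq dvd_eq_mod_eq_0 intro!: Nat.gr0I)
    show "card ((\<lambda>k. g ^ k mod q) ` {..<q - 1}) = card {1..<q}"
      using inj_power_mod[OF g(1)] g(2) by (simp add: card_image)
  qed simp
  moreover have "k mod q \<in> {1..<q}" if "\<not> q dvd k" for k
    using that q1 by (auto simp: Suc_le_eq dvd_eq_mod_eq_0 intro!: Nat.gr0I)
  ultimately have "\<exists>e. g ^ e mod q = k mod q" if "\<not> q dvd k" for k
    using that by (metis (no_types, lifting) imageE)
  moreover have "\<not> q dvd g" using nd[of 1] by simp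
  ultimately show ?thesis by blast
qed

context group begin

lemma prime_order_powers:
  assumes V: "subgroup V G" "card V = q" "prime q" and v: "v \<in> V" "v \<noteq> \<one>" and w: "w \<in> V"
  shows "\<exists>k::nat. w = v [^] k" and "v [^] (a::nat) = v [^] (a mod q)" and "conjg v w = w"
proof -
  have fV: "finite V" using V by (metis card.infinite not_prime_0)
  have vG: "v \<in> carrier G" using v V by (simp add: subgroup.mem_carrier)
  have one: "{\<one>} \<subseteq> V" using subgroup.one_closed[OF V(1)] by simp
  have n1: "g \<in> normalizes {\<one>}" if "g \<in> carrier G" for g using that by (simp add: normalizes_def)
  have "v [^] (card V div card {\<one>}) \<in> {\<one>}"
    by (rule pow_index_mem[OF V(1) fV triv_subgroup one _ v(1)]) (use n1 subgroup.mem_carrier[OF V(1)] in auto)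
  hence vq: "v [^] q = \<one>" using V(2) by simp
  show "v [^] a = v [^] (a mod q)"
  proof -
    have "v [^] a = v [^] (q * (a div q) + a mod q)" by simp
    also have "\<dots> = (v [^] q) [^] (a div q) \<otimes> v [^] (a mod q)" 
      using vG by (simp only: nat_pow_pow nat_pow_mult)
    finally show ?thesis using vq vG by simp
  qed
  have "adjoin {\<one>} v = V"
    by (rule adjoin_eq_if_prime_index[OF V(1) fV triv_subgroup one V(3) _ v(1) _ n1[OF vG]]) (use V v in auto)
  then obtain i where i: "w = \<one> \<otimes> v [^] (i::int)" using w by (auto simp: adjoin_def)
  have q0: "q > 0" using V(3) by (rule prime_gt_0_nat)
  have "v [^] i = v [^] (int q * (i div int q) + int (nat (i mod int q)))" using q0 by simp
  also have "\<dots> = (v [^] q) [^] (i div int q) \<otimes> v [^] (nat (i mod int q))"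
    using vG int_pow_mult[OF vG] int_pow_pow[OF vG, of "int q"] by (simp add: int_pow_int)
  finally have wk: "w = v [^] (nat (i mod int q))" using i vq vG by simp
  thus "\<exists>k::nat. w = v [^] k" by blast
  have "conjg v v = v" using vG by (simp add: conjg_def m_assoc)
  thus "conjg v w = w" unfolding wk using vG by (simp add: conjg_pow)
qed

text \<open>The kernel of the action of \<open>G\<close> on \<open>V\<close> is \<open>V\<close>, so
  \<open>G/V\<close> embeds into the cyclic automorphism group of \<open>V\<close>, and the series
  through \<open>V\<close> has cyclic factors. A generator of \<open>G/V\<close> is found directly
  from the exponents.\<close>

lemma supersoluble_if_self_centralizing_prime_order:
  assumes V: "V \<lhd> G" "card V = q" "prime q"
    and cent: "\<And>x. x \<in> carrier G \<Longrightarrow> (\<And>v. v \<in> V \<Longrightarrow> conjg x v = v) \<Longrightarrow> x \<in> V"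
  shows "supersoluble G"
proof -
  have Vs: "subgroup V G" by (rule normal_imp_subgroup[OF V(1)])
  have "V \<noteq> {\<one>}" using V(2,3) by auto
  then obtain v where v: "v \<in> V" "v \<noteq> \<one>" using subgroup.one_closed[OF Vs] by blast
  have vG: "v \<in> carrier G" using v Vs by (simp add: subgroup.mem_carrier)
  note pow = prime_order_powers(1)[OF Vs V(2,3) v] and red = prime_order_powers(2)[OF Vs V(2,3) v v(1)]
  obtain \<rho> :: nat where \<rho>: "\<And>k. \<not> q dvd k \<Longrightarrow> \<exists>e. \<rho> ^ e mod q = k mod q"
    using prime_primroot_powers[OF V(3)] by blast
  \<comment> \<open>\<open>R g e\<close> says that \<open>g\<close> acts on \<open>V\<close> as the
    power map with exponent \<open>\<rho> ^ e\<close>. The number \<open>e\<close> is not unique,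
    but such numbers add under products, and \<open>R x 0\<close> forces \<open>x\<close> into
    \<open>V\<close>.\<close>
  define R where "R g e \<longleftrightarrow> g \<in> carrier G \<and> conjg g v = v [^] (\<rho> ^ e)" for g e
  have Rex: "\<exists>e. R g e" if g: "g \<in> carrier G" for g
  proof -
    obtain k where k: "conjg g v = v [^] (k::nat)" using pow[OF normal_conjg[OF V(1) g v(1)]] by blast
    have "\<not> q dvd k"
    proof
      assume "q dvd k"
      hence "conjg g v = \<one>" using k red[of k] by simp
      hence "conjg (inv g) (conjg g v) = \<one>" using g by simp
      thus False using g vG v(2) by simp
    qed
    then obtain e where "\<rho> ^ e mod q = k mod q" using \<rho> by blast
    hence "conjg g v = v [^] (\<rho> ^ e)" using k red[of k] red[of "\<rho> ^ e"] by simp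
    thus ?thesis using g by (auto simp: R_def)
  qed
  have Rm: "R (g \<otimes> h) (d + e)" if "R g d" "R h e" for g h d e
  proof -
    have "conjg (g \<otimes> h) v = conjg g (v [^] (\<rho> ^ e))" using that vG by (simp add: R_def conjg_conjg)
    also have "\<dots> = v [^] (\<rho> ^ d * \<rho> ^ e)" using that vG by (simp add: R_def conjg_pow nat_pow_pow)
    finally show ?thesis using that by (simp add: R_def power_add)
  qed
  have all: "x \<in> V" if "R x 0" for x
  proof (rule cent)
    show xG: "x \<in> carrier G" using that by (simp add: R_def)
    have xv: "conjg x v = v" using that vG by (simp add: R_def)
    fix w assume "w \<in> V"
    then obtain k where "w = v [^] (k::nat)" using pow by blast
    thus "conjg x w = w" using xv xG vG by (simp add: conjg_pow)
  qed
  have gen: "\<exists>\<gamma>\<in>carrier G. \<forall>a\<in>carrier G. \<exists>i::int. \<exists>b\<in>V. a = b \<otimes> \<gamma> [^] i"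
  proof (cases "\<exists>e>0. \<exists>g. R g e")
    case False
    have "a \<in> V" if a: "a \<in> carrier G" for a
    proof -
      obtain e where "R a e" using Rex[OF a] by blast
      moreover from this have "e = 0" using False by auto
      ultimately show ?thesis using all by simp
    qed
    hence "\<exists>b\<in>V. a = b \<otimes> \<one> [^] (0::int)" if "a \<in> carrier G" for a
      using that by (intro bexI[of _ a]) auto
    thus ?thesis by (meson one_closed)
  next
    case True
    \<comment> \<open>Division by the least positive exponent \<open>e0\<close> leaves an element
      with a remainder below \<open>e0\<close>, hence 0, so \<open>\<gamma>\<close> generates
      \<open>G\<close> modulo \<open>V\<close>.\<close>
    define e0 where "e0 = (LEAST e. e > 0 \<and> (\<exists>g. R g e))"
    have "e0 > 0 \<and> (\<exists>g. R g e0)" unfolding e0_def by (rule LeastI_ex) (use True in blast)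
    then obtain \<gamma> where e0: "e0 > 0" and \<gamma>: "R \<gamma> e0" by blast
    have least: "r = 0" if "R x r" "r < e0" for x r
      using not_less_Least[of r "\<lambda>e. e > 0 \<and> (\<exists>g. R g e)"] that e0_def by auto
    have \<gamma>G: "\<gamma> \<in> carrier G" using \<gamma> by (simp add: R_def)
    have \<gamma>t: "R (\<gamma> [^] t) (e0 * t)" for t :: nat
    proof (induction t)
      case 0 show ?case using vG by (simp add: R_def)
    next
      case (Suc t)
      show ?case using Rm[OF Suc \<gamma>] by (simp add: add.commute)
    qed
    have "\<exists>i::int. \<exists>b\<in>V. a = b \<otimes> \<gamma> [^] i" if a: "a \<in> carrier G" for a
    proof -
      obtain e where e: "R a e" using Rex[OF a] by blast
      define t where "t = e div e0"
      define g where "g = \<gamma> [^] t"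
      define y where "y = inv g \<otimes> a"
      have gG: "g \<in> carrier G" and yG: "y \<in> carrier G" using \<gamma>G a by (auto simp: g_def y_def)
      have gy: "g \<otimes> y = a" using gG a by (simp add: y_def)
      have "conjg g (conjg y v) = v [^] (\<rho> ^ (e0 * t + e mod e0))"
        using e gy gG yG vG by (simp add: R_def t_def flip: conjg_conjg)
      also have "\<dots> = conjg g (v [^] (\<rho> ^ (e mod e0)))"
        using \<gamma>t[of t] gG vG by (simp add: R_def conjg_pow nat_pow_pow power_add flip: g_def)
      finally have "conjg (inv g) (conjg g (conjg y v)) = conjg (inv g) (conjg g (v [^] (\<rho> ^ (e mod e0))))" by simp
      hence "R y (e mod e0)" using gG yG vG by (simp add: R_def)
      moreover from this have "e mod e0 = 0" by (rule least) (use e0 in simp)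
      ultimately have "y \<in> V" using all by simp
      hence "conjg g y \<in> V" by (rule normal_conjg[OF V(1) gG])
      moreover have "a = conjg g y \<otimes> \<gamma> [^] (int t)"
        using gG yG by (simp add: conjg_def m_assoc int_pow_int flip: g_def gy)
      ultimately show ?thesis by blast
    qed
    thus ?thesis using \<gamma>G by blast
  qed
  define S where "S i = (if i = 0 then {\<one>} else if i = Suc 0 then V else carrier G)" for i :: nat
  have one: "{\<one>} \<subseteq> V" using subgroup.one_closed[OF Vs] by simp
  have "cyclic_group (G\<lparr>carrier := V\<rparr> Mod {\<one>})"
  proof (rule cyclic_section[OF Vs one_is_normal one v(1)])
    fix a assume "a \<in> V"
    then obtain k where "a = v [^] (k::nat)" using pow by blast
    hence "a = \<one> \<otimes> v [^] (int k)" using vG by (simp add: int_pow_int)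
    thus "\<exists>i::int. \<exists>b\<in>{\<one>}. a = b \<otimes> v [^] i" by blast
  qed
  moreover obtain \<gamma> where "\<gamma> \<in> carrier G" "\<And>a. a \<in> carrier G \<Longrightarrow> \<exists>i::int. \<exists>b\<in>V. a = b \<otimes> \<gamma> [^] i"
    using gen by blast
  hence "cyclic_group (G\<lparr>carrier := carrier G\<rparr> Mod V)"
    by (intro cyclic_section[OF subgroup_self V(1) subgroup.subset[OF Vs]])
  ultimately have "cyclic_group (G\<lparr>carrier := S (Suc i)\<rparr> Mod S i)" if "i < 2" for i
    using that by (auto simp: S_def less_2_cases_iff)
  moreover have "S i \<lhd> G" for i using V(1) one_is_normal normal_self by (simp add: S_def)
  moreover have "S i \<subseteq> S (Suc i)" for i using one subgroup.subset[OF Vs] by (auto simp: S_def)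
  ultimately show ?thesis
    unfolding supersoluble_def by (intro exI[of _ 2] exI[of _ S]) (auto simp: S_def)
qed

end

section \<open>Extensions by normal subgroups of prime order\<close>

lemma in_class_extension_by_prime_order_nat:
  fixes G :: "nat monoid" (structure)
  assumes \<F>: "formation \<F>" "saturated \<F>" "supersoluble_groups \<subseteq> \<F>"
    and "group G" and fG: "finite (carrier G)" and V: "V \<lhd> G" "card V = q" "prime q" and GV: "in_class (G Mod V) \<F>"
  shows "in_class G \<F>"
proof -
  interpret group G by (rule assms(4))
  interpret V: normal V G by (rule V(1))
  have Vs: "subgroup V G" by (rule normal_imp_subgroup[OF V(1)])
  have fV: "finite V" using V by (metis card.infinite not_prime_0)
  note VG = subgroup.mem_carrier[OF Vs]
  show ?thesis
  proof (cases "V \<subseteq> frattini G")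
    case True
    interpret F: normal "frattini G" G by (rule frattini_normal)
    have "in_class (G Mod frattini G) \<F>"
    proof (rule in_class_image_of_quotient[OF \<F>(1) V(1) GV F.factorgroup_is_group F.r_coset_hom_Mod])
      show "(\<lambda>a. frattini G #> a) ` carrier G = carrier (G Mod frattini G)" by (simp add: carrier_FactGroup)
      show "frattini G #> v = \<one>\<^bsub>G Mod frattini G\<^esub>" if "v \<in> V" for v
        using coset_join2[OF VG[OF that] F.is_subgroup] that True by auto
    qed
    hence "G \<in> \<F>" using \<F>(2) group_axioms fG by (simp add: saturated_def finite_group_def)
    thus ?thesis unfolding in_class_def by (blast intro: iso_refl)
  next
    case False
    then obtain M where M: "maximal_subgroup M G" "\<not> V \<subseteq> M" using VG by (auto simp: frattini_def)
    have Ms: "subgroup M G" and mx: "\<And>K. subgroup K G \<Longrightarrow> M \<subseteq> K \<Longrightarrow> K = M \<or> K = carrier G"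
      using M by (auto simp: maximal_subgroup_def)
    note MG = subgroup.mem_carrier[OF Ms]
    note MV = subgroup_set_mult_normal[OF Ms V(1)]
    have "M <#> V = carrier G" using mx[OF MV(1,3)] MV(2) M(2) by auto
    have VM: "V \<inter> M = {\<one>}"
    proof -
      have s: "subgroup (V \<inter> M) G" by (rule subgroups_Inter_pair[OF Vs Ms])
      have "card (V \<inter> M) dvd q" using card_subgroup_dvd[OF Vs s _] V(2) by simp
      moreover have "card (V \<inter> M) \<noteq> q"
      proof
        assume "card (V \<inter> M) = q"
        hence "V \<inter> M = V" using V(2) fV by (intro card_subset_eq) auto
        thus False using M(2) by auto
      qed
      ultimately have "card (V \<inter> M) = 1" using V(3) by (metis prime_nat_iff)
      thus ?thesis using subgroup.one_closed[OF s] by (metis card_1_singletonE singletonD)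
    qed
    have "V \<noteq> {\<one>}" using V(2,3) by auto
    then obtain v where v: "v \<in> V" "v \<noteq> \<one>" using subgroup.one_closed[OF Vs] by blast
    have Vab: "conjg u w = w" if "u \<in> V" "w \<in> V" for u w
      using prime_order_powers(3)[OF Vs V(2,3) that(1) _ that(2)] VG[OF that(2)] by (cases "u = \<one>") auto
    \<comment> \<open>This is the centralizer of \<open>V\<close> in the complement
      \<open>M\<close>. It is normal in \<open>G\<close> because \<open>M\<close> normalizes it,
      \<open>V\<close> centralizes it, and \<open>G\<close> is the product of \<open>M\<close> and
      \<open>V\<close>.\<close>
    define C where "C = {m \<in> M. \<forall>w\<in>V. conjg m w = w}"
    have Cs: "subgroup C G"
    proof -
      have "C = {m \<in> M. \<forall>w\<in>V. conjg m w \<otimes> inv w \<in> {\<one>}}"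
        using conjg_eq_iff(1) MG VG by (auto simp: C_def)
      moreover have "V \<subseteq> carrier G" using VG by blast
      ultimately show ?thesis using subgroup_commuting_mod[OF one_is_normal _ Ms, of V] by simp
    qed
    have Cn: "C \<lhd> G"
    proof (rule normal_conjgI[OF Cs])
      fix g c assume g: "g \<in> carrier G" and c: "c \<in> C"
      have cM: "c \<in> M" and cG: "c \<in> carrier G" using c MG by (auto simp: C_def)
      obtain m u where mu: "m \<in> M" "u \<in> V" "g = m \<otimes> u"
        using g unfolding \<open>M <#> V = carrier G\<close>[symmetric] by (auto simp: set_mult_def)
      have G: "m \<in> carrier G" "u \<in> carrier G" using mu MG VG by auto
      have "conjg c u = u" using c mu(2) by (simp add: C_def)
      hence "c \<otimes> u = u \<otimes> c" using cG G by (metis conjg_def inv_solve_right' m_closed)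
      hence "conjg u c = c" using cG G by (simp add: conjg_def m_assoc flip: \<open>c \<otimes> u = u \<otimes> c\<close>)
      hence gc: "conjg g c = conjg m c" using mu(3) G cG by (simp add: conjg_conjg)
      have "conjg m c \<in> M" using mu(1) cM Ms by (simp add: conjg_def subgroup.m_closed subgroup.m_inv_closed)
      moreover have "conjg (conjg m c) w = w" if w: "w \<in> V" for w
      proof -
        have "conjg (inv m) w \<in> V" using normal_conjg[OF V(1)] G w by simp
        hence "conjg c (conjg (inv m) w) = conjg (inv m) w" using c by (simp add: C_def)
        hence "conjg m (conjg c (conjg (inv m) w)) = w" using G VG[OF w] by simp
        moreover have "conjg m (conjg c (conjg (inv m) w)) = conjg (conjg m c) w"
          using G cG VG[OF w] by (simp add: conjg_def m_assoc inv_mult_group)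
        ultimately show ?thesis by simp
      qed
      ultimately show "conjg g c \<in> C" using gc by (simp add: C_def)
    qed
    have VC: "V \<inter> C = {\<one>}" using VM subgroup.one_closed[OF Cs] subgroup.one_closed[OF Vs] by (auto simp: C_def)
    interpret C: normal C G by (rule Cn)
    let ?Q = "G Mod C" and ?\<pi> = "\<lambda>x. C #> x"
    interpret \<pi>: group_hom G ?Q ?\<pi> by (rule group_hom_Mod[OF Cn])
    have fQ: "finite (carrier ?Q)" using fG by (simp add: carrier_FactGroup)
    obtain K :: "nat monoid" where K: "group K" "finite (carrier K)" "?Q \<cong> K"
      using nat_copy_exists[OF \<pi>.H.group_axioms fQ] by blast
    then obtain f where f: "f \<in> iso ?Q K" by (auto simp: is_iso_def)
    define h where "h = f \<circ> ?\<pi>"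
    have hhom: "h \<in> hom G K" unfolding h_def by (rule Group.hom_compose[OF \<pi>.homh]) (use f in \<open>simp add: iso_def\<close>)
    interpret h: group_hom G K h using hhom K(1) group_axioms by (simp add: group_hom_def group_hom_axioms_def)
    have hsurj: "h ` carrier G = carrier K"
    proof -
      have "h ` carrier G = f ` carrier ?Q" by (simp add: h_def image_comp carrier_FactGroup)
      thus ?thesis using f by (simp add: iso_def bij_betw_def)
    qed
    have hker: "h x = \<one>\<^bsub>K\<^esub> \<longleftrightarrow> x \<in> C" if x: "x \<in> carrier G" for x
    proof -
      have "f \<one>\<^bsub>?Q\<^esub> = \<one>\<^bsub>K\<^esub>" by (rule hom_one) (use f K(1) \<pi>.H.group_axioms in \<open>simp_all add: iso_def\<close>)
      moreover have "inj_on f (carrier ?Q)" using f by (simp add: iso_def bij_betw_def)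
      moreover have "?\<pi> x \<in> carrier ?Q" using x by simp
      moreover have "\<one>\<^bsub>?Q\<^esub> \<in> carrier ?Q" by (rule \<pi>.H.one_closed)
      ultimately have "h x = \<one>\<^bsub>K\<^esub> \<longleftrightarrow> ?\<pi> x = \<one>\<^bsub>?Q\<^esub>" unfolding h_def comp_def by (metis inj_onD)
      also have "\<dots> \<longleftrightarrow> x \<in> C" using coset_join2[OF x Cs] rcos_self[OF x Cs] by auto
      finally show ?thesis .
    qed
    have hVn: "h ` V \<lhd> K" by (rule V.surj_hom_normal_subgroup[OF h.group_hom_axioms hsurj])
    have "card (h ` V) * card {b \<in> V. h b = \<one>\<^bsub>K\<^esub>} = card V"
      by (rule card_hom_image_subgroup(2)[OF K(1) Vs fV]) (use VG in auto)
    moreover have "{b \<in> V. h b = \<one>\<^bsub>K\<^esub>} = {\<one>}" using hker VG VC subgroup.one_closed[OF Vs] by auto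
    ultimately have chV: "card (h ` V) = q" using V(2) by simp
    \<comment> \<open>In the quotient by \<open>C\<close> the image of \<open>V\<close> is
      self-centralizing: an element centralizing \<open>V\<close> modulo \<open>C\<close>
      centralizes it outright because \<open>V \<inter> C\<close> is trivial, and its factor in
      \<open>M\<close> then lies in \<open>C\<close>.\<close>
    have "supersoluble K"
    proof (rule h.H.supersoluble_if_self_centralizing_prime_order[OF hVn chV V(3)])
      fix y assume y: "y \<in> carrier K" and cy: "\<And>w. w \<in> h ` V \<Longrightarrow> h.H.conjg y w = w"
      obtain x where x: "x \<in> carrier G" "y = h x" using y hsurj by auto
      have cx: "conjg x w = w" if w: "w \<in> V" for w
      proof -
        have wG: "w \<in> carrier G" by (rule VG[OF w])
        have "h (conjg x w) = h w" using cy[of "h w"] w x wG by (simp add: h.H.conjg_def conjg_def)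
        hence "h (conjg x w \<otimes> inv w) = \<one>\<^bsub>K\<^esub>" using x wG by simp
        hence "conjg x w \<otimes> inv w \<in> C" by (rule iffD1[OF hker, rotated]) (use x wG in auto)
        moreover have "conjg x w \<otimes> inv w \<in> V"
          using normal_conjg[OF V(1) x(1) w] w Vs by (simp add: subgroup.m_closed subgroup.m_inv_closed)
        ultimately have "conjg x w \<otimes> inv w = \<one>" using VC by auto
        thus ?thesis using conjg_eq_iff(1)[OF x(1) wG] by simp
      qed
      obtain m u where mu: "m \<in> M" "u \<in> V" "x = m \<otimes> u"
        using x(1) unfolding \<open>M <#> V = carrier G\<close>[symmetric] by (auto simp: set_mult_def)
      have G: "m \<in> carrier G" "u \<in> carrier G" using mu MG VG by auto
      have "conjg m w = w" if w: "w \<in> V" for w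
      proof -
        have "conjg m (conjg u w) = w" using cx[OF w] mu(3) G VG[OF w] by (simp add: conjg_conjg)
        thus ?thesis using Vab[OF mu(2) w] by simp
      qed
      hence "m \<in> C" using mu(1) by (simp add: C_def)
      hence "y = h u" using x(2) mu(3) G hker[OF G(1)] by simp
      thus "y \<in> h ` V" using mu(2) by simp
    qed
    hence "K \<in> \<F>" using \<F>(3) K(1,2) by (auto simp: supersoluble_groups_def finite_group_def)
    hence "in_class ?Q \<F>" using K(3) by (auto simp: in_class_def)
    thus ?thesis by (rule in_class_subdirect[OF \<F>(1) V(1) Cn VC GV])
  qed
qed

text \<open>Saturation is formulated for groups of natural numbers, so the argument is carried out
  on a copy and brought back along the isomorphism.\<close>

lemma in_class_extension_by_prime_order:
  fixes G :: "('a, 'b) monoid_scheme" (structure)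
  assumes \<F>: "formation \<F>" "saturated \<F>" "supersoluble_groups \<subseteq> \<F>"
    and "group G" and fG: "finite (carrier G)" and V: "V \<lhd> G" "card V = q" "prime q" and GV: "in_class (G Mod V) \<F>"
  shows "in_class G \<F>"
proof -
  interpret group G by (rule assms(4))
  obtain H :: "nat monoid" where H: "group H" "finite (carrier H)" "G \<cong> H"
    using nat_copy_exists[OF group_axioms fG] by blast
  then obtain f where f: "f \<in> iso G H" by (auto simp: is_iso_def)
  have fV: "f ` V \<lhd> H" by (rule iso_normal_subgroup[OF f group_axioms H(1) V(1)])
  interpret FV: normal "f ` V" H by (rule fV)
  have "V \<subseteq> carrier G" by (rule subgroup.subset[OF normal_imp_subgroup[OF V(1)]])
  moreover have "inj_on f (carrier G)" using f by (simp add: iso_def bij_betw_def)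
  ultimately have cV: "card (f ` V) = q" using V(2) by (metis card_image inj_on_subset)
  have "in_class (H Mod f ` V) \<F>"
  proof (rule in_class_image_of_quotient[OF \<F>(1) V(1) GV FV.factorgroup_is_group])
    show "(\<lambda>y. f ` V #>\<^bsub>H\<^esub> y) \<circ> f \<in> hom G (H Mod f ` V)"
      using f FV.r_coset_hom_Mod by (intro Group.hom_compose) (auto simp: iso_def)
    have "carrier H = f ` carrier G" using f by (simp add: iso_def bij_betw_def)
    thus "((\<lambda>y. f ` V #>\<^bsub>H\<^esub> y) \<circ> f) ` carrier G = carrier (H Mod f ` V)"
      by (simp add: image_image carrier_FactGroup)
    fix v assume "v \<in> V"
    hence fv: "f v \<in> f ` V" by simp
    thus "((\<lambda>y. f ` V #>\<^bsub>H\<^esub> y) \<circ> f) v = \<one>\<^bsub>H Mod f ` V\<^esub>"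
      using FV.coset_join2[OF FV.mem_carrier[OF fv] FV.is_subgroup fv] by simp
  qed
  hence "in_class H \<F>"
    by (rule in_class_extension_by_prime_order_nat[OF \<F> H(1,2) fV cV V(3)])
  thus ?thesis by (rule in_class_iso[OF _ H(1) iso_sym[OF H(3)]])
qed

text \<open>Membership passes down the chain from \<open>G Mod N\<close> to
  \<open>G Mod {\<one>}\<close>: for a link from \<open>B\<close> to \<open>C\<close>,
  \<open>G Mod B\<close> has the normal subgroup \<open>C/B\<close> of prime order, and the quotient
  by it is an image of \<open>G Mod C\<close>.\<close>

lemma in_class_if_hypercyclic_quotient:
  fixes G :: "('a, 'b) monoid_scheme" (structure)
  assumes \<F>: "formation \<F>" "saturated \<F>" "supersoluble_groups \<subseteq> \<F>"
    and "group G" and fG: "finite (carrier G)"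
    and ch: "(group.prime_step G)\<^sup>*\<^sup>* {\<one>} N" and GN: "in_class (G Mod N) \<F>"
  shows "in_class G \<F>"
proof -
  interpret group G by (rule assms(4))
  have "in_class (G Mod {\<one>}) \<F>"
    using ch
  proof (induction rule: converse_rtranclp_induct)
    case base
    show ?case by (rule GN)
  next
    case (step B C)
    obtain q where BC: "B \<lhd> G" "C \<lhd> G" "B \<subseteq> C" "prime q" "card C = q * card B"
      using step(1) by (auto simp: prime_step_def)
    have s: "subgroup B G" "subgroup C G" using BC normal_imp_subgroup by auto
    have fin: "finite C" "finite B" using finite_subset[OF _ fG] s subgroup.subset by auto
    have cB: "card B > 0" by (rule card_subgroup_pos[OF s(1) fin(2)])
    let ?Q = "G Mod B" and ?\<pi> = "\<lambda>x. B #> x"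
    interpret \<pi>: group_hom G ?Q ?\<pi> by (rule group_hom_Mod[OF BC(1)])
    define V where "V = ?\<pi> ` C"
    have Vn: "V \<lhd> ?Q" unfolding V_def by (rule Mod_image_normal[OF BC(1,2)])
    interpret V: normal V ?Q by (rule Vn)
    have cV: "card V = q" using card_subgroup_cosets[OF s(2,1) BC(3)] BC(5) cB by (simp add: V_def)
    have fQ: "finite (carrier ?Q)" using fG by (simp add: carrier_FactGroup)
    have "in_class (?Q Mod V) \<F>"
    proof (rule in_class_image_of_quotient[OF \<F>(1) BC(2) step.IH V.factorgroup_is_group])
      show "(\<lambda>y. V #>\<^bsub>?Q\<^esub> y) \<circ> ?\<pi> \<in> hom G (?Q Mod V)"
        using \<pi>.homh V.r_coset_hom_Mod by (rule Group.hom_compose)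
      show "((\<lambda>y. V #>\<^bsub>?Q\<^esub> y) \<circ> ?\<pi>) ` carrier G = carrier (?Q Mod V)"
        by (simp add: image_image carrier_FactGroup)
      fix c assume "c \<in> C"
      hence cV: "?\<pi> c \<in> V" by (simp add: V_def)
      thus "((\<lambda>y. V #>\<^bsub>?Q\<^esub> y) \<circ> ?\<pi>) c = \<one>\<^bsub>?Q Mod V\<^esub>"
        using \<pi>.H.coset_join2[OF V.mem_carrier[OF cV] V.is_subgroup cV] by simp
    qed
    thus ?case by (rule in_class_extension_by_prime_order[OF \<F> \<pi>.H.group_axioms fQ Vn cV BC(4)])
  qed
  moreover have "group (G Mod {\<one>})" by (rule normal.factorgroup_is_group[OF one_is_normal])
  moreover have "G Mod {\<one>} \<cong> G" by (rule is_isoI[OF trivial_factor_iso])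
  ultimately show ?thesis by (rule in_class_iso)
qed

theorem theorem1p6:
  fixes \<F> :: "nat monoid set"
    and G :: "('a, 'b) monoid_scheme"
    and N :: "'a set"
  assumes "formation \<F>" and "saturated \<F>" and "supersoluble_groups \<subseteq> \<F>"
    and "finite_group G" and "N \<lhd> G" and "in_class (G Mod N) \<F>"
    and "\<And>p P M. \<lbrakk>prime p; p dvd card N; sylow_subgroup p P (G\<lparr>carrier := N\<rparr>);
            maximal_subgroup M (G\<lparr>carrier := P\<rparr>)\<rbrakk>
          \<Longrightarrow> partial_Pi_property M (G\<lparr>carrier := normalizer G P\<rparr>)"
    and "\<And>p P. \<lbrakk>prime p; p dvd card N; sylow_subgroup p P (G\<lparr>carrier := N\<rparr>)\<rbrakk>
          \<Longrightarrow> partial_Pi_property (derived G P) G"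
  shows "in_class G \<F>"
proof -
  have G: "group G" and fG: "finite (carrier G)" using assms(4) by (auto simp: finite_group_def)
  interpret group G by (rule G)
  have Ns: "subgroup N G" by (rule normal_imp_subgroup[OF assms(5)])
  have fN: "finite N" by (rule finite_subset[OF subgroup.subset[OF Ns] fG])
  have "prime_step\<^sup>*\<^sup>* {\<one>\<^bsub>G\<^esub>} N"
    by (rule normal_hypercyclic[OF fG assms(5)])
      (use assms(7,8) sylow_in_iff_sylow_subgroup[OF Ns fN] in auto)
  thus ?thesis by (rule in_class_if_hypercyclic_quotient[OF assms(1-3) G fG _ assms(6)])
qed

end
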